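(* Let $Q,h,\delta>0$. There is $N(\delta,Q)$ (depending also on the fixed ellipticity constant $\kappa$) such that the following holds whenever $V_N\in\mathcal A_{h,\delta}$, $q\equiv|M_h^-(V_N)|\le Q$ and $N\ge N(\delta,Q)$. Write $M_h^-=M_h^-(V_N)=\{x_1,\dots,x_q\}$ for the special labeling of the $h$-minima, $S_{h,k}=\{x_1,\dots,x_k\}\cup\{-1,1\}$ for $0\le k\le q$, and $d_k=V_N(z^*(x_k,S_{h,k-1}))-V_N(x_k)$ for $1\le k\le q$. (1) With $\lambda_N^*\equiv\min\sigma\big(\mathcal L^{(N)}(I_N\setminus M_h^-)\big)$, the operator $\mathcal L^{(N)}(I_N)$ has exactly $q$ eigenvalues smaller than $\lambda_N^*$: $$\sigma(\mathcal L^{(N)}(I_N))\cap[0,\lambda_N^* )=\{\lambda_1^{(N)}<\lambda_2^{(N)}<\cdots<\lambda_q^{(N)}\}.$$ (2) $\lambda_N^*\ge N^{-2}e^{-h\sqrt N}$. (3) For $1\le k\le q$ define $h_k$ on $I_N$ by $h_k(x)=P^\omega_{N,x}(\tau_{x_k}<\tau_{S_{h,k-1}})$ if $x\notin S_{h,k}$, $h_k(x_k)=1$, and $h_k(x)=0$ if $x\in S_{h,k-1}$. Let $\|\cdot\|_2$ be the norm of $L^2(I_N,\mu_N)$. Then for $1\le k\le q$ $$\lambda_k^{(N)}=\frac{\mu_N(x_k)\,P^\omega_{N,x_k}(\tau_{S_{h,k-1}}<\tau_{x_k})}{\|h_k\|_2^2}\Big(1+O\big(e^{-(\delta/10)\sqrt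 N}\big)\Big)$$ (with the constant in $O(\cdot)$ depending only on $\kappa,\delta,Q$), and $$c(\kappa)N^{-2}e^{-\sqrt N d_k}\le\lambda_k^{(N)}\le c'(\kappa)e^{-\sqrt N d_k}.$$ (4) For $1\le k\le q$ there exists a normalized eigenvector $\psi_k^{(N)}$ of $\mathcal L^{(N)}(I_N)$ with eigenvalue $\lambda_k^{(N)}$ such that $$\Big\|\psi_k^{(N)}-\frac{h_k}{\|h_k\|_2}\Big\|_2\le e^{-(\delta/10)\sqrt N}.$$ Here $c(\kappa),c'(\kappa)$ are positive constants depending only on $\kappa$.
   Context: Fix $\kappa>0$ and an environment $\omega=(\omega_x)_{x\in\mathbb Z}$ with $\omega_x\in[\kappa,1-\kappa]$ for all $x$. $(X_n)_{n\ge0}$ is the nearest-neighbour random walk on $\mathbb Z$ jumping from $x$ to $x+1$ with probability $\omega_x$ and to $x-1$ with probability $1-\omega_x$. The potential is $V(0)=0$, $V(x)=\sum_{i=1}^x\ln\frac{1-\omega_i}{\omega_i}$ for $x\ge1$, $V(x)=-\sum_{i=x+1}^0\ln\frac{1-\omega_i}{\omega_i}$ for $x\le-1$. For an integer $N\ge1$, $\mathbb Z/N=\{k/N:k\in\mathbb Z\}$, $V^{(N)}\in C(\mathbb R)$ is the linear interpolation of the values $V^{(N)}(k/N)=V(k)/\sqrt N$, $k\in\mathbb Z$, and $V_N$ is the restriction of $V^{(N)}$ to $[-1,1]$. Put $\mu(x)=e^{-V(x)}/\omega_x$ for $x\in\mathbb Z$, $\mu_N(x)=\mu(Nx)$ for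 $x\in\mathbb Z/N$, $I_N=(-1,1)\cap\mathbb Z/N$. The rescaled generator is $(\mathcal L^{(N)}f)(x)=f(x)-\omega_{Nx}f(x+\tfrac1N)-(1-\omega_{Nx})f(x-\tfrac1N)$, $x\in\mathbb Z/N$, and for finite $D\subset\mathbb Z/N$, $\mathcal L^{(N)}(D)=(\mathcal L^{(N)}_{x,y})_{x,y\in D}$ (Dirichlet conditions outside $D$), which is symmetric on $L^2(D,\mu_N)$; $\sigma(\cdot)$ denotes the spectrum. $P^\omega_{N,x}$ is the law of $(X_n/N)_{n\ge0}$ started at $x\in\mathbb Z/N$, and $\tau_A=\min\{n\ge1:X_n/N\in A\}$. $h$-minima. Let $\gamma\in C([-1,1])$, $h>0$. A point $x\in[-1,1]$ is an $h$-minimum if there are $a,b\in[-1,1]$ with $a<x<b$, $\gamma(a)\ge\gamma(x)+h$, $\gamma(b)\ge\gamma(x)+h$, $\gamma(x)=\min_{[a,b]}\gamma$. Two $h$-minima $x,x'$ are called equivalent ($x\sim x'$) if $\max_{z\in[x\wedge x',x\vee x']}|\gamma(z)-\gamma(x)|<h$; there are finitely many equivalence classes, each closed, and $M_h^-(\gamma)$ is the (finite) set consisting of the smallest element of each class. Saddles. For disjoint finite $A,B\subset[-1,1]$, $Z(A,B)$ is the set of $z\in[-1,1]$ such that there are $a\in A$, $b\in B$ with $a\wedge b\le z\le a\vee b$ and $\gamma(z)=\min_{a'\in A,b'\in B}\max_{a'\wedge b'\le x\le a'\vee b'}\gamma(x)$; $z^*(A,B)=\min Z(A,B)$ (singletons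 are identified with points). For $V_N$, saddles are taken with $\gamma=V_N$. Good paths. $\mathcal A_{h,\delta}$ is the set of $\gamma\in C([-1,1])$ such that: $M_h^-(\gamma)\ne\varnothing$; $\gamma(z^*(x,(M_h^-(\gamma)\cup\{-1,1\})\setminus\{x\}))-\gamma(x)\ge h+\delta$ for all $x\in M_h^-(\gamma)$; and, for a suitable labeling $M_h^-(\gamma)=\{x_1,\dots,x_q\}$, setting $S_{h,0}=\{-1,1\}$, $S_{h,k}=\{x_1,\dots,x_k\}\cup\{-1,1\}$, one has for all $1\le k\le q-1$ $$\gamma(z^*(x_k,S_{h,k-1}))-\gamma(x_k)\ge\max_{k<j\le q}\{\gamma(z^*(x_j,S_{h,k-1}))-\gamma(x_j)\}+\delta.$$ For $\gamma\in\mathcal A_{h,\delta}$ this labeling is unique and is called the special labeling.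
   Formalization: In (2) the bound is proved as λ*_N ≥ c(κ) N^{-2} e^{-h√N} with c(κ)>0 depending only on κ; with prefactor 1 it fails, e.g. for a wide flat non-h-minimum valley next to a wide plateau just below height h, where λ*_N ≈ ½ N^{-2} e^{-h√N}. *)

theory Defs
  imports "HOL-Probability.Probability"
begin

section \<open>\<open>h\<close>-minima, saddles and good paths\<close>

text \<open>A path in \<open>C([-1,1])\<close> is a function on the reals that is continuous on \<open>{-1..1}\<close>;
  none of the notions below depends on its values outside \<open>{-1..1}\<close>.\<close>

definition h_minimum :: "real \<Rightarrow> (real \<Rightarrow> real) \<Rightarrow> real \<Rightarrow> bool" where
  "h_minimum h \<gamma> x \<longleftrightarrow> x \<in> {-1..1} \<and>
     (\<exists>a\<in>{-1..1}. \<exists>b\<in>{-1..1}. a < x \<and> x < b \<and> \<gamma> a \<ge> \<gamma> x + h \<and> \<gamma> b \<ge> \<gamma> x + h \<and>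
        (\<forall>z\<in>{a..b}. \<gamma> x \<le> \<gamma> z))"

definition h_equiv :: "real \<Rightarrow> (real \<Rightarrow> real) \<Rightarrow> real \<Rightarrow> real \<Rightarrow> bool" where
  "h_equiv h \<gamma> x x' \<longleftrightarrow> (\<forall>z\<in>{min x x'..max x x'}. \<bar>\<gamma> z - \<gamma> x\<bar> < h)"

definition h_minima :: "real \<Rightarrow> (real \<Rightarrow> real) \<Rightarrow> real set" where
  "h_minima h \<gamma> = {x. h_minimum h \<gamma> x \<and> (\<forall>y. h_minimum h \<gamma> y \<and> h_equiv h \<gamma> x y \<longrightarrow> x \<le> y)}"

text \<open>The supremum over the compact interval is a maximum, \<open>\<gamma>\<close> being continuous.\<close>

definition saddle_height :: "(real \<Rightarrow> real) \<Rightarrow> real set \<Rightarrow> real set \<Rightarrow> real" where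
  "saddle_height \<gamma> A B = Min ((\<lambda>(a, b). SUP x\<in>{min a b..max a b}. \<gamma> x) ` (A \<times> B))"

definition saddle_set :: "(real \<Rightarrow> real) \<Rightarrow> real set \<Rightarrow> real set \<Rightarrow> real set" where
  "saddle_set \<gamma> A B = {z \<in> {-1..1}. \<exists>a\<in>A. \<exists>b\<in>B.
     min a b \<le> z \<and> z \<le> max a b \<and> \<gamma> z = saddle_height \<gamma> A B}"

definition saddle :: "(real \<Rightarrow> real) \<Rightarrow> real set \<Rightarrow> real set \<Rightarrow> real" where
  "saddle \<gamma> A B = (LEAST z. z \<in> saddle_set \<gamma> A B)"

definition depth :: "(real \<Rightarrow> real) \<Rightarrow> real \<Rightarrow> real set \<Rightarrow> real" where
  "depth \<gamma> x B = \<gamma> (saddle \<gamma> {x} B) - \<gamma> x"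

text \<open>A labeling \<open>x\<^sub>1, \<dots>, x\<^sub>q\<close> is a function on the naturals of which only the values at
  \<open>1, \<dots>, q\<close> matter; \<open>bdry_minima x k\<close> is \<open>S\<^sub>h\<^sub>,\<^sub>k\<close>.\<close>

definition bdry_minima :: "(nat \<Rightarrow> real) \<Rightarrow> nat \<Rightarrow> real set" where
  "bdry_minima x k = x ` {1..k} \<union> {-1, 1}"

definition special_labeling :: "real \<Rightarrow> real \<Rightarrow> (real \<Rightarrow> real) \<Rightarrow> (nat \<Rightarrow> real) \<Rightarrow> bool" where
  "special_labeling h \<delta> \<gamma> x \<longleftrightarrow>
     (let q = card (h_minima h \<gamma>) in
       bij_betw x {1..q} (h_minima h \<gamma>) \<and>
       (\<forall>k\<in>{1..q - 1}. depth \<gamma> (x k) (bdry_minima x (k - 1))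
          \<ge> Max ((\<lambda>j. depth \<gamma> (x j) (bdry_minima x (k - 1))) ` {k<..q}) + \<delta>))"

definition good_paths :: "real \<Rightarrow> real \<Rightarrow> (real \<Rightarrow> real) set" where
  "good_paths h \<delta> = {\<gamma>. continuous_on {-1..1} \<gamma> \<and> h_minima h \<gamma> \<noteq> {} \<and>
     (\<forall>x\<in>h_minima h \<gamma>. depth \<gamma> x ((h_minima h \<gamma> \<union> {-1, 1}) - {x}) \<ge> h + \<delta>) \<and>
     (\<exists>x. special_labeling h \<delta> \<gamma> x)}"


section \<open>Environment, potential and reversible measure\<close>

definition elliptic_env :: "real \<Rightarrow> (int \<Rightarrow> real) \<Rightarrow> bool" where
  "elliptic_env \<kappa> w \<longleftrightarrow> (\<forall>k. w k \<in> {\<kappa>..1 - \<kappa>})"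

definition potential :: "(int \<Rightarrow> real) \<Rightarrow> int \<Rightarrow> real" where
  "potential w k = (if k \<ge> 0 then (\<Sum>i\<in>{1..k}. ln ((1 - w i) / w i))
                    else - (\<Sum>i\<in>{k + 1..0}. ln ((1 - w i) / w i)))"

text \<open>The linear interpolation of the values \<open>potential w k / sqrt N\<close> at the points \<open>k / N\<close>.\<close>

definition scaled_potential :: "(int \<Rightarrow> real) \<Rightarrow> nat \<Rightarrow> real \<Rightarrow> real" where
  "scaled_potential w N t =
     (let k = \<lfloor>real N * t\<rfloor>; s = real N * t - of_int k
      in ((1 - s) * potential w k + s * potential w (k + 1)) / sqrt (real N))"

definition lattice :: "nat \<Rightarrow> real set" where
  "lattice N = range (\<lambda>k::int. of_int k / real N)"

text \<open>For \<open>x\<close> in \<open>lattice N\<close> this is the integer \<open>N x\<close>.\<close>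

definition site :: "nat \<Rightarrow> real \<Rightarrow> int" where
  "site N x = \<lfloor>real N * x\<rfloor>"

lemma site_lattice: "N > 0 \<Longrightarrow> site N (of_int k / real N) = k"
  by (simp add: site_def)

definition mu :: "(int \<Rightarrow> real) \<Rightarrow> nat \<Rightarrow> real \<Rightarrow> real" where
  "mu w N x = exp (- potential w (site N x)) / w (site N x)"

definition lattice_interval :: "nat \<Rightarrow> real set" where
  "lattice_interval N = {-1<..<1} \<inter> lattice N"

definition norm2 :: "(int \<Rightarrow> real) \<Rightarrow> nat \<Rightarrow> (real \<Rightarrow> real) \<Rightarrow> real" where
  "norm2 w N f = sqrt (\<Sum>x\<in>lattice_interval N. mu w N x * (f x)\<^sup>2)"


section \<open>The generator and its Dirichlet restrictions\<close>

definition generator :: "(int \<Rightarrow> real) \<Rightarrow> nat \<Rightarrow> (real \<Rightarrow> real) \<Rightarrow> real \<Rightarrow> real" where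
  "generator w N f x = f x - w (site N x) * f (x + 1 / real N)
                           - (1 - w (site N x)) * f (x - 1 / real N)"

definition gen_entry :: "(int \<Rightarrow> real) \<Rightarrow> nat \<Rightarrow> real \<Rightarrow> real \<Rightarrow> real" where
  "gen_entry w N x y = generator w N (indicator {y}) x"

text \<open>The operator with matrix \<open>(gen_entry w N x y)\<close>, \<open>x, y \<in> D\<close>, acting on functions on the
  finite set \<open>D\<close>; values outside \<open>D\<close> are irrelevant. It is symmetric with respect to \<open>mu\<close>, so
  its spectrum is real and consists of the real eigenvalues.\<close>

definition dirichlet_gen :: "(int \<Rightarrow> real) \<Rightarrow> nat \<Rightarrow> real set \<Rightarrow> (real \<Rightarrow> real) \<Rightarrow> real \<Rightarrow> real" where
  "dirichlet_gen w N D f x = (\<Sum>y\<in>D. gen_entry w N x y * f y)"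

definition dirichlet_eigenvector ::
  "(int \<Rightarrow> real) \<Rightarrow> nat \<Rightarrow> real set \<Rightarrow> real \<Rightarrow> (real \<Rightarrow> real) \<Rightarrow> bool" where
  "dirichlet_eigenvector w N D l f \<longleftrightarrow>
     (\<exists>x\<in>D. f x \<noteq> 0) \<and> (\<forall>x\<in>D. dirichlet_gen w N D f x = l * f x)"

definition dirichlet_spectrum :: "(int \<Rightarrow> real) \<Rightarrow> nat \<Rightarrow> real set \<Rightarrow> real set" where
  "dirichlet_spectrum w N D = {l. \<exists>f. dirichlet_eigenvector w N D l f}"


section \<open>The rescaled random walk\<close>

text \<open>The walk is driven by independent uniform variables \<open>u\<^sub>0, u\<^sub>1, \<dots>\<close> on \<open>[0,1]\<close>: from \<open>k\<close>
  it jumps to the right at time \<open>n\<close> iff \<open>u\<^sub>n < w k\<close>, that is, with probability \<open>w k\<close>. The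
  lemma \<open>walk_paths\<close> below says that this is the Markov chain with the required transition
  probabilities.\<close>

definition uniform01 :: "real measure" where
  "uniform01 = uniform_measure lborel {0..1}"

definition rw_step :: "(int \<Rightarrow> real) \<Rightarrow> real \<Rightarrow> int \<Rightarrow> int" where
  "rw_step w u k = (if u < w k then k + 1 else k - 1)"

primrec rw_path :: "(int \<Rightarrow> real) \<Rightarrow> int \<Rightarrow> real stream \<Rightarrow> nat \<Rightarrow> int" where
  "rw_path w k us 0 = k"
| "rw_path w k us (Suc n) = rw_step w (us !! n) (rw_path w k us n)"

definition walk :: "(int \<Rightarrow> real) \<Rightarrow> nat \<Rightarrow> real \<Rightarrow> (nat \<Rightarrow> real) measure" where
  "walk w N x = distr (stream_space uniform01) (Pi\<^sub>M UNIV (\<lambda>_. borel))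
     (\<lambda>us n. of_int (rw_path w (site N x) us n) / real N)"

definition hit_time :: "real set \<Rightarrow> (nat \<Rightarrow> real) \<Rightarrow> enat" where
  "hit_time A X = Inf (enat ` {n. n \<ge> 1 \<and> X n \<in> A})"

text \<open>The probability that the walk started at \<open>x\<close> satisfies \<open>\<tau>\<^sub>A < \<tau>\<^sub>B\<close>.\<close>

definition hits_before :: "(int \<Rightarrow> real) \<Rightarrow> nat \<Rightarrow> real \<Rightarrow> real set \<Rightarrow> real set \<Rightarrow> real" where
  "hits_before w N x A B = measure (walk w N x) {X \<in> space (walk w N x). hit_time A X < hit_time B X}"

definition hk :: "(int \<Rightarrow> real) \<Rightarrow> nat \<Rightarrow> (nat \<Rightarrow> real) \<Rightarrow> nat \<Rightarrow> real \<Rightarrow> real" where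
  "hk w N x k y = (if y = x k then 1 else if y \<in> bdry_minima x (k - 1) then 0
                   else hits_before w N y {x k} (bdry_minima x (k - 1)))"


subsection \<open>Path probabilities\<close>

interpretation uniform01: prob_space uniform01
  unfolding uniform01_def by (rule prob_space_uniform_measure) auto

interpretation unif_stream: prob_space "stream_space uniform01"
  by (rule uniform01.prob_space_stream_space)

lemma sets_uniform01 [simp, measurable_cong]: "sets uniform01 = sets borel"
  by (simp add: uniform01_def)

lemma space_uniform01 [simp]: "space uniform01 = UNIV"
  by (simp add: uniform01_def)

lemma rw_step_measurable [measurable]:
  "(\<lambda>u. rw_step w u k) \<in> uniform01 \<rightarrow>\<^sub>M count_space UNIV"
  unfolding rw_step_def by measurable

lemma rw_path_measurable [measurable]:
  "(\<lambda>us. rw_path w k us n) \<in> stream_space uniform01 \<rightarrow>\<^sub>M count_space UNIV"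
proof (induction n)
  case (Suc n)
  have "(\<lambda>us. (\<lambda>i us. rw_step w (us !! n) i) (rw_path w k us n) us)
          \<in> stream_space uniform01 \<rightarrow>\<^sub>M count_space UNIV"
    by (rule measurable_compose_countable'[OF _ Suc]) measurable
  then show ?case by simp
qed simp

lemma walk_map_measurable [measurable]:
  "(\<lambda>us n. of_int (rw_path w k us n) / real N)
     \<in> stream_space uniform01 \<rightarrow>\<^sub>M Pi\<^sub>M UNIV (\<lambda>_. borel)"
  by (rule measurable_PiM_single') (auto intro!: measurable_compose[OF rw_path_measurable])

lemma prob_space_walk: "prob_space (walk w N x)"
  unfolding walk_def by (rule unif_stream.prob_space_distr) measurable

lemma rw_path_Stream: "rw_path w k (u ## us) (Suc n) = rw_path w (rw_step w u k) us n"
  by (induction n) auto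

definition jump_prob :: "(int \<Rightarrow> real) \<Rightarrow> int \<Rightarrow> int \<Rightarrow> real" where
  "jump_prob w k l = (if l = k + 1 then w k else if l = k - 1 then 1 - w k else 0)"

lemma prob_rw_step:
  assumes "w k \<in> {0..1}"
  shows "measure uniform01 {u. rw_step w u k = l} = jump_prob w k l"
proof -
  have *: "{0..1} \<inter> {u. u < w k} = {0..<w k}" "{0..1} \<inter> {u. \<not> u < w k} = {w k..1}"
    using assms by auto
  have m: "measure uniform01 {u. P u} = measure lborel ({0..1} \<inter> {u. P u})"
    if "{u. P u} \<in> sets borel" for P :: "real \<Rightarrow> bool"
    unfolding uniform01_def using that by (subst measure_uniform_measure) auto
  have "measure uniform01 {u. u < w k} = w k" "measure uniform01 {u. \<not> u < w k} = 1 - w k"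
    using assms by (subst m; simp add: * measure_def)+
  moreover have "{u. rw_step w u k = l} = (if l = k + 1 then {u. u < w k}
      else if l = k - 1 then {u. \<not> u < w k} else {})"
    by (auto simp: rw_step_def)
  ultimately show ?thesis by (simp add: jump_prob_def)
qed

lemma prob_rw_path:
  assumes "\<And>k. w k \<in> {0..1}"
  shows "measure (stream_space uniform01) {us. \<forall>i\<le>n. rw_path w k us i = p i}
         = (if p 0 = k then \<Prod>i<n. jump_prob w (p i) (p (Suc i)) else 0)"
proof (induction n arbitrary: k p)
  case 0
  show ?case using unif_stream.prob_space by (auto simp: space_stream_space)
next
  case (Suc n)
  have sp: "space (stream_space uniform01) = UNIV" by (simp add: space_stream_space)
  have meas: "{us. \<forall>i\<le>n. rw_path w k us i = p i} \<in> sets (stream_space uniform01)" for k n p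
  proof -
    have "{us \<in> space (stream_space uniform01). \<forall>i\<le>n. rw_path w k us i = p i}
            \<in> sets (stream_space uniform01)" by measurable
    then show ?thesis by (simp add: sp)
  qed
  define Q where "Q = (\<Prod>i<n. jump_prob w (p (Suc i)) (p (Suc (Suc i))))"
  have Q0: "0 \<le> Q"
    unfolding Q_def jump_prob_def using assms by (intro prod_nonneg) auto
  let ?P = "\<lambda>us. \<forall>i\<le>Suc n. rw_path w k us i = p i"
  have eq: "?P (u ## us) \<longleftrightarrow> p 0 = k \<and> (\<forall>i\<le>n. rw_path w (rw_step w u k) us i = p (Suc i))" for u us
    by (auto simp: rw_path_Stream less_Suc_eq_le[symmetric] All_less_Suc2 simp del: rw_path.simps(2))
  have step: "measure (stream_space uniform01) {us. ?P (u ## us)}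
      = (if p 0 = k then Q else 0) * indicator {u. rw_step w u k = p 1} u" for u
    unfolding eq using Suc[of "rw_step w u k" "\<lambda>i. p (Suc i)"] by (auto simp: Q_def)
  have m1: "{u. rw_step w u k = p 1} \<in> sets uniform01"
    using measurable_sets[OF rw_step_measurable, of "{p 1}" w k] by (simp add: vimage_def)
  have "ennreal (measure (stream_space uniform01) {us. ?P us})
      = (\<integral>\<^sup>+u. ennreal (measure (stream_space uniform01) {us. ?P (u ## us)}) \<partial>uniform01)"
    using uniform01.prob_stream_space[of ?P] meas[of "Suc n" k p] by (simp add: sp)
  also have "\<dots> = (\<integral>\<^sup>+u. ennreal (if p 0 = k then Q else 0)
                     * indicator {u. rw_step w u k = p 1} u \<partial>uniform01)"
    unfolding step using Q0 by (intro nn_integral_cong) (auto simp: indicator_def)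
  also have "\<dots> = ennreal ((if p 0 = k then Q else 0) * measure uniform01 {u. rw_step w u k = p 1})"
    using m1 Q0 by (simp add: nn_integral_cmult_indicator uniform01.emeasure_eq_measure ennreal_mult)
  finally have "measure (stream_space uniform01) {us. ?P us}
      = (if p 0 = k then Q else 0) * measure uniform01 {u. rw_step w u k = p 1}"
    using Q0 by (subst (asm) ennreal_inj) auto
  also have "\<dots> = (if p 0 = k then jump_prob w (p 0) (p 1) * Q else 0)"
    using prob_rw_step[of w k "p 1"] assms by simp
  also have "jump_prob w (p 0) (p 1) * Q = (\<Prod>i<Suc n. jump_prob w (p i) (p (Suc i)))"
    unfolding Q_def by (subst prod.lessThan_Suc_shift) simp
  finally show ?case .
qed

lemma walk_paths:
  assumes "\<And>k. w k \<in> {0..1}" and "N > 0" and "x \<in> lattice N"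
  shows "measure (walk w N x) {X. \<forall>i\<le>n. X i = of_int (p i) / real N}
         = (if of_int (p 0) / real N = x then \<Prod>i<n. jump_prob w (p i) (p (Suc i)) else 0)"
proof -
  have "{X \<in> space (Pi\<^sub>M UNIV (\<lambda>_. borel)). \<forall>i\<le>n. X i = of_int (p i) / real N}
          \<in> sets (Pi\<^sub>M UNIV (\<lambda>_. borel))" by measurable
  then have "{X. \<forall>i\<le>n. X i = of_int (p i) / real N} \<in> sets (Pi\<^sub>M UNIV (\<lambda>_. borel))"
    by (simp add: space_PiM PiE_UNIV_domain)
  then have "measure (walk w N x) {X. \<forall>i\<le>n. X i = of_int (p i) / real N}
      = measure (stream_space uniform01) {us. \<forall>i\<le>n. rw_path w (site N x) us i = p i}"
    unfolding walk_def using assms(2)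
    by (subst measure_distr) (auto simp: vimage_def space_stream_space)
  moreover have "p 0 = site N x \<longleftrightarrow> of_int (p 0) / real N = x"
    using assms(2,3) by (auto simp: lattice_def site_lattice)
  ultimately show ?thesis using prob_rw_path[OF assms(1)] by simp
qed

lemma hits_before_event:
  assumes "finite A" "finite B"
  shows "{X \<in> space (walk w N x). hit_time A X < hit_time B X} \<in> sets (walk w N x)"
proof -
  have sub: "A \<in> sets borel" "B \<in> sets borel"
    using assms by (auto intro: borel_closed finite_imp_closed)
  have "(hit_time A X < hit_time B X) \<longleftrightarrow> (\<exists>n\<ge>1. X n \<in> A \<and> (\<forall>m\<in>{1..n}. X m \<notin> B))" for X
  proof
    assume less: "hit_time A X < hit_time B X"
    then obtain n where n: "n \<ge> 1" "X n \<in> A" "enat n < hit_time B X"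
      unfolding hit_time_def[of A] by (auto simp: Inf_less_iff)
    have "X m \<notin> B" if "m \<in> {1..n}" for m
    proof
      assume "X m \<in> B"
      then have "hit_time B X \<le> enat m" unfolding hit_time_def using that by (intro Inf_lower) auto
      with n(3) that show False by (meson atLeastAtMost_iff enat_ord_simps(1) leD order_trans)
    qed
    with n show "\<exists>n\<ge>1. X n \<in> A \<and> (\<forall>m\<in>{1..n}. X m \<notin> B)" by auto
  next
    assume "\<exists>n\<ge>1. X n \<in> A \<and> (\<forall>m\<in>{1..n}. X m \<notin> B)"
    then obtain n where n: "n \<ge> 1" "X n \<in> A" "\<And>m. m \<in> {1..n} \<Longrightarrow> X m \<notin> B" by auto
    have "hit_time A X \<le> enat n" unfolding hit_time_def using n by (intro Inf_lower) auto
    also have "enat n < eSuc (enat n)" by (simp add: eSuc_enat)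
    also have "eSuc (enat n) \<le> hit_time B X"
      unfolding hit_time_def
    proof (rule Inf_greatest)
      fix y assume "y \<in> enat ` {m. m \<ge> 1 \<and> X m \<in> B}"
      then obtain m where m: "y = enat m" "m \<ge> 1" "X m \<in> B" by auto
      with n(3)[of m] have "n < m" by (cases "m \<le> n") auto
      with m show "eSuc (enat n) \<le> y" by (simp add: eSuc_enat)
    qed
    finally show "hit_time A X < hit_time B X" .
  qed
  then show ?thesis unfolding walk_def using sub by simp
qed

end

theory Submission
  imports Defs
begin

text \<open>
  The walk is reversible with respect to \<open>\<mu>\<close>, so \<open>\<L>\<^sup>(\<^sup>N\<^sup>)\<close> is symmetric and its quadratic form is the
  Dirichlet energy \<open>\<E>(f, g) = \<Sum>\<^sub>z e\<^bsup>-V(z)\<^esup> (f(z+1) - f(z)) (g(z+1) - g(z))\<close>. The hitting probability \<open>h\<^sub>k\<close> is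
  harmonic off \<open>S\<^sub>k\<close> and vanishes on \<open>S\<^sub>k\<^sub>-\<^sub>1\<close>. Hence \<open>\<E>(h\<^sub>k, g) = 0\<close> as soon as \<open>g\<close> vanishes on \<open>S\<^sub>k\<close>; this
  applies to \<open>g = h\<^sub>j\<close> with \<open>j > k\<close> and to every \<open>g\<close> that vanishes at the \<open>h\<close>-minima. So the \<open>h\<^sub>k\<close> diagonalise
  the form exactly: writing \<open>f = \<Sum>\<^sub>k c\<^sub>k h\<^sub>k + g\<close> with \<open>g = 0\<close> on \<open>M\<^sub>h\<^sup>-\<close> gives
  \<open>\<E>(f, f) = \<Sum>\<^sub>k c\<^sub>k\<^sup>2 \<E>(h\<^sub>k, h\<^sub>k) + \<E>(g, g)\<close> with \<open>\<E>(g, g) \<ge> \<lambda>\<^sup>* \<parallel>g\<parallel>\<^sup>2\<close>, and \<open>\<E>(h\<^sub>k, h\<^sub>k)\<close> is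
  \<open>\<mu>(x\<^sub>k) P(\<tau>\<^bsub>S k-1\<^esub> < \<tau>\<^bsub>x k\<^esub>)\<close>. The \<open>h\<^sub>k\<close> fail to be an eigenbasis only because they are not orthogonal in
  \<open>L\<^sup>2(\<mu>)\<close>. If the normalised overlaps are at most \<open>\<eta>\<close>, and the quotients
  \<open>\<rho>\<^sub>k = \<E>(h\<^sub>k, h\<^sub>k) / \<parallel>h\<^sub>k\<parallel>\<^sup>2\<close> and \<open>\<lambda>\<^sup>*\<close> are separated by factors \<open>\<theta>\<close>, then min-max gives the eigenvalues
  up to relative error of order \<open>q \<eta> + \<theta>\<close>, and testing the eigenvalue equation against the \<open>h\<^sub>j\<close> and
  against \<open>g\<close> gives the eigenvectors (\<open>low_spectrum\<close>, a statement about symmetric kernels only).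

  It remains to see that \<open>\<eta>\<close> and \<open>\<theta>\<close> are exponentially small. All estimates come from one inequality,
  Cauchy-Schwarz along a path: if \<open>f\<close> vanishes on \<open>S\<close>, then \<open>f(y)\<^sup>2\<close> is at most \<open>2 N \<E>(f, f)\<close> times the
  exponential of the lowest pass from \<open>y\<close> to \<open>S\<close> (\<open>energy_point_bound\<close>). With indicator functions of valleys as
  test functions it determines the energies up to a factor of order \<open>N\<close>, it gives the Poincare inequality behind
  \<open>\<lambda>\<^sup>* \<ge> c N\<^sup>-\<^sup>2 e\<^bsup>-h \<surd>N\<^esup>\<close>, and it bounds \<open>h\<^sub>k(y)\<close>. The landscape enters through a dichotomy (\<open>well_dichotomy\<close>):
  relative to \<open>S\<^sub>k\<^sub>-\<^sub>1\<close>, a site \<open>y\<close> either has depth below that of \<open>x\<^sub>k\<close> by \<open>\<delta> \<surd>N\<close>, which makes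
  \<open>\<mu>(y) h\<^sub>k(y)\<^sup>2\<close> negligible against \<open>\<mu>(x\<^sub>k)\<close>, or lies in the valley of \<open>x\<^sub>k\<close>, of which \<open>x\<^sub>k\<close> is the bottom.
  Two valleys that meet are nested, and then their bottoms differ in height by \<open>\<delta> \<surd>N\<close> (\<open>nested_wells\<close>); this
  makes the overlaps small. The separation of the \<open>\<rho>\<^sub>k\<close> is the defining property of the special labeling.
\<close>

section \<open>Symmetric kernels on a finite set\<close>

text \<open>Elimination of one unknown per equation. This supplies the test vectors of all dimension counts and
  min-max arguments below.\<close>

lemma homogeneous_system_nontrivial:
  fixes a :: "'b \<Rightarrow> 'a \<Rightarrow> real"
  assumes "finite B" "finite J" "card B < card J"
  shows "\<exists>c. (\<exists>i\<in>J. c i \<noteq> 0) \<and> (\<forall>j\<in>B. (\<Sum>i\<in>J. a j i * c i) = 0)"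
  using assms
proof (induction B arbitrary: J a rule: finite_induct)
  case empty
  then have "J \<noteq> {}" by auto
  then show ?case by (intro exI[of _ "\<lambda>_. 1"]) auto
next
  case (insert j B)
  show ?case
  proof (cases "\<forall>i\<in>J. a j i = 0")
    case True
    have "card B < card J" using insert by auto
    from insert.IH[OF insert.prems(1) this, of a] True show ?thesis by auto
  next
    case False
    then obtain i0 where i0: "i0 \<in> J" "a j i0 \<noteq> 0" by auto
    define J' where "J' = J - {i0}"
    have J: "J = insert i0 J'" "i0 \<notin> J'" and J': "finite J'" "card B < card J'"
      using insert i0 by (auto simp: J'_def)
    from insert.IH[OF J', of "\<lambda>b i. a b i - a b i0 * a j i / a j i0"] obtain c where
      c: "\<exists>i\<in>J'. c i \<noteq> 0" and c0: "\<And>b. b \<in> B \<Longrightarrow> (\<Sum>i\<in>J'. (a b i - a b i0 * a j i / a j i0) * c i) = 0"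
      by auto
    define s where "s = (\<Sum>i\<in>J'. a j i * c i)"
    define e where "e i = (if i = i0 then - s / a j i0 else c i)" for i
    have sum: "(\<Sum>i\<in>J. a b i * e i) = a b i0 * (- s / a j i0) + (\<Sum>i\<in>J'. a b i * c i)" for b
    proof -
      have "(\<Sum>i\<in>J'. a b i * e i) = (\<Sum>i\<in>J'. a b i * c i)"
        using J by (intro sum.cong) (auto simp: e_def)
      then show ?thesis using J J' by (simp add: e_def)
    qed
    have "(\<Sum>i\<in>J. a b i * e i) = 0" if "b \<in> B" for b
    proof -
      have "0 = (\<Sum>i\<in>J'. a b i * c i - a b i0 / a j i0 * (a j i * c i))"
        using c0[OF that] by (simp add: algebra_simps)
      also have "\<dots> = (\<Sum>i\<in>J'. a b i * c i) - a b i0 / a j i0 * s"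
        by (simp add: s_def sum_subtractf sum_distrib_left)
      finally show ?thesis unfolding sum by simp
    qed
    moreover have "(\<Sum>i\<in>J. a j i * e i) = 0"
      unfolding sum using i0 by (simp add: s_def)
    moreover have "\<exists>i\<in>J. e i \<noteq> 0" using c J by (auto simp: e_def)
    ultimately show ?thesis by (intro exI[of _ e]) auto
  qed
qed

text \<open>The set \<open>X\<close> is a parameter because the same kernel is used on the whole interval and on the
  complement of the \<open>h\<close>-minima. Functions are total; only their values on \<open>X\<close> count.\<close>

locale reversible_kernel =
  fixes X :: "'a set" and m :: "'a \<Rightarrow> real" and A :: "'a \<Rightarrow> 'a \<Rightarrow> real"
  assumes fin [simp]: "finite X"
    and m_pos: "x \<in> X \<Longrightarrow> m x > 0"
    and rev: "x \<in> X \<Longrightarrow> y \<in> X \<Longrightarrow> m x * A x y = m y * A y x"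
begin

definition ip :: "('a \<Rightarrow> real) \<Rightarrow> ('a \<Rightarrow> real) \<Rightarrow> real" where
  "ip f g = (\<Sum>x\<in>X. m x * f x * g x)"

definition kop :: "('a \<Rightarrow> real) \<Rightarrow> 'a \<Rightarrow> real" where
  "kop f x = (\<Sum>y\<in>X. A x y * f y)"

definition form :: "('a \<Rightarrow> real) \<Rightarrow> ('a \<Rightarrow> real) \<Rightarrow> real" where
  "form f g = ip f (kop g)"

definition eigvec :: "real \<Rightarrow> ('a \<Rightarrow> real) \<Rightarrow> bool" where
  "eigvec l f \<longleftrightarrow> (\<exists>x\<in>X. f x \<noteq> 0) \<and> (\<forall>x\<in>X. kop f x = l * f x)"

lemma ip_commute: "ip f g = ip g f"
  by (simp add: ip_def mult_ac)

lemma form_commute: "form f g = form g f"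
proof -
  have "form f g = (\<Sum>x\<in>X. \<Sum>y\<in>X. m x * A x y * f x * g y)"
    by (simp add: form_def ip_def kop_def sum_distrib_left mult_ac)
  also have "\<dots> = (\<Sum>x\<in>X. \<Sum>y\<in>X. m y * A y x * f x * g y)"
    by (intro sum.cong refl) (simp add: rev)
  also have "\<dots> = (\<Sum>y\<in>X. \<Sum>x\<in>X. m y * A y x * f x * g y)"
    by (rule sum.swap)
  also have "\<dots> = form g f"
    by (simp add: form_def ip_def kop_def sum_distrib_left mult_ac)
  finally show ?thesis .
qed

lemma ip_cong: "(\<And>x. x \<in> X \<Longrightarrow> f x = f' x) \<Longrightarrow> (\<And>x. x \<in> X \<Longrightarrow> g x = g' x) \<Longrightarrow> ip f g = ip f' g'"
  by (simp add: ip_def)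

lemma kop_cong: "(\<And>x. x \<in> X \<Longrightarrow> f x = f' x) \<Longrightarrow> kop f y = kop f' y"
  by (simp add: kop_def)

lemma form_cong:
  "(\<And>x. x \<in> X \<Longrightarrow> f x = f' x) \<Longrightarrow> (\<And>x. x \<in> X \<Longrightarrow> g x = g' x) \<Longrightarrow> form f g = form f' g'"
  unfolding form_def by (intro ip_cong kop_cong) auto

lemma ip_add_left: "ip (\<lambda>x. f x + g x) h = ip f h + ip g h"
  by (simp add: ip_def algebra_simps sum.distrib)

lemma ip_scale_left: "ip (\<lambda>x. c * f x) h = c * ip f h"
  by (simp add: ip_def algebra_simps sum_distrib_left)

lemma ip_sum_left: "ip (\<lambda>x. \<Sum>i\<in>J. F i x) h = (\<Sum>i\<in>J. ip (F i) h)"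
proof -
  have "ip (\<lambda>x. \<Sum>i\<in>J. F i x) h = (\<Sum>x\<in>X. \<Sum>i\<in>J. m x * F i x * h x)"
    by (simp add: ip_def sum_distrib_left sum_distrib_right)
  also have "\<dots> = (\<Sum>i\<in>J. \<Sum>x\<in>X. m x * F i x * h x)" by (rule sum.swap)
  finally show ?thesis by (simp add: ip_def)
qed

lemma ip_add_right: "ip h (\<lambda>x. f x + g x) = ip h f + ip h g"
  and ip_scale_right: "ip h (\<lambda>x. c * f x) = c * ip h f"
  and ip_sum_right: "ip h (\<lambda>x. \<Sum>i\<in>J. F i x) = (\<Sum>i\<in>J. ip h (F i))"
  by (simp_all add: ip_commute[of h] ip_add_left ip_scale_left ip_sum_left)

lemma form_add_left: "form (\<lambda>x. f x + g x) h = form f h + form g h"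
  and form_scale_left: "form (\<lambda>x. c * f x) h = c * form f h"
  and form_sum_left: "form (\<lambda>x. \<Sum>i\<in>J. F i x) h = (\<Sum>i\<in>J. form (F i) h)"
  by (simp_all add: form_def ip_add_left ip_scale_left ip_sum_left)

lemma form_add_right: "form h (\<lambda>x. f x + g x) = form h f + form h g"
  and form_scale_right: "form h (\<lambda>x. c * f x) = c * form h f"
  and form_sum_right: "form h (\<lambda>x. \<Sum>i\<in>J. F i x) = (\<Sum>i\<in>J. form h (F i))"
  by (simp_all add: form_commute[of h] form_add_left form_scale_left form_sum_left)

lemmas ip_lin = ip_add_left ip_scale_left ip_add_right ip_scale_right
lemmas form_lin = form_add_left form_scale_left form_add_right form_scale_right

lemma ip_nonneg: "ip f f \<ge> 0"
  unfolding ip_def using m_pos by (intro sum_nonneg) (simp add: mult.assoc less_imp_le)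

lemma ip_pos: "ip f f > 0" if "x \<in> X" "f x \<noteq> 0"
proof -
  have "0 < m x * f x * f x" using m_pos[OF that(1)] that(2)
    by (metis mult.assoc mult_pos_pos not_real_square_gt_zero)
  also have "\<dots> \<le> ip f f"
    unfolding ip_def using that(1) m_pos
    by (intro member_le_sum) (auto simp: mult.assoc less_imp_le)
  finally show ?thesis .
qed

lemma ip_pos_iff: "ip f f > 0 \<longleftrightarrow> (\<exists>x\<in>X. f x \<noteq> 0)"
proof
  assume *: "ip f f > 0"
  show "\<exists>x\<in>X. f x \<noteq> 0"
  proof (rule ccontr)
    assume "\<not> ?thesis"
    then have "ip f f = 0" by (simp add: ip_def)
    with * show False by simp
  qed
qed (auto intro: ip_pos)

lemma ip_indicator: "x \<in> X \<Longrightarrow> ip (indicator {x}) f = m x * f x"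
proof -
  assume x: "x \<in> X"
  have "ip (indicator {x}) f = (\<Sum>y\<in>X. if y = x then m y * f y else 0)"
    unfolding ip_def by (intro sum.cong) (auto simp: indicator_def)
  with x show ?thesis by simp
qed

lemma eigvec_iff: "eigvec l f \<longleftrightarrow> ip f f > 0 \<and> (\<forall>g. form g f = l * ip g f)"
proof
  assume e: "eigvec l f"
  have "form g f = l * ip g f" for g
  proof -
    have "form g f = ip g (\<lambda>x. l * f x)"
      unfolding form_def using e by (intro ip_cong) (auto simp: eigvec_def)
    then show ?thesis by (simp add: ip_lin)
  qed
  with e show "ip f f > 0 \<and> (\<forall>g. form g f = l * ip g f)"
    by (auto simp: eigvec_def ip_pos_iff)
next
  assume r: "ip f f > 0 \<and> (\<forall>g. form g f = l * ip g f)"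
  have "kop f x = l * f x" if x: "x \<in> X" for x
  proof -
    have "m x * kop f x = l * (m x * f x)"
      using r ip_indicator[OF x] by (metis form_def)
    with m_pos[OF x] show ?thesis by simp
  qed
  with r show "eigvec l f" by (auto simp: eigvec_def ip_pos_iff)
qed

lemma eigvecs_orthogonal:
  assumes "eigvec l f" "eigvec l' g" "l \<noteq> l'"
  shows "ip f g = 0"
proof -
  have "l' * ip f g = form f g" using assms(2) by (simp add: eigvec_iff)
  also have "\<dots> = l * ip f g"
    using assms(1) unfolding form_commute[of f g] ip_commute[of f g] by (simp add: eigvec_iff)
  finally show ?thesis using assms(3) by simp
qed

lemma eigvec_scale: "eigvec l f \<Longrightarrow> c \<noteq> 0 \<Longrightarrow> eigvec l (\<lambda>x. c * f x)"
  by (auto simp: eigvec_def kop_def mult.left_commute simp flip: sum_distrib_left)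

lemma ip_abs_le: "\<bar>ip f g\<bar> \<le> sqrt (ip f f) * sqrt (ip g g)"
proof -
  have eq: "ip f g = (\<Sum>x\<in>X. (sqrt (m x) * f x) * (sqrt (m x) * g x))" for f g
  proof -
    have "m x * f x * g x = (sqrt (m x) * f x) * (sqrt (m x) * g x)" if "x \<in> X" for x
    proof -
      have "(sqrt (m x) * f x) * (sqrt (m x) * g x) = (sqrt (m x))\<^sup>2 * f x * g x"
        by (simp add: power2_eq_square mult_ac)
      then show ?thesis using m_pos[OF that] by simp
    qed
    then show ?thesis unfolding ip_def by (intro sum.cong) auto
  qed
  have "(ip f g)\<^sup>2 \<le> ip f f * ip g g"
    unfolding eq using Cauchy_Schwarz_ineq_sum[of "\<lambda>x. sqrt (m x) * f x" "\<lambda>x. sqrt (m x) * g x" X]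
    by (simp add: power2_eq_square)
  then have "sqrt ((ip f g)\<^sup>2) \<le> sqrt (ip f f * ip g g)" by (rule real_sqrt_le_mono)
  then show ?thesis by (simp add: real_sqrt_mult)
qed

lemma ip_orthogonal_comb:
  assumes "finite J" "\<And>i j. i \<in> J \<Longrightarrow> j \<in> J \<Longrightarrow> i \<noteq> j \<Longrightarrow> ip (f i) (f j) = 0"
  shows "ip (\<lambda>x. \<Sum>i\<in>J. c i * f i x) (\<lambda>x. \<Sum>i\<in>J. c i * f i x) = (\<Sum>i\<in>J. (c i)\<^sup>2 * ip (f i) (f i))"
proof -
  have "ip (\<lambda>x. \<Sum>i\<in>J. c i * f i x) (\<lambda>x. \<Sum>i\<in>J. c i * f i x)
      = (\<Sum>i\<in>J. \<Sum>j\<in>J. c i * (c j * ip (f i) (f j)))"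
    by (simp only: ip_sum_left ip_sum_right ip_lin sum_distrib_left)
  also have "\<dots> = (\<Sum>i\<in>J. \<Sum>j\<in>J. if j = i then (c i)\<^sup>2 * ip (f i) (f i) else 0)"
    using assms(2) by (intro sum.cong) (auto simp: power2_eq_square)
  finally show ?thesis using assms(1) by simp
qed

lemma form_orthogonal_comb:
  assumes "finite J" "\<And>i j. i \<in> J \<Longrightarrow> j \<in> J \<Longrightarrow> i \<noteq> j \<Longrightarrow> form (f i) (f j) = 0"
  shows "form (\<lambda>x. \<Sum>i\<in>J. c i * f i x) (\<lambda>x. \<Sum>i\<in>J. c i * f i x) = (\<Sum>i\<in>J. (c i)\<^sup>2 * form (f i) (f i))"
proof -
  have "form (\<lambda>x. \<Sum>i\<in>J. c i * f i x) (\<lambda>x. \<Sum>i\<in>J. c i * f i x)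
      = (\<Sum>i\<in>J. \<Sum>j\<in>J. c i * (c j * form (f i) (f j)))"
    by (simp only: form_sum_left form_sum_right form_lin sum_distrib_left)
  also have "\<dots> = (\<Sum>i\<in>J. \<Sum>j\<in>J. if j = i then (c i)\<^sup>2 * form (f i) (f i) else 0)"
    using assms(2) by (intro sum.cong) (auto simp: power2_eq_square)
  finally show ?thesis using assms(1) by simp
qed

definition nrm :: "('a \<Rightarrow> real) \<Rightarrow> real" where "nrm f = sqrt (ip f f)"

lemma nrm_nonneg [simp]: "nrm f \<ge> 0" by (simp add: nrm_def ip_nonneg)

lemma nrm_power2: "(nrm f)\<^sup>2 = ip f f" by (simp add: nrm_def ip_nonneg)

lemma ip_le_nrm: "\<bar>ip f g\<bar> \<le> nrm f * nrm g"
  unfolding nrm_def by (rule ip_abs_le)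

lemma nrm_triangle: "nrm (\<lambda>x. f x + g x) \<le> nrm f + nrm g"
proof (rule power2_le_imp_le)
  have "(nrm (\<lambda>x. f x + g x))\<^sup>2 = ip f f + 2 * ip f g + ip g g"
    by (simp add: nrm_power2 ip_lin ip_commute[of g f])
  also have "\<dots> \<le> ip f f + 2 * (nrm f * nrm g) + ip g g"
    using ip_le_nrm[of f g] by simp
  also have "\<dots> = (nrm f + nrm g)\<^sup>2" by (simp add: power2_sum nrm_power2)
  finally show "(nrm (\<lambda>x. f x + g x))\<^sup>2 \<le> (nrm f + nrm g)\<^sup>2" .
qed simp

lemma nrm_scale: "nrm (\<lambda>x. c * f x) = \<bar>c\<bar> * nrm f"
proof -
  have "ip (\<lambda>x. c * f x) (\<lambda>x. c * f x) = c\<^sup>2 * ip f f"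
    by (simp add: ip_lin power2_eq_square)
  then show ?thesis by (simp add: nrm_def real_sqrt_mult)
qed

lemma nrm_sum: "nrm (\<lambda>x. \<Sum>i\<in>J. F i x) \<le> (\<Sum>i\<in>J. nrm (F i))"
proof (induction J rule: infinite_finite_induct)
  case (insert i J)
  then show ?case using nrm_triangle[of "F i" "\<lambda>x. \<Sum>i\<in>J. F i x"] by simp
qed (simp_all add: nrm_def ip_def)

text \<open>The unit sphere is compact. To see this in the product topology of all functions on the type, functions
  are cut off outside \<open>X\<close>, which changes none of the forms; a unit vector has
  \<open>\<bar>f x\<bar> \<le> 1 / sqrt (m x)\<close>, so the sphere lies in a compact box.\<close>

lemma rayleigh_minimizer:
  assumes "finite P" "ip f0 f0 > 0" "\<And>p. p \<in> P \<Longrightarrow> ip p f0 = 0"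
  obtains u where "ip u u = 1" "\<And>p. p \<in> P \<Longrightarrow> ip p u = 0"
    "\<And>f. (\<And>p. p \<in> P \<Longrightarrow> ip p f = 0) \<Longrightarrow> form u u * ip f f \<le> form f f"
proof -
  define Bx where "Bx = (\<Pi>\<^sub>E x\<in>UNIV. if x \<in> X then {- 1 / sqrt (m x)..1 / sqrt (m x)} else {0})"
  define C where "C = {f. ip f f = 1} \<inter> (\<Inter>p\<in>P. {f. ip p f = 0})"
  have coord: "continuous_on UNIV (\<lambda>f::'a \<Rightarrow> real. f x)" for x
    by (rule continuous_on_product_coordinates)
  have contip: "continuous_on UNIV (\<lambda>f. ip f f)" "continuous_on UNIV (\<lambda>f. ip p f)"
    "continuous_on UNIV (\<lambda>f. form f f)" for p
    unfolding form_def ip_def kop_def by (intro continuous_intros coord)+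
  have comp: "compact Bx"
  proof -
    have "compactin (product_topology (\<lambda>_. euclidean) UNIV) Bx"
      unfolding Bx_def by (subst compactin_PiE) auto
    then show ?thesis by (simp add: euclidean_product_topology flip: compactin_euclidean_iff)
  qed
  have "closed C" unfolding C_def
    by (intro closed_Int closed_INT ballI closed_Collect_eq contip continuous_on_const)
  then have comp': "compact (C \<inter> Bx)" using comp by (rule closed_Int_compact)
  have normalise: "(\<lambda>x. if x \<in> X then f x / sqrt (ip f f) else 0) \<in> C \<inter> Bx"
    (is "?g \<in> _") if f: "ip f f > 0" "\<And>p. p \<in> P \<Longrightarrow> ip p f = 0" for f
  proof -
    define r where "r = 1 / sqrt (ip f f)"
    have r2: "r * r * ip f f = 1" using f(1) by (simp add: r_def flip: real_sqrt_mult)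
    have g: "ip p ?g = ip p (\<lambda>x. r * f x)" "ip ?g ?g = ip (\<lambda>x. r * f x) (\<lambda>x. r * f x)" for p
      by (auto intro!: ip_cong simp: r_def)
    have one: "ip p ?g = 0" if "p \<in> P" for p
      unfolding g(1) using f(2)[OF that] by (simp add: ip_lin)
    have one': "ip ?g ?g = 1" unfolding g(2) using r2 by (simp add: ip_lin mult_ac)
    have "\<bar>?g x\<bar> \<le> 1 / sqrt (m x)" if x: "x \<in> X" for x
    proof -
      have "m x * (?g x)\<^sup>2 \<le> ip ?g ?g"
        unfolding ip_def power2_eq_square mult.assoc[symmetric] using x m_pos
        by (intro member_le_sum) (auto simp: mult.assoc less_imp_le)
      then have "(?g x)\<^sup>2 \<le> 1 / m x" using m_pos[OF x] one' by (simp add: field_simps)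
      then have "sqrt ((?g x)\<^sup>2) \<le> sqrt (1 / m x)" by (rule real_sqrt_le_mono)
      then show ?thesis by (simp add: real_sqrt_divide)
    qed
    then have "- 1 / sqrt (m x) \<le> ?g x \<and> ?g x \<le> 1 / sqrt (m x)" if "x \<in> X" for x
      using that by (metis abs_le_iff minus_divide_left minus_le_iff)
    then have "?g \<in> Bx" unfolding Bx_def by (auto simp: PiE_UNIV_domain)
    with one one' show ?thesis by (auto simp: C_def)
  qed
  have "C \<inter> Bx \<noteq> {}" using normalise[OF assms(2,3)] by auto
  from continuous_attains_inf[OF comp' this continuous_on_subset[OF contip(3) subset_UNIV]]
  obtain u where u: "u \<in> C \<inter> Bx" "\<And>f. f \<in> C \<inter> Bx \<Longrightarrow> form u u \<le> form f f" by auto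
  show ?thesis
  proof (rule that[of u])
    show "ip u u = 1" and "\<And>p. p \<in> P \<Longrightarrow> ip p u = 0" using u(1) by (auto simp: C_def)
    fix f assume f: "\<And>p. p \<in> P \<Longrightarrow> ip p f = 0"
    show "form u u * ip f f \<le> form f f"
    proof (cases "ip f f > 0")
      case True
      let ?g = "\<lambda>x. if x \<in> X then f x / sqrt (ip f f) else 0"
      define r where "r = 1 / sqrt (ip f f)"
      have r2: "r * r * ip f f = 1" using True by (simp add: r_def flip: real_sqrt_mult)
      have "form u u \<le> form ?g ?g" by (rule u(2)[OF normalise[OF True f]])
      also have "\<dots> = form (\<lambda>x. r * f x) (\<lambda>x. r * f x)" by (intro form_cong) (auto simp: r_def)
      also have "\<dots> = r * r * form f f" by (simp add: form_lin)
      finally have "form u u * ip f f \<le> (r * r * form f f) * ip f f"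
        using True by (intro mult_right_mono) auto
      also have "\<dots> = (r * r * ip f f) * form f f" by simp
      finally show ?thesis using r2 by simp
    next
      case False
      then have "\<forall>x\<in>X. f x = 0" by (auto simp: ip_pos_iff)
      then have "ip f f = 0" "form f f = 0" by (auto simp: ip_def form_def)
      then show ?thesis by simp
    qed
  qed
qed

text \<open>The first variation of the Rayleigh quotient vanishes in every direction orthogonal to \<open>P\<close>. In the
  directions of \<open>P\<close> the eigenvalue equation holds by symmetry, since \<open>P\<close> consists of eigenvectors
  orthogonal to \<open>u\<close>.\<close>

lemma minimizer_eigvec:
  assumes u: "ip u u = 1" "\<And>p. p \<in> P \<Longrightarrow> ip p u = 0"
    "\<And>f. (\<And>p. p \<in> P \<Longrightarrow> ip p f = 0) \<Longrightarrow> form u u * ip f f \<le> form f f"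
    and eig: "\<And>p. p \<in> P \<Longrightarrow> \<exists>l. eigvec l p"
    and P: "finite P" "\<And>p. p \<in> P \<Longrightarrow> ip p p = 1" "\<And>p p'. p \<in> P \<Longrightarrow> p' \<in> P \<Longrightarrow> p \<noteq> p' \<Longrightarrow> ip p p' = 0"
  shows "eigvec (form u u) u"
proof -
  let ?l = "form u u"
  have main: "form f u = ?l * ip f u" if f: "\<And>p. p \<in> P \<Longrightarrow> ip p f = 0" for f
  proof -
    define b where "b = form f u - ?l * ip f u"
    define e where "e = form f f - ?l * ip f f"
    have quad: "0 \<le> 2 * t * b + t * t * e" for t
    proof -
      have "?l * ip (\<lambda>x. u x + t * f x) (\<lambda>x. u x + t * f x)
          \<le> form (\<lambda>x. u x + t * f x) (\<lambda>x. u x + t * f x)"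
        using f u(2) by (intro u(3)) (simp add: ip_lin)
      then show ?thesis using u(1)
        by (simp add: form_lin ip_lin b_def e_def form_commute[of u f] ip_commute[of u f] algebra_simps)
    qed
    have e0: "e \<ge> 0" using u(3)[OF f] by (simp add: e_def)
    have "b = 0"
    proof (rule ccontr)
      assume b: "b \<noteq> 0"
      \<comment> \<open>The parabola \<open>2 t b + t\<^sup>2 e\<close> is lowest at \<open>t = - b / e\<close>; adding one to \<open>e\<close> covers \<open>e = 0\<close> as well.\<close>
      define t where "t = - b / (e + 1)"
      have te: "t * (e + 1) = - b" using e0 by (simp add: t_def)
      have "t * t * e = t * (- b) - t * t" by (simp add: te[symmetric] algebra_simps)
      moreover have "t * b < 0"
      proof -
        have "0 < b * b / (e + 1)" using b e0 unfolding power2_eq_square[symmetric] by (intro divide_pos_pos) auto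
        then show ?thesis by (simp add: t_def)
      qed
      moreover have "0 \<le> t * t" by simp
      ultimately show False using quad[of t] by (simp add: mult.assoc)
    qed
    then show ?thesis by (simp add: b_def)
  qed
  have all: "form f u = ?l * ip f u" for f
  proof -
    \<comment> \<open>Split off the component of \<open>f\<close> in the span of \<open>P\<close>.\<close>
    define g where "g x = f x + (- 1) * (\<Sum>p\<in>P. ip p f * p x)" for x
    have g: "g = (\<lambda>x. f x + (- 1) * (\<Sum>p\<in>P. ip p f * p x))" by (simp add: g_def fun_eq_iff)
    have "ip p g = 0" if p: "p \<in> P" for p
    proof -
      have "(\<Sum>p'\<in>P. ip p' f * ip p p') = (\<Sum>p'\<in>P. if p' = p then ip p f else 0)"
        using P p by (intro sum.cong) auto
      also have "\<dots> = ip p f" using P(1) p by simp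
      finally have "(\<Sum>p'\<in>P. ip p' f * ip p p') = ip p f" .
      moreover have "ip p g = ip p f + (- 1) * (\<Sum>p'\<in>P. ip p' f * ip p p')"
        by (simp only: g ip_lin ip_sum_right)
      ultimately show ?thesis by simp
    qed
    then have gu: "form g u = ?l * ip g u" by (rule main)
    have "form p u = 0" "ip p u = 0" if "p \<in> P" for p
    proof -
      from eig[OF that] obtain l where "eigvec l p" by auto
      then show "form p u = 0" using u(2)[OF that]
        by (simp add: form_commute[of p u] ip_commute[of p u] eigvec_iff)
    qed (use u(2) that in auto)
    then have "(\<Sum>p\<in>P. ip p f * form p u) = 0" "(\<Sum>p\<in>P. ip p f * ip p u) = 0" by simp_all
    moreover have "form g u = form f u + (- 1) * (\<Sum>p\<in>P. ip p f * form p u)"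
      "ip g u = ip f u + (- 1) * (\<Sum>p\<in>P. ip p f * ip p u)"
      by (simp_all only: g form_lin ip_lin form_sum_left ip_sum_left)
    ultimately have "form g u = form f u" "ip g u = ip f u" by simp_all
    then show ?thesis using gu by (simp only:)
  qed
  show ?thesis
    unfolding eigvec_iff
  proof (intro conjI allI)
    show "0 < ip u u" using u(1) by simp
    show "form g u = ?l * ip g u" for g by (rule all)
  qed
qed

text \<open>Successive minimisation: each new eigenvector minimises the Rayleigh quotient on the orthogonal
  complement of the previous ones. This variational form of the spectral theorem makes min-max immediate.\<close>

lemma orthonormal_eigvecs:
  assumes "n \<le> card X"
  shows "\<exists>\<psi> l. (\<forall>k\<in>{1..n}. eigvec (l k) (\<psi> k) \<and> ip (\<psi> k) (\<psi> k) = 1 \<and>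
     (\<forall>i\<in>{1..<k}. ip (\<psi> i) (\<psi> k) = 0) \<and>
     (\<forall>f. (\<forall>i\<in>{1..<k}. ip (\<psi> i) f = 0) \<longrightarrow> l k * ip f f \<le> form f f))"
  using assms
proof (induction n)
  case (Suc n)
  from Suc.IH[OF Suc_leD[OF Suc.prems]]
  obtain \<psi> :: "nat \<Rightarrow> 'a \<Rightarrow> real" and l where IH: "\<And>k. k \<in> {1..n} \<Longrightarrow> eigvec (l k) (\<psi> k)"
    "\<And>k. k \<in> {1..n} \<Longrightarrow> ip (\<psi> k) (\<psi> k) = 1"
    "\<And>k i. k \<in> {1..n} \<Longrightarrow> i \<in> {1..<k} \<Longrightarrow> ip (\<psi> i) (\<psi> k) = 0"
    "\<And>k f. k \<in> {1..n} \<Longrightarrow> (\<forall>i\<in>{1..<k}. ip (\<psi> i) f = 0) \<Longrightarrow> l k * ip f f \<le> form f f"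
    by blast
  define P where "P = \<psi> ` {1..n}"
  have P: "finite P" "card P < card X"
  proof -
    have "card P \<le> n" unfolding P_def using card_image_le[of "{1..n}" \<psi>] by simp
    then show "card P < card X" using Suc.prems by simp
  qed (simp add: P_def)
  obtain c where c: "\<exists>i\<in>X. c i \<noteq> 0" "\<forall>p\<in>P. (\<Sum>x\<in>X. (m x * p x) * c x) = 0"
    using homogeneous_system_nontrivial[OF P(1) fin P(2), of "\<lambda>p x. m x * p x"] by blast
  have orth: "ip (\<psi> i) (\<psi> j) = 0" if "i \<in> {1..n}" "j \<in> {1..n}" "i \<noteq> j" for i j
    using that IH(3)[of i j] IH(3)[of j i] ip_commute by (cases i j rule: linorder_cases) auto
  have "ip c c > 0" "\<And>p. p \<in> P \<Longrightarrow> ip p c = 0" using c by (auto simp: ip_pos_iff) (simp add: ip_def)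
  from rayleigh_minimizer[OF P(1) this] obtain u where u: "ip u u = 1" "\<And>p. p \<in> P \<Longrightarrow> ip p u = 0"
    "\<And>f. (\<And>p. p \<in> P \<Longrightarrow> ip p f = 0) \<Longrightarrow> form u u * ip f f \<le> form f f" by blast
  have eu: "eigvec (form u u) u"
    using u(1,2,3) _ P(1)
  proof (rule minimizer_eigvec)
    show "\<exists>l. eigvec l p" if "p \<in> P" for p
    proof -
      from that obtain i where "p = \<psi> i" "i \<in> {1..n}" unfolding P_def by blast
      with IH(1)[of i] show ?thesis by blast
    qed
    show "ip p p = 1" if "p \<in> P" for p using that IH(2) by (auto simp: P_def)
    show "ip p p' = 0" if "p \<in> P" "p' \<in> P" "p \<noteq> p'" for p p'
    proof -
      from that obtain i j where "p = \<psi> i" "i \<in> {1..n}" "p' = \<psi> j" "j \<in> {1..n}"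
        unfolding P_def by blast
      with that(3) orth[of i j] show ?thesis by auto
    qed
  qed
  define \<psi>' where "\<psi>' = \<psi>(Suc n := u)"
  define l' where "l' = l(Suc n := form u u)"
  have "eigvec (l' k) (\<psi>' k) \<and> ip (\<psi>' k) (\<psi>' k) = 1 \<and> (\<forall>i\<in>{1..<k}. ip (\<psi>' i) (\<psi>' k) = 0) \<and>
     (\<forall>f. (\<forall>i\<in>{1..<k}. ip (\<psi>' i) f = 0) \<longrightarrow> l' k * ip f f \<le> form f f)" if "k \<in> {1..Suc n}" for k
  proof (cases "k = Suc n")
    case True
    have "l' k * ip f f \<le> form f f" if "\<forall>i\<in>{1..<k}. ip (\<psi>' i) f = 0" for f
    proof -
      have "ip p f = 0" if "p \<in> P" for p
        using that \<open>\<forall>i\<in>{1..<k}. ip (\<psi>' i) f = 0\<close> True by (auto simp: P_def \<psi>'_def)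
      from u(3)[OF this] show ?thesis using True by (simp add: l'_def)
    qed
    then show ?thesis using True eu u(1,2) by (auto simp: \<psi>'_def l'_def P_def)
  next
    case False
    then have k: "k \<in> {1..n}" using that by auto
    then show ?thesis using False IH(1)[OF k] IH(2)[OF k] IH(3)[OF k] IH(4)[OF k]
      by (auto simp: \<psi>'_def l'_def)
  qed
  then show ?case by blast
qed auto

text \<open>Eigenvectors to different eigenvalues are orthogonal, while \<open>card X + 1\<close> functions on \<open>X\<close> are
  linearly dependent.\<close>

lemma finite_spectrum: "finite {l. \<exists>f. eigvec l f}"
proof (rule ccontr)
  assume "infinite {l. \<exists>f. eigvec l f}"
  then obtain T where T: "T \<subseteq> {l. \<exists>f. eigvec l f}" "finite T" "card T = Suc (card X)"
    using infinite_arbitrarily_large by blast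
  then have "\<forall>l\<in>T. \<exists>f. eigvec l f" by auto
  then obtain F where F: "\<And>l. l \<in> T \<Longrightarrow> eigvec l (F l)" by metis
  obtain c where c: "\<exists>i\<in>T. c i \<noteq> 0" "\<And>x. x \<in> X \<Longrightarrow> (\<Sum>l\<in>T. F l x * c l) = 0"
    using homogeneous_system_nontrivial[OF fin T(2), of "\<lambda>x l. F l x"] T(3) by auto
  from c(1) obtain i where i: "i \<in> T" "c i \<noteq> 0" by auto
  have "0 = ip (\<lambda>x. \<Sum>l\<in>T. c l * F l x) (F i)"
    using c(2) by (simp add: ip_def mult.commute)
  also have "\<dots> = (\<Sum>l\<in>T. if l = i then c i * ip (F i) (F i) else 0)"
    unfolding ip_sum_left ip_lin
  proof (intro sum.cong refl)
    fix l assume l: "l \<in> T"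
    show "c l * ip (F l) (F i) = (if l = i then c i * ip (F i) (F i) else 0)"
      using eigvecs_orthogonal[OF F[OF l] F[OF i(1)]] by auto
  qed
  also have "\<dots> = c i * ip (F i) (F i)" using T(2) i(1) by simp
  finally show False using i F[OF i(1)] by (auto simp: eigvec_iff)
qed

lemma Min_spectrum:
  assumes "X \<noteq> {}"
  shows "\<exists>f. eigvec (Min {l. \<exists>f. eigvec l f}) f"
    and "Min {l. \<exists>f. eigvec l f} * ip f f \<le> form f f"
proof -
  have "1 \<le> card X" using assms by (simp add: Suc_leI card_gt_0_iff)
  from orthonormal_eigvecs[OF this] obtain \<psi> l where
    e: "eigvec (l (1::nat)) (\<psi> (1::nat))" and r: "\<And>f. l 1 * ip f f \<le> form f f" by auto
  have "Min {l. \<exists>f. eigvec l f} = l 1"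
  proof (rule Min_eqI[OF finite_spectrum])
    fix y assume "y \<in> {l. \<exists>f. eigvec l f}"
    then obtain g where "eigvec y g" by auto
    then show "l 1 \<le> y" using r[of g] by (auto simp: eigvec_iff)
  qed (use e in auto)
  with e r show "\<exists>f. eigvec (Min {l. \<exists>f. eigvec l f}) f"
    and "Min {l. \<exists>f. eigvec l f} * ip f f \<le> form f f" by auto
qed

end

section \<open>Low spectrum of a kernel with a quasi-eigenbasis\<close>

text \<open>The situation of the \<open>h\<^sub>k\<close>, stripped of probability. The points \<open>p k\<close> stand for the \<open>h\<close>-minima,
  \<open>F k\<close> for the normalised \<open>h\<^sub>k\<close>, \<open>\<rho> k\<close> for its energy, and \<open>\<Lambda>\<close> for the bottom of the spectrum with
  Dirichlet conditions at the points \<open>p k\<close>. Orthogonality for the form is exact, and \<open>\<eta>\<close> measures the defect of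
  orthogonality in \<open>L\<^sup>2\<close>. Assumption \<open>harm\<close> says that \<open>F k\<close> is harmonic off the points \<open>p i\<close>.\<close>

locale quasi_eigenbasis = reversible_kernel X m A
  for X :: "'a set" and m :: "'a \<Rightarrow> real" and A :: "'a \<Rightarrow> 'a \<Rightarrow> real" +
  fixes q :: nat and p :: "nat \<Rightarrow> 'a" and F :: "nat \<Rightarrow> 'a \<Rightarrow> real" and \<rho> :: "nat \<Rightarrow> real"
    and \<Lambda> \<eta> \<theta> :: real
  assumes q: "q \<ge> 1"
    and p_in: "k \<in> {1..q} \<Longrightarrow> p k \<in> X" and p_inj: "inj_on p {1..q}"
    and tri0: "k \<in> {1..q} \<Longrightarrow> j \<in> {1..<k} \<Longrightarrow> F k (p j) = 0"
    and tri1: "k \<in> {1..q} \<Longrightarrow> F k (p k) \<noteq> 0"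
    and unit: "k \<in> {1..q} \<Longrightarrow> ip (F k) (F k) = 1"
    and quasi: "i \<in> {1..q} \<Longrightarrow> j \<in> {1..q} \<Longrightarrow> i \<noteq> j \<Longrightarrow> \<bar>ip (F i) (F j)\<bar> \<le> \<eta>"
    and diag: "k \<in> {1..q} \<Longrightarrow> form (F k) (F k) = \<rho> k"
    and off_diag: "i \<in> {1..q} \<Longrightarrow> j \<in> {1..q} \<Longrightarrow> i \<noteq> j \<Longrightarrow> form (F i) (F j) = 0"
    and harm: "k \<in> {1..q} \<Longrightarrow> (\<And>i. i \<in> {1..q} \<Longrightarrow> g (p i) = 0) \<Longrightarrow> form (F k) g = 0"
    and gap: "(\<And>i. i \<in> {1..q} \<Longrightarrow> g (p i) = 0) \<Longrightarrow> \<Lambda> * ip g g \<le> form g g"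
    and \<rho>_pos: "k \<in> {1..q} \<Longrightarrow> \<rho> k > 0"
    and sep: "k \<in> {1..<q} \<Longrightarrow> \<rho> k \<le> \<theta> * \<rho> (Suc k)"
    and sep_top: "\<rho> q \<le> \<theta> * \<Lambda>"
    and \<eta>: "0 \<le> \<eta>" "real q * \<eta> \<le> 1 / 8"
    and \<theta>: "0 \<le> \<theta>" "\<theta> \<le> 1 / 8"
begin

lemma \<Lambda>_pos: "\<Lambda> > 0"
proof -
  have "0 < \<theta> * \<Lambda>" using \<rho>_pos[of q] sep_top q by simp
  with \<theta>(1) show ?thesis by (simp add: zero_less_mult_iff)
qed

lemma \<rho>_less: "i \<in> {1..q} \<Longrightarrow> j \<in> {1..q} \<Longrightarrow> i < j \<Longrightarrow> \<rho> i \<le> \<theta> * \<rho> j"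
proof (induction j)
  case (Suc j)
  show ?case
  proof (cases "i = j")
    case True
    with Suc sep[of j] show ?thesis by auto
  next
    case False
    then have "\<rho> i \<le> \<theta> * \<rho> j" using Suc by auto
    also have "\<dots> \<le> 1 * \<rho> j" using \<theta> \<rho>_pos[of j] Suc False by (intro mult_right_mono) auto
    also have "\<dots> \<le> \<theta> * \<rho> (Suc j)" using sep[of j] Suc False by auto
    finally show ?thesis .
  qed
qed auto

lemma \<rho>_mono: "i \<in> {1..q} \<Longrightarrow> j \<in> {1..q} \<Longrightarrow> i \<le> j \<Longrightarrow> \<rho> i \<le> \<rho> j"
proof (cases "i < j")
  case True
  assume a: "i \<in> {1..q}" "j \<in> {1..q}"
  have "\<rho> i \<le> \<theta> * \<rho> j" using \<rho>_less a True by auto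
  also have "\<dots> \<le> 1 * \<rho> j" using \<theta> \<rho>_pos[OF a(2)] by (intro mult_right_mono) auto
  finally show ?thesis by simp
qed auto

lemma \<rho>_top: "k \<in> {1..q} \<Longrightarrow> \<rho> k \<le> \<theta> * \<Lambda>"
  using \<rho>_mono[of k q] sep_top q by auto

lemma form_comb:
  assumes "J \<subseteq> {1..q}"
  shows "form (\<lambda>x. \<Sum>i\<in>J. c i * F i x) (\<lambda>x. \<Sum>i\<in>J. c i * F i x) = (\<Sum>i\<in>J. (c i)\<^sup>2 * \<rho> i)"
proof -
  have "finite J" using assms finite_subset by blast
  then have "form (\<lambda>x. \<Sum>i\<in>J. c i * F i x) (\<lambda>x. \<Sum>i\<in>J. c i * F i x) = (\<Sum>i\<in>J. (c i)\<^sup>2 * form (F i) (F i))"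
    by (intro form_orthogonal_comb off_diag) (use assms in auto)
  also have "\<dots> = (\<Sum>i\<in>J. (c i)\<^sup>2 * \<rho> i)" using assms diag by (intro sum.cong) auto
  finally show ?thesis .
qed

text \<open>The Gram matrix of the \<open>F i\<close> is the identity up to off-diagonal entries of size \<open>\<eta>\<close>.\<close>

lemma ip_comb_bounds:
  assumes "J \<subseteq> {1..q}"
  shows "\<bar>ip (\<lambda>x. \<Sum>i\<in>J. c i * F i x) (\<lambda>x. \<Sum>i\<in>J. c i * F i x) - (\<Sum>i\<in>J. (c i)\<^sup>2)\<bar>
    \<le> real q * \<eta> * (\<Sum>i\<in>J. (c i)\<^sup>2)"
proof -
  have fJ: "finite J" using assms finite_subset by blast
  have cJ: "card J \<le> q" using card_mono[OF _ assms] by simp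
  have "ip (\<lambda>x. \<Sum>i\<in>J. c i * F i x) (\<lambda>x. \<Sum>i\<in>J. c i * F i x) - (\<Sum>i\<in>J. (c i)\<^sup>2)
      = (\<Sum>i\<in>J. (\<Sum>j\<in>J. c i * (c j * ip (F i) (F j))) - (c i)\<^sup>2)"
    by (simp add: ip_sum_left ip_sum_right ip_lin sum_distrib_left sum_subtractf)
  also have "\<dots> = (\<Sum>i\<in>J. \<Sum>j\<in>J. c i * (c j * ip (F i) (F j)) - (if j = i then (c i)\<^sup>2 else 0))"
    using fJ by (simp add: sum_subtractf)
  also have "\<bar>\<dots>\<bar> \<le> (\<Sum>i\<in>J. \<Sum>j\<in>J. \<eta> * (\<bar>c i\<bar> * \<bar>c j\<bar>))"
  proof (rule order_trans[OF sum_abs], rule sum_mono, rule order_trans[OF sum_abs], rule sum_mono)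
    fix i j assume ij: "i \<in> J" "j \<in> J"
    show "\<bar>c i * (c j * ip (F i) (F j)) - (if j = i then (c i)\<^sup>2 else 0)\<bar> \<le> \<eta> * (\<bar>c i\<bar> * \<bar>c j\<bar>)"
    proof (cases "j = i")
      case True
      with ij assms \<eta> show ?thesis by (auto simp: unit power2_eq_square subset_eq)
    next
      case False
      then have "\<bar>ip (F i) (F j)\<bar> \<le> \<eta>" using ij assms by (intro quasi) auto
      then have "(\<bar>c i\<bar> * \<bar>c j\<bar>) * \<bar>ip (F i) (F j)\<bar> \<le> (\<bar>c i\<bar> * \<bar>c j\<bar>) * \<eta>"
        by (intro mult_left_mono) auto
      with False show ?thesis by (simp add: abs_mult mult_ac)
    qed
  qed
  also have "\<dots> = \<eta> * (\<Sum>i\<in>J. \<bar>c i\<bar> * 1)\<^sup>2"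
    unfolding power2_eq_square mult_1_right sum_product by (simp only: sum_distrib_left)
  also have "\<dots> \<le> \<eta> * ((\<Sum>i\<in>J. \<bar>c i\<bar>\<^sup>2) * (\<Sum>i\<in>J. 1\<^sup>2))"
    using \<eta> by (intro mult_left_mono Cauchy_Schwarz_ineq_sum) auto
  also have "\<dots> = (\<eta> * (\<Sum>i\<in>J. (c i)\<^sup>2)) * card J" by simp
  also have "\<dots> \<le> (\<eta> * (\<Sum>i\<in>J. (c i)\<^sup>2)) * q"
    using \<eta> cJ by (intro mult_left_mono mult_nonneg_nonneg sum_nonneg) auto
  finally show ?thesis by (simp add: mult_ac)
qed

text \<open>The coefficients solve a triangular system, because \<open>F j\<close> vanishes at \<open>p 1, \<dots>, p (j - 1)\<close>. If \<open>f\<close>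
  vanishes at the first \<open>k - 1\<close> points, the first \<open>k - 1\<close> coefficients are zero.\<close>

lemma decompose:
  assumes "k \<in> {1..q}" and "\<And>i. i \<in> {1..<k} \<Longrightarrow> f (p i) = 0"
  shows "\<exists>c g. (\<forall>x. f x = (\<Sum>i\<in>{k..q}. c i * F i x) + g x) \<and> (\<forall>i\<in>{1..q}. g (p i) = 0)"
proof -
  have "\<exists>c. \<forall>i\<in>{1..n}. f (p i) - (\<Sum>j\<in>{k..n}. c j * F j (p i)) = 0"
    if "Suc n \<ge> k" "n \<le> q" for n
    using that
  proof (induction n)
    case (Suc n)
    show ?case
    proof (cases "Suc n \<ge> k")
      case True
      with Suc obtain c where c: "\<And>i. i \<in> {1..n} \<Longrightarrow> f (p i) - (\<Sum>j\<in>{k..n}. c j * F j (p i)) = 0"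
        by auto
      define b where "b = (f (p (Suc n)) - (\<Sum>j\<in>{k..n}. c j * F j (p (Suc n)))) / F (Suc n) (p (Suc n))"
      have "(\<Sum>j\<in>{k..Suc n}. (c(Suc n := b)) j * F j (p i))
          = (\<Sum>j\<in>{k..n}. c j * F j (p i)) + b * F (Suc n) (p i)" for i
        using True by simp
      moreover have "F (Suc n) (p (Suc n)) \<noteq> 0" using Suc.prems by (intro tri1) auto
      moreover have "F (Suc n) (p i) = 0" if "i \<in> {1..n}" for i
        using Suc.prems that by (intro tri0) auto
      ultimately have "f (p i) - (\<Sum>j\<in>{k..Suc n}. (c(Suc n := b)) j * F j (p i)) = 0"
        if "i \<in> {1..Suc n}" for i
        using that c[of i] by (cases "i = Suc n") (auto simp: b_def)
      then show ?thesis by blast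
    next
      case False
      with Suc.prems assms(2) show ?thesis by auto
    qed
  qed auto
  from this[of q] assms obtain c where
    c: "\<And>i. i \<in> {1..q} \<Longrightarrow> f (p i) - (\<Sum>j\<in>{k..q}. c j * F j (p i)) = 0" by auto
  show ?thesis
    by (rule exI[of _ c], rule exI[of _ "\<lambda>x. f x - (\<Sum>j\<in>{k..q}. c j * F j x)"]) (use c in auto)
qed

lemma form_decomposed:
  assumes "J \<subseteq> {1..q}" "\<And>x. f x = (\<Sum>i\<in>J. c i * F i x) + g x" "\<And>i. i \<in> {1..q} \<Longrightarrow> g (p i) = 0"
  shows "form f f = (\<Sum>i\<in>J. (c i)\<^sup>2 * \<rho> i) + form g g"
proof -
  have f: "f = (\<lambda>x. (\<Sum>i\<in>J. c i * F i x) + g x)" using assms(2) by (simp add: fun_eq_iff)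
  have 0: "form (\<lambda>x. \<Sum>i\<in>J. c i * F i x) g = 0"
    unfolding form_sum_left form_lin using assms(1) harm[of _ g, OF _ assms(3)]
    by (intro sum.neutral) (auto simp: subset_eq)
  with form_commute[of g "\<lambda>x. \<Sum>i\<in>J. c i * F i x"]
  have "form g (\<lambda>x. \<Sum>i\<in>J. c i * F i x) = 0" by (rule trans)
  with 0 show ?thesis
    unfolding f form_lin form_comb[OF assms(1)] by simp
qed

lemma p_card: "q \<le> card X"
proof -
  have "card (p ` {1..q}) \<le> card X" using p_in by (intro card_mono) auto
  then show ?thesis unfolding card_image[OF p_inj] by simp
qed

text \<open>The form splits exactly along \<open>f = \<Sum>\<^sub>i c\<^sub>i F\<^sub>i + g\<close>, the norm by the triangle inequality. Since
  \<open>f\<close> ranges over a space of codimension \<open>k - 1\<close>, this is the lower half of min-max for the \<open>k\<close>-th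
  eigenvalue.\<close>

lemma rayleigh_lower:
  assumes "k \<in> {1..q}" "\<And>i. i \<in> {1..<k} \<Longrightarrow> f (p i) = 0"
  shows "ip f f * \<rho> k \<le> (1 + q * \<eta> + \<theta>) * form f f"
proof -
  obtain c g where f: "\<And>x. f x = (\<Sum>i\<in>{k..q}. c i * F i x) + g x"
    and g: "\<And>i. i \<in> {1..q} \<Longrightarrow> g (p i) = 0"
    using decompose[of k f] assms by metis
  have J: "{k..q} \<subseteq> {1..q}" using assms by auto
  let ?u = "\<lambda>x. \<Sum>i\<in>{k..q}. c i * F i x"
  define a where "a = nrm ?u"
  define b where "b = nrm g"
  define s where "s = (\<Sum>i\<in>{k..q}. (c i)\<^sup>2)"
  have s0: "s \<ge> 0" by (simp add: s_def sum_nonneg)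
  have a2: "a\<^sup>2 \<le> (1 + q * \<eta>) * s"
    using ip_comb_bounds[OF J, of c] unfolding a_def nrm_power2 s_def by (simp add: algebra_simps abs_le_iff)
  have "s * \<rho> k \<le> (\<Sum>i\<in>{k..q}. (c i)\<^sup>2 * \<rho> i)"
    unfolding s_def sum_distrib_right using assms
    by (intro sum_mono mult_left_mono \<rho>_mono) auto
  moreover have "\<Lambda> * b\<^sup>2 \<le> form g g" unfolding b_def nrm_power2 by (rule gap[of g, OF g])
  ultimately have E: "\<rho> k * s + \<Lambda> * b\<^sup>2 \<le> form f f"
    using form_decomposed[OF J f g] by (simp add: mult.commute)
  have "f = (\<lambda>x. ?u x + g x)" using f by (rule ext)
  then have "nrm f \<le> a + b" unfolding a_def b_def using nrm_triangle[of ?u g] by (simp only:)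
  then have "ip f f \<le> (a + b)\<^sup>2" unfolding nrm_power2[symmetric] by (intro power_mono) auto
  then have "ip f f * \<rho> k \<le> (a + b)\<^sup>2 * \<rho> k" using \<rho>_pos[OF assms(1)] by (intro mult_right_mono) auto
  also have "\<dots> \<le> (1 + q * \<eta> + \<theta>) * (\<rho> k * s + \<Lambda> * b\<^sup>2)"
  proof -
    define T where "T = 1 + real q * \<eta>"
    have T: "T \<ge> 1" using \<eta> by (simp add: T_def)
    \<comment> \<open>Cauchy-Schwarz for \<open>a + b\<close> with the weights \<open>1 / \<rho> k\<close> and \<open>1 / (T * \<Lambda>)\<close>.\<close>
    have "(a + b)\<^sup>2 * \<rho> k \<le> (1 + \<rho> k / (T * \<Lambda>)) * (a\<^sup>2 * \<rho> k + T * \<Lambda> * b\<^sup>2)"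
    proof -
      have r: "\<rho> k > 0" and l: "T * \<Lambda> > 0" using \<rho>_pos[OF assms(1)] \<Lambda>_pos T by auto
      have "(1 + \<rho> k / (T * \<Lambda>)) * (a\<^sup>2 * \<rho> k + T * \<Lambda> * b\<^sup>2) - (a + b)\<^sup>2 * \<rho> k
          = (\<rho> k * a - T * \<Lambda> * b)\<^sup>2 / (T * \<Lambda>)"
        using l T \<Lambda>_pos by (simp add: field_simps power2_eq_square)
      also have "\<dots> \<ge> 0" using l by simp
      finally show ?thesis by simp
    qed
    also have "\<dots> \<le> (1 + \<rho> k / (T * \<Lambda>)) * (T * s * \<rho> k + T * \<Lambda> * b\<^sup>2)"
      using a2 \<rho>_pos[OF assms(1)] \<Lambda>_pos T
      by (intro mult_left_mono add_mono mult_right_mono) (auto simp: T_def)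
    also have "\<dots> = (T + \<rho> k / \<Lambda>) * (\<rho> k * s + \<Lambda> * b\<^sup>2)"
      using T \<Lambda>_pos by (simp add: field_simps)
    also have "\<dots> \<le> (T + \<theta>) * (\<rho> k * s + \<Lambda> * b\<^sup>2)"
      using \<rho>_top[OF assms(1)] \<Lambda>_pos \<rho>_pos[OF assms(1)] s0
      by (intro mult_right_mono) (auto simp: field_simps)
    finally show ?thesis by (simp add: T_def)
  qed
  also have "\<dots> \<le> (1 + q * \<eta> + \<theta>) * form f f" using E \<eta> \<theta> by (intro mult_left_mono) auto
  finally show ?thesis .
qed

text \<open>Expand \<open>f = \<Sum>\<^sub>i c\<^sub>i F\<^sub>i + g\<close> and test the eigenvalue equation. Testing with \<open>g\<close> gives
  \<open>\<parallel>g\<parallel> \<le> l / \<Lambda>\<close>; testing with \<open>F\<^sub>j\<close> gives \<open>c\<^sub>j \<rho>\<^sub>j = l \<langle>F\<^sub>j, f\<rangle>\<close>. For \<open>j > k\<close> this bounds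
  \<open>c\<^sub>j\<close> by \<open>l / \<rho>\<^sub>j\<close>. For \<open>j < k\<close>, where \<open>\<rho>\<^sub>j\<close> is much smaller than \<open>l\<close>, the term \<open>c\<^sub>j\<close> of
  \<open>\<langle>F\<^sub>j, f\<rangle>\<close> is moved to the left-hand side, and what remains on the right is a sum of overlaps. So only
  \<open>c\<^sub>k\<close> is not small, and its modulus is close to one.\<close>

lemma eigvec_near_basis:
  assumes k: "k \<in> {1..q}" and e: "eigvec l f" and unit_f: "ip f f = 1"
    and l_up: "l \<le> 8/7 * \<rho> k" and l_low: "\<rho> k \<le> 5/4 * l"
  shows "\<exists>s. \<bar>s\<bar> = 1 \<and> nrm (\<lambda>x. s * f x - F k x) \<le> 10 * real q * (q * \<eta> + \<theta>)"
proof -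
  have rk: "\<rho> k > 0" by (rule \<rho>_pos[OF k])
  have l0: "l > 0" using l_low rk by linarith
  have ev: "form g f = l * ip g f" for g using e by (simp add: eigvec_iff)
  obtain c g where f: "\<And>x. f x = (\<Sum>i\<in>{1..q}. c i * F i x) + g x"
    and g: "\<And>i. i \<in> {1..q} \<Longrightarrow> g (p i) = 0"
    using decompose[of 1 f] q by auto
  let ?u = "\<lambda>x. \<Sum>i\<in>{1..q}. c i * F i x"
  have f': "f = (\<lambda>x. ?u x + g x)" using f by (rule ext)
  define t where "t = real q * \<eta>"
  have t: "0 \<le> t" "t \<le> 1/8" using \<eta> by (auto simp: t_def)
  have nf: "nrm f = 1" using unit_f by (simp add: nrm_def)
  have nF: "nrm (F j) = 1" if "j \<in> {1..q}" for j using unit[OF that] by (simp add: nrm_def)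
  have ip_f: "\<bar>ip h f\<bar> \<le> nrm h" for h using ip_le_nrm[of h f] nf by simp
  have harm_comb: "form g ?u = 0"
    unfolding form_sum_right form_lin form_commute[of g] using harm[of _ g, OF _ g]
    by (intro sum.neutral) auto
  have form_f: "form h f = form h ?u + form h g" for h
    unfolding f' by (rule form_add_right)
  have ip_f_add: "ip h f = ip h ?u + ip h g" for h
    unfolding f' by (rule ip_add_right)
  have ng: "nrm g \<le> 8/7 * \<theta>"
  proof -
    have "\<Lambda> * (nrm g)\<^sup>2 \<le> form g g" unfolding nrm_power2 by (rule gap[of g, OF g])
    also have "\<dots> = form g f" unfolding form_f[of g] harm_comb by simp
    also have "\<dots> = l * ip g f" by (rule ev)
    also have "\<dots> \<le> l * nrm g" using ip_f[of g] l0 by (intro mult_left_mono) auto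
    finally have "\<Lambda> * nrm g * nrm g \<le> l * nrm g" by (simp add: power2_eq_square mult_ac)
    have "\<Lambda> * nrm g \<le> l"
    proof (cases "nrm g = 0")
      case False
      then have "nrm g > 0" using nrm_nonneg[of g] by linarith
      with \<open>\<Lambda> * nrm g * nrm g \<le> l * nrm g\<close> show ?thesis by (rule mult_right_le_imp_le)
    qed (use l0 in simp)
    also have "\<dots> \<le> 8/7 * (\<theta> * \<Lambda>)" using l_up \<rho>_top[OF k] by simp
    finally show ?thesis using \<Lambda>_pos by (simp add: mult_ac)
  qed
  have c_le: "\<bar>c j\<bar> \<le> 2" if j: "j \<in> {1..q}" for j
  proof -
    have "nrm ?u = nrm (\<lambda>x. f x + (-1) * g x)" using f by (simp add: nrm_def)
    also have "\<dots> \<le> 1 + nrm g" using nrm_triangle[of f "\<lambda>x. (-1) * g x"] nrm_scale[of "-1" g] nf by simp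
    also have "\<dots> \<le> 8/7" using ng \<theta> by simp
    finally have "(nrm ?u)\<^sup>2 \<le> (8/7)\<^sup>2" by (intro power_mono) auto
    then have "ip ?u ?u \<le> 64/49" unfolding nrm_power2 by (simp add: power2_eq_square)
    moreover have "(1 - t) * (\<Sum>i\<in>{1..q}. (c i)\<^sup>2) \<le> ip ?u ?u"
      using abs_le_D2[OF ip_comb_bounds[OF order_refl, of c]]
      unfolding t_def left_diff_distrib by linarith
    ultimately have "(1 - t) * (\<Sum>i\<in>{1..q}. (c i)\<^sup>2) \<le> 64/49" by (rule order_trans[rotated])
    moreover have "7/8 * (\<Sum>i\<in>{1..q}. (c i)\<^sup>2) \<le> (1 - t) * (\<Sum>i\<in>{1..q}. (c i)\<^sup>2)"
      using t by (intro mult_right_mono sum_nonneg) auto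
    moreover have "(c j)\<^sup>2 \<le> (\<Sum>i\<in>{1..q}. (c i)\<^sup>2)" using j by (intro member_le_sum) auto
    ultimately have "(c j)\<^sup>2 \<le> 2\<^sup>2" unfolding power2_eq_square[of "2::real"] by linarith
    then have "sqrt ((c j)\<^sup>2) \<le> sqrt (2\<^sup>2)" by (rule real_sqrt_le_mono)
    then show ?thesis by simp
  qed
  have test: "c j * \<rho> j = l * ip (F j) f" if j: "j \<in> {1..q}" for j
  proof -
    have "form (F j) ?u = (\<Sum>i\<in>{1..q}. if i = j then c j * \<rho> j else 0)"
      unfolding form_sum_right form_lin using j by (intro sum.cong) (auto simp: diag off_diag)
    also have "\<dots> = c j * \<rho> j" using j by simp
    finally have "form (F j) ?u = c j * \<rho> j" .
    moreover have "form (F j) g = 0" using j g by (rule harm)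
    ultimately show ?thesis unfolding ev[symmetric] form_f[of "F j"] by simp
  qed
  have c_small: "\<bar>c j\<bar> \<le> 3 * t + 2 * \<theta>" if j: "j \<in> {1..q}" "j \<noteq> k" for j
  proof (cases "j < k")
    case False
    have rj: "\<rho> j > 0" by (rule \<rho>_pos[OF j(1)])
    have "\<bar>c j\<bar> * \<rho> j = l * \<bar>ip (F j) f\<bar>"
      using arg_cong[OF test[OF j(1)], of abs] rj l0 by (simp add: abs_mult)
    also have "\<dots> \<le> l" using ip_f[of "F j"] nF[OF j(1)] l0 by simp
    also have "\<dots> \<le> 8/7 * (\<theta> * \<rho> j)" using l_up \<rho>_less[of k j] False j k by simp
    finally have "\<bar>c j\<bar> \<le> 8/7 * \<theta>" using rj by (simp add: mult_ac)
    also have "\<dots> \<le> 2 * \<theta>" using \<theta> by simp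
    finally show ?thesis using t by simp
  next
    case True
    have rj: "\<rho> j \<le> 5/32 * l" 
    proof -
      have "\<rho> j \<le> \<theta> * \<rho> k" using True j k by (intro \<rho>_less) auto
      also have "\<dots> \<le> 1/8 * (5/4 * l)" using \<theta> l_low rk by (intro mult_mono) auto
      finally show ?thesis by simp
    qed
    have "ip (F j) ?u = (\<Sum>i\<in>{1..q}. c i * ip (F j) (F i))"
      unfolding ip_sum_right ip_lin ..
    also have "\<dots> = c j + (\<Sum>i\<in>{1..q} - {j}. c i * ip (F j) (F i))"
      using j unit[OF j(1)] by (subst sum.remove[of _ j]) auto
    finally have "c j * \<rho> j = l * (c j + (\<Sum>i\<in>{1..q} - {j}. c i * ip (F j) (F i)) + ip (F j) g)"
      using test[OF j(1)] ip_f_add[of "F j"] by simp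
    then have "c j * (l - \<rho> j) = - (l * ((\<Sum>i\<in>{1..q} - {j}. c i * ip (F j) (F i)) + ip (F j) g))"
      by (simp add: algebra_simps)
    then have "\<bar>c j * (l - \<rho> j)\<bar> = l * \<bar>(\<Sum>i\<in>{1..q} - {j}. c i * ip (F j) (F i)) + ip (F j) g\<bar>"
      using l0 by (simp only: abs_minus_cancel abs_mult abs_of_pos)
    moreover have "\<bar>c j * (l - \<rho> j)\<bar> = \<bar>c j\<bar> * (l - \<rho> j)" using rj l0 by (simp add: abs_mult)
    ultimately have "\<bar>c j\<bar> * (l - \<rho> j) = l * \<bar>(\<Sum>i\<in>{1..q} - {j}. c i * ip (F j) (F i)) + ip (F j) g\<bar>"
      by simp
    also have "\<dots> \<le> l * (2 * t + 8/7 * \<theta>)"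
    proof (intro mult_left_mono order_trans[OF abs_triangle_ineq] add_mono)
      have "\<bar>\<Sum>i\<in>{1..q} - {j}. c i * ip (F j) (F i)\<bar> \<le> (\<Sum>i\<in>{1..q} - {j}. 2 * \<eta>)"
      proof (rule order_trans[OF sum_abs], rule sum_mono)
        fix i assume i: "i \<in> {1..q} - {j}"
        then have "\<bar>c i\<bar> * \<bar>ip (F j) (F i)\<bar> \<le> 2 * \<eta>"
          using c_le[of i] quasi[of j i] j by (intro mult_mono) auto
        then show "\<bar>c i * ip (F j) (F i)\<bar> \<le> 2 * \<eta>" by (simp add: abs_mult)
      qed
      also have "\<dots> \<le> 2 * t" using j \<eta> by (simp add: t_def mult_right_mono)
      finally show "\<bar>\<Sum>i\<in>{1..q} - {j}. c i * ip (F j) (F i)\<bar> \<le> 2 * t" .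
      show "\<bar>ip (F j) g\<bar> \<le> 8/7 * \<theta>" using ip_le_nrm[of "F j" g] nF[OF j(1)] ng by simp
    qed (use l0 in auto)
    finally have *: "\<bar>c j\<bar> * (l - \<rho> j) \<le> l * (2 * t + 8/7 * \<theta>)" .
    have "\<bar>c j\<bar> * (27/32 * l) \<le> \<bar>c j\<bar> * (l - \<rho> j)" using rj by (intro mult_left_mono) auto
    also note *
    finally have "l * (27/32 * \<bar>c j\<bar>) \<le> l * (2 * t + 8/7 * \<theta>)" by (simp add: mult_ac)
    then have "27/32 * \<bar>c j\<bar> \<le> 2 * t + 8/7 * \<theta>" using l0 by (simp only: mult_le_cancel_left_pos)
    then show ?thesis using t \<theta> by linarith
  qed
  define \<epsilon> where "\<epsilon> = q * (3 * t + 2 * \<theta>) + 8/7 * \<theta>"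
  have near: "nrm (\<lambda>x. f x - c k * F k x) \<le> \<epsilon>"
  proof -
    have "f x - c k * F k x = (\<Sum>i\<in>{1..q} - {k}. c i * F i x) + g x" for x
    proof -
      have "(\<Sum>i\<in>{1..q}. c i * F i x) = c k * F k x + (\<Sum>i\<in>{1..q} - {k}. c i * F i x)"
        using k by (intro sum.remove) auto
      then show ?thesis using f[of x] by simp
    qed
    then have "(\<lambda>x. f x - c k * F k x) = (\<lambda>x. (\<Sum>i\<in>{1..q} - {k}. c i * F i x) + g x)"
      by (rule ext)
    then have "nrm (\<lambda>x. f x - c k * F k x) \<le> nrm (\<lambda>x. \<Sum>i\<in>{1..q} - {k}. c i * F i x) + nrm g"
      by (simp only: nrm_triangle)
    also have "nrm (\<lambda>x. \<Sum>i\<in>{1..q} - {k}. c i * F i x) \<le> (\<Sum>i\<in>{1..q} - {k}. nrm (\<lambda>x. c i * F i x))"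
      by (rule nrm_sum)
    also have "\<dots> \<le> (\<Sum>i\<in>{1..q} - {k}. 3 * t + 2 * \<theta>)"
      using c_small nF by (intro sum_mono) (auto simp: nrm_scale)
    also have "\<dots> \<le> q * (3 * t + 2 * \<theta>)" using k t \<theta> by (simp add: mult_right_mono)
    finally show ?thesis using ng by (simp add: \<epsilon>_def)
  qed
  \<comment> \<open>The eigenvector is determined up to sign only.\<close>
  define s where "s = (if c k \<ge> 0 then 1 else - 1 :: real)"
  have s: "s * s = 1" "\<bar>s\<bar> = 1" "s * c k = \<bar>c k\<bar>" by (auto simp: s_def)
  have "\<bar>\<bar>c k\<bar> - 1\<bar> \<le> \<epsilon>"
  proof -
    have "nrm f \<le> nrm (\<lambda>x. f x - c k * F k x) + nrm (\<lambda>x. c k * F k x)"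
      using nrm_triangle[of "\<lambda>x. f x - c k * F k x" "\<lambda>x. c k * F k x"] by simp
    moreover have "nrm (\<lambda>x. c k * F k x) \<le> nrm f + nrm (\<lambda>x. (-1) * (f x - c k * F k x))"
      using nrm_triangle[of f "\<lambda>x. (-1) * (f x - c k * F k x)"] by simp
    ultimately have "1 \<le> nrm (\<lambda>x. f x - c k * F k x) + \<bar>c k\<bar>"
      "\<bar>c k\<bar> \<le> 1 + nrm (\<lambda>x. f x - c k * F k x)"
      using nf nF[OF k] unfolding nrm_scale by simp_all
    then show ?thesis using near by linarith
  qed
  have "nrm (\<lambda>x. s * f x - F k x) = nrm (\<lambda>x. s * (f x - c k * F k x) + (\<bar>c k\<bar> - 1) * F k x)"
    by (simp add: algebra_simps flip: s(3))
  also have "\<dots> \<le> nrm (\<lambda>x. s * (f x - c k * F k x)) + nrm (\<lambda>x. (\<bar>c k\<bar> - 1) * F k x)"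
    by (rule nrm_triangle)
  also have "\<dots> \<le> \<epsilon> + \<epsilon>"
    using near \<open>\<bar>\<bar>c k\<bar> - 1\<bar> \<le> \<epsilon>\<close> s nF[OF k] by (intro add_mono) (auto simp: nrm_scale)
  also have "\<dots> \<le> 10 * real q * (t + \<theta>)"
  proof -
    have "\<theta> \<le> q * \<theta>" "0 \<le> q * t" using q \<theta> t by (auto simp: mult_le_cancel_right1)
    moreover have "10 * real q * (t + \<theta>) = 10 * (q * t) + 10 * (q * \<theta>)"
      "q * (3 * t + 2 * \<theta>) = 3 * (q * t) + 2 * (q * \<theta>)" by (simp_all add: algebra_simps)
    ultimately show ?thesis using \<theta>(1) unfolding \<epsilon>_def by linarith
  qed
  finally show ?thesis using s(2) unfolding t_def by blast
qed

text \<open>Min-max in both directions. The span of \<open>F 1, \<dots>, F k\<close> bounds the \<open>k\<close>-th eigenvalue from above; a combination of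
  the first \<open>k\<close> eigenvectors that vanishes at \<open>p 1, \<dots>, p (k - 1)\<close> bounds it from below. A further
  eigenvalue below \<open>\<Lambda>\<close> would leave room for a combination of \<open>q + 1\<close> eigenvectors that vanishes at all
  points \<open>p k\<close>, which contradicts the gap. The separation of the \<open>\<rho> k\<close> makes the eigenvalues distinct.\<close>

theorem low_spectrum:
  "\<exists>l \<psi>. strict_mono_on {1..q} l \<and> {e. (\<exists>f. eigvec e f) \<and> e < \<Lambda>} = l ` {1..q} \<and>
    (\<forall>k\<in>{1..q}. \<bar>l k / \<rho> k - 1\<bar> \<le> 2 * (q * \<eta> + \<theta>) \<and> eigvec (l k) (\<psi> k) \<and> ip (\<psi> k) (\<psi> k) = 1 \<and>
      nrm (\<lambda>x. \<psi> k x - F k x) \<le> 10 * real q * (q * \<eta> + \<theta>))"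
proof -
  define t where "t = real q * \<eta>"
  have t: "0 \<le> t" "t \<le> 1/8" using \<eta> by (auto simp: t_def)
  from orthonormal_eigvecs[OF p_card] obtain \<psi> :: "nat \<Rightarrow> 'a \<Rightarrow> real" and l where
    ev: "\<And>k. k \<in> {1..q} \<Longrightarrow> eigvec (l k) (\<psi> k)" and
    un: "\<And>k. k \<in> {1..q} \<Longrightarrow> ip (\<psi> k) (\<psi> k) = 1" and
    orth: "\<And>k i. k \<in> {1..q} \<Longrightarrow> i \<in> {1..<k} \<Longrightarrow> ip (\<psi> i) (\<psi> k) = 0" and
    min: "\<And>k f. k \<in> {1..q} \<Longrightarrow> (\<And>i. i \<in> {1..<k} \<Longrightarrow> ip (\<psi> i) f = 0) \<Longrightarrow> l k * ip f f \<le> form f f"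
    by blast
  have orth': "ip (\<psi> i) (\<psi> j) = 0" if "i \<in> {1..q}" "j \<in> {1..q}" "i \<noteq> j" for i j
    using that orth[of i j] orth[of j i] ip_commute by (cases i j rule: linorder_cases) auto
  have mono: "l i \<le> l j" if "i \<in> {1..q}" "j \<in> {1..q}" "i \<le> j" for i j
  proof -
    have "l i * ip (\<psi> j) (\<psi> j) \<le> form (\<psi> j) (\<psi> j)" using that orth[of j] by (intro min) auto
    then show ?thesis using ev[OF that(2)] un[OF that(2)] by (auto simp: eigvec_iff)
  qed
  have upper: "l k * (1 - t) \<le> \<rho> k" if k: "k \<in> {1..q}" for k
  proof -
    have "card {1..<k} < card {1..k}" using k by auto
    from homogeneous_system_nontrivial[OF _ _ this, of "\<lambda>j i. ip (\<psi> j) (F i)"] obtain c where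
      c: "\<exists>i\<in>{1..k}. c i \<noteq> 0" "\<And>j. j \<in> {1..<k} \<Longrightarrow> (\<Sum>i\<in>{1..k}. ip (\<psi> j) (F i) * c i) = 0" by blast
    define S where "S = (\<Sum>i\<in>{1..k}. (c i)\<^sup>2)"
    have S: "S > 0" unfolding S_def using c(1) by (auto intro: sum_pos2)
    let ?f = "\<lambda>x. \<Sum>i\<in>{1..k}. c i * F i x"
    have J: "{1..k} \<subseteq> {1..q}" using k by auto
    have "ip ?f ?f \<ge> (1 - t) * S"
      using ip_comb_bounds[OF J, of c] by (simp add: S_def t_def algebra_simps abs_le_iff)
    moreover have "ip (\<psi> j) ?f = 0" if "j \<in> {1..<k}" for j
      unfolding ip_sum_right ip_lin using c(2)[OF that] by (simp add: mult.commute)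
    then have "l k * ip ?f ?f \<le> form ?f ?f" by (rule min[OF k])
    moreover have "form ?f ?f \<le> S * \<rho> k"
      unfolding form_comb[OF J] S_def sum_distrib_right using k
      by (intro sum_mono mult_left_mono \<rho>_mono) auto
    moreover have "l k * ((1 - t) * S) \<le> l k * ip ?f ?f \<or> l k < 0"
      using calculation(1) by (auto intro!: mult_left_mono)
    ultimately have "l k * (1 - t) * S \<le> \<rho> k * S \<or> l k < 0" by (auto simp: mult_ac)
    then show ?thesis
    proof
      assume "l k < 0"
      then have "l k * (1 - t) \<le> 0" using t by (simp add: mult_nonpos_nonneg)
      then show ?thesis using \<rho>_pos[OF k] by simp
    qed (use S in simp)
  qed
  have form_psi: "form (\<lambda>x. \<Sum>i\<in>J. c i * \<psi> i x) (\<lambda>x. \<Sum>i\<in>J. c i * \<psi> i x) = (\<Sum>i\<in>J. (c i)\<^sup>2 * l i)"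
    and ip_psi: "ip (\<lambda>x. \<Sum>i\<in>J. c i * \<psi> i x) (\<lambda>x. \<Sum>i\<in>J. c i * \<psi> i x) = (\<Sum>i\<in>J. (c i)\<^sup>2)"
    if J: "J \<subseteq> {1..q}" for J c
  proof -
    have fJ: "finite J" using J finite_subset by blast
    have f: "form (\<psi> i) (\<psi> j) = l j * ip (\<psi> i) (\<psi> j)" if "j \<in> J" for i j
      using that J ev[of j] by (auto simp: eigvec_iff)
    have o: "ip (\<psi> i) (\<psi> j) = 0" if "i \<in> J" "j \<in> J" "i \<noteq> j" for i j
      using that J by (intro orth') auto
    have one: "ip (\<psi> i) (\<psi> i) = 1" if "i \<in> J" for i using that J by (intro un) auto
    show "ip (\<lambda>x. \<Sum>i\<in>J. c i * \<psi> i x) (\<lambda>x. \<Sum>i\<in>J. c i * \<psi> i x) = (\<Sum>i\<in>J. (c i)\<^sup>2)"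
      using ip_orthogonal_comb[where c = c, OF fJ o] one by simp
    have "form (\<psi> i) (\<psi> j) = 0" if "i \<in> J" "j \<in> J" "i \<noteq> j" for i j
      using f[OF that(2)] o[OF that] by simp
    from form_orthogonal_comb[where c = c, OF fJ this]
    show "form (\<lambda>x. \<Sum>i\<in>J. c i * \<psi> i x) (\<lambda>x. \<Sum>i\<in>J. c i * \<psi> i x) = (\<Sum>i\<in>J. (c i)\<^sup>2 * l i)"
      using f one by simp
  qed
  have lower: "\<rho> k \<le> (1 + t + \<theta>) * l k" if k: "k \<in> {1..q}" for k
  proof -
    have "card {1..<k} < card {1..k}" using k by auto
    from homogeneous_system_nontrivial[OF _ _ this, of "\<lambda>j i. \<psi> i (p j)"] obtain c where
      c: "\<exists>i\<in>{1..k}. c i \<noteq> 0" "\<And>j. j \<in> {1..<k} \<Longrightarrow> (\<Sum>i\<in>{1..k}. \<psi> i (p j) * c i) = 0" by blast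
    define S where "S = (\<Sum>i\<in>{1..k}. (c i)\<^sup>2)"
    have S: "S > 0" unfolding S_def using c(1) by (auto intro: sum_pos2)
    let ?f = "\<lambda>x. \<Sum>i\<in>{1..k}. c i * \<psi> i x"
    have J: "{1..k} \<subseteq> {1..q}" using k by auto
    have "ip ?f ?f * \<rho> k \<le> (1 + q * \<eta> + \<theta>) * form ?f ?f"
      using c(2) by (intro rayleigh_lower[OF k]) (simp add: mult.commute)
    moreover have "ip ?f ?f = S" using ip_psi[OF J] by (simp add: S_def)
    moreover have "form ?f ?f \<le> S * l k"
      unfolding form_psi[OF J] S_def sum_distrib_right using k
      by (intro sum_mono mult_left_mono mono) auto
    then have "(1 + q * \<eta> + \<theta>) * form ?f ?f \<le> (1 + q * \<eta> + \<theta>) * (S * l k)"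
      using \<eta> \<theta> by (intro mult_left_mono) auto
    ultimately have "\<rho> k * S \<le> ((1 + t + \<theta>) * l k) * S" by (simp add: t_def mult_ac)
    then show ?thesis using S by simp
  qed
  have l0: "l k > 0" if k: "k \<in> {1..q}" for k
  proof -
    have "0 < (1 + t + \<theta>) * l k" using lower[OF k] \<rho>_pos[OF k] by linarith
    then show ?thesis using t \<theta> by (simp add: zero_less_mult_iff)
  qed
  have l_up: "l k \<le> 8/7 * \<rho> k" if k: "k \<in> {1..q}" for k
  proof -
    have "l k * (7/8) \<le> l k * (1 - t)" using l0[OF k] t by (intro mult_left_mono) auto
    then show ?thesis using upper[OF k] by simp
  qed
  have l_low: "\<rho> k \<le> 5/4 * l k" if k: "k \<in> {1..q}" for k
  proof -
    have "(1 + t + \<theta>) * l k \<le> 5/4 * l k" using l0[OF k] t \<theta> by (intro mult_right_mono) auto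
    then show ?thesis using lower[OF k] by simp
  qed
  have below: "l k < \<Lambda>" if k: "k \<in> {1..q}" for k
  proof -
    have "\<theta> * \<Lambda> \<le> 1/8 * \<Lambda>" using \<theta> \<Lambda>_pos by (intro mult_right_mono) auto
    then show ?thesis using l_up[OF k] \<rho>_top[OF k] \<Lambda>_pos by linarith
  qed
  have ratio: "\<bar>l k / \<rho> k - 1\<bar> \<le> 2 * (q * \<eta> + \<theta>)" if k: "k \<in> {1..q}" for k
  proof -
    define r where "r = l k / \<rho> k"
    have rk: "\<rho> k > 0" by (rule \<rho>_pos[OF k])
    have r1: "r * (1 - t) \<le> 1" using upper[OF k] rk by (simp add: r_def)
    have r2: "1 \<le> (1 + t + \<theta>) * r" using lower[OF k] rk by (simp add: r_def)
    have r3: "r \<le> 8/7" using l_up[OF k] rk by (simp add: r_def field_simps)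
    have "r * t \<le> 8/7 * t" using r3 t by (intro mult_right_mono) auto
    moreover have "r * t \<ge> 0" using l0[OF k] rk t by (simp add: r_def)
    moreover have "r * (t + \<theta>) \<le> 8/7 * (t + \<theta>)" using r3 t \<theta> by (intro mult_right_mono) auto
    ultimately have "r - 1 \<le> 2 * (t + \<theta>)" "1 - r \<le> 2 * (t + \<theta>)"
      using r1 r2 t \<theta> by (simp_all add: algebra_simps)
    then show ?thesis by (simp add: r_def t_def abs_le_iff)
  qed
  have strict: "strict_mono_on {1..q} l"
  proof (rule strict_mono_onI)
    fix i j assume ij: "i \<in> {1..q}" "j \<in> {1..q}" "i < j"
    have "l i \<le> 8/7 * \<rho> i" by (rule l_up[OF ij(1)])
    also have "\<dots> \<le> 8/7 * (\<theta> * \<rho> j)" using \<rho>_less[OF ij] by simp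
    also have "\<dots> \<le> 8/7 * (1/8 * (5/4 * l j))"
      using \<theta> l_low[OF ij(2)] \<rho>_pos[OF ij(2)] by (intro mult_left_mono mult_mono) auto
    also have "\<dots> < l j" using l0[OF ij(2)] by simp
    finally show "l i < l j" .
  qed
  have "{e. (\<exists>f. eigvec e f) \<and> e < \<Lambda>} = l ` {1..q}"
  proof (intro equalityI subsetI)
    fix e assume "e \<in> {e. (\<exists>f. eigvec e f) \<and> e < \<Lambda>}"
    then obtain f where e: "eigvec e f" "e < \<Lambda>" by auto
    show "e \<in> l ` {1..q}"
    proof (rule ccontr)
      assume new: "e \<notin> l ` {1..q}"
      define \<phi> where "\<phi> i = (if i = Suc q then f else \<psi> i)" for i
      define le where "le i = (if i = Suc q then e else l i)" for i
      define J where "J = {1..Suc q}"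
      have fJ: "finite J" by (simp add: J_def)
      have ev': "eigvec (le i) (\<phi> i)" if "i \<in> J" for i
        using that ev e(1) by (auto simp: \<phi>_def le_def J_def)
      have le': "le i < \<Lambda>" if "i \<in> J" for i
        using that below e(2) by (auto simp: le_def J_def)
      have o': "ip (\<phi> i) (\<phi> j) = 0" if "i \<in> J" "j \<in> J" "i \<noteq> j" for i j
      proof -
        have "le i \<noteq> le j"
        proof (cases "i = Suc q \<or> j = Suc q")
          case True
          with that new show ?thesis by (auto simp: le_def J_def)
        next
          case False
          then have "i \<in> {1..q}" "j \<in> {1..q}" using that by (auto simp: J_def)
          moreover have "inj_on l {1..q}" using strict by (rule strict_mono_on_imp_inj_on)
          ultimately show ?thesis using that(3) False by (auto simp: le_def inj_on_eq_iff)
        qed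
        then show ?thesis using eigvecs_orthogonal ev' that by blast
      qed
      obtain c where c: "\<exists>i\<in>J. c i \<noteq> 0"
        "\<And>j. j \<in> {1..q} \<Longrightarrow> (\<Sum>i\<in>J. \<phi> i (p j) * c i) = 0"
      proof -
        have "card {1..q} < card J" by (simp add: J_def)
        from homogeneous_system_nontrivial[OF _ fJ this, of "\<lambda>j i. \<phi> i (p j)"] show ?thesis
          using that by blast
      qed
      let ?f = "\<lambda>x. \<Sum>i\<in>J. c i * \<phi> i x"
      have "\<Lambda> * ip ?f ?f \<le> form ?f ?f" using c(2) by (intro gap) (simp add: mult.commute)
      moreover have f': "form (\<phi> i) (\<phi> j) = le j * ip (\<phi> i) (\<phi> j)" if "j \<in> J" for i j
        using ev'[OF that] by (simp add: eigvec_iff)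
      have "form (\<phi> i) (\<phi> j) = 0" if "i \<in> J" "j \<in> J" "i \<noteq> j" for i j
        using f'[OF that(2)] o'[OF that] by simp
      from form_orthogonal_comb[where c = c, OF fJ this]
      have "form ?f ?f = (\<Sum>i\<in>J. (c i)\<^sup>2 * (le i * ip (\<phi> i) (\<phi> i)))" using f' by simp
      moreover note ip_orthogonal_comb[where c = c, OF fJ o']
      ultimately have "\<Lambda> * (\<Sum>i\<in>J. (c i)\<^sup>2 * ip (\<phi> i) (\<phi> i))
          \<le> (\<Sum>i\<in>J. (c i)\<^sup>2 * (le i * ip (\<phi> i) (\<phi> i)))" by simp
      then have "(\<Sum>i\<in>J. (c i)\<^sup>2 * (- ((le i - \<Lambda>) * ip (\<phi> i) (\<phi> i)))) \<le> 0"
        by (simp add: algebra_simps sum_subtractf sum_distrib_left)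
      moreover have "0 < (\<Sum>i\<in>J. (c i)\<^sup>2 * (- ((le i - \<Lambda>) * ip (\<phi> i) (\<phi> i))))"
      proof -
        have neg: "(le i - \<Lambda>) * ip (\<phi> i) (\<phi> i) < 0" if "i \<in> J" for i
          using le'[OF that] ev'[OF that] by (auto simp: eigvec_iff mult_neg_pos)
        obtain i where i: "i \<in> J" "c i \<noteq> 0" using c(1) by auto
        show ?thesis
          using i neg by (intro sum_pos2[OF fJ i(1)] mult_pos_pos mult_nonneg_nonneg) (auto simp: less_imp_le)
      qed
      ultimately show False by simp
    qed
  next
    fix e assume "e \<in> l ` {1..q}"
    then show "e \<in> {e. (\<exists>f. eigvec e f) \<and> e < \<Lambda>}" using ev below by blast
  qed
  have "\<exists>s. \<bar>s\<bar> = 1 \<and> nrm (\<lambda>x. s * \<psi> k x - F k x) \<le> 10 * real q * (q * \<eta> + \<theta>)"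
    if k: "k \<in> {1..q}" for k
    by (rule eigvec_near_basis[OF k ev[OF k] un[OF k] l_up[OF k] l_low[OF k]])
  then obtain s :: "nat \<Rightarrow> real" where s: "\<And>k. k \<in> {1..q} \<Longrightarrow> \<bar>s k\<bar> = 1"
    "\<And>k. k \<in> {1..q} \<Longrightarrow> nrm (\<lambda>x. s k * \<psi> k x - F k x) \<le> 10 * real q * (q * \<eta> + \<theta>)" by metis
  have s2: "s k * s k = 1" "s k \<noteq> 0" if "k \<in> {1..q}" for k
    using s(1)[OF that] abs_mult_self_eq[of "s k"] by auto
  show ?thesis
  proof (rule exI[of _ l], rule exI[of _ "\<lambda>k x. s k * \<psi> k x"], intro conjI ballI)
    show "strict_mono_on {1..q} l" by (rule strict)
    show "{e. (\<exists>f. eigvec e f) \<and> e < \<Lambda>} = l ` {1..q}" by fact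
  next
    fix k assume k: "k \<in> {1..q}"
    show "eigvec (l k) (\<lambda>x. s k * \<psi> k x)" by (rule eigvec_scale[OF ev[OF k] s2(2)[OF k]])
    show "ip (\<lambda>x. s k * \<psi> k x) (\<lambda>x. s k * \<psi> k x) = 1"
      using s2(1)[OF k] un[OF k] by (simp add: ip_lin)
    show "nrm (\<lambda>x. s k * \<psi> k x - F k x) \<le> 10 * real q * (q * \<eta> + \<theta>)" by (rule s(2)[OF k])
    show "\<bar>l k / \<rho> k - 1\<bar> \<le> 2 * (q * \<eta> + \<theta>)" by (rule ratio[OF k])
  qed
qed

end

section \<open>Landscapes, valleys and energy estimates\<close>

text \<open>The saddle height between \<open>y\<close> and \<open>S\<close>, for a function on the integers.\<close>

definition pass :: "(int \<Rightarrow> real) \<Rightarrow> int \<Rightarrow> int set \<Rightarrow> real" where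
  "pass U y S = Min ((\<lambda>s. Max (U ` {min s y..max s y})) ` S)"

lemma pass_attained:
  assumes "finite S" "S \<noteq> {}"
  shows "\<exists>s\<in>S. \<forall>z\<in>{min s y..max s y}. U z \<le> pass U y S"
proof -
  have "pass U y S \<in> (\<lambda>s. Max (U ` {min s y..max s y})) ` S"
    unfolding pass_def using assms by (intro Min_in) auto
  then obtain s where s: "s \<in> S" "pass U y S = Max (U ` {min s y..max s y})" by auto
  have "U z \<le> pass U y S" if "z \<in> {min s y..max s y}" for z
    unfolding s(2) using that by (intro Max_ge) auto
  with s(1) show ?thesis by blast
qed

lemma pass_barrier:
  assumes "finite S" "s \<in> S"
  shows "\<exists>z\<in>{min s y..max s y}. pass U y S \<le> U z"
proof -
  have "Max (U ` {min s y..max s y}) \<in> U ` {min s y..max s y}" by (intro Max_in) auto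
  then obtain z where z: "z \<in> {min s y..max s y}" "Max (U ` {min s y..max s y}) = U z" by blast
  have "pass U y S \<le> Max (U ` {min s y..max s y})"
    unfolding pass_def using assms by (intro Min_le) auto
  with z show ?thesis by auto
qed

lemma pass_le:
  assumes "finite S" "s \<in> S" "\<And>z. z \<in> {min s y..max s y} \<Longrightarrow> U z \<le> c"
  shows "pass U y S \<le> c"
  using pass_barrier[OF assms(1,2), of y U] assms(3) by force

lemma pass_ge:
  assumes "finite S" "S \<noteq> {}" "\<And>s. s \<in> S \<Longrightarrow> \<exists>z\<in>{min s y..max s y}. c \<le> U z"
  shows "c \<le> pass U y S"
  using pass_attained[OF assms(1,2), of y U] assms(3) by force

lemma pass_antimono:
  assumes "T \<subseteq> S" "T \<noteq> {}" "finite S"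
  shows "pass U y S \<le> pass U y T"
proof (rule pass_ge)
  show "finite T" using assms finite_subset by blast
  show "\<exists>z\<in>{min s y..max s y}. pass U y S \<le> U z" if "s \<in> T" for s
    using that assms by (intro pass_barrier) auto
qed (rule assms)

text \<open>The valley of \<open>y\<close> reaches to the nearest sites on both sides that are as high as the pass. It
  contains no point of \<open>S\<close>, for such a point would be reached below the pass.\<close>

lemma valley_exists:
  assumes S: "finite S" and "lo \<in> S" "hi \<in> S" "lo < y" "y < hi" and y: "U y < pass U y S"
  shows "\<exists>a b. lo \<le> a \<and> a < y \<and> y < b \<and> b \<le> hi \<and> pass U y S \<le> U a \<and> pass U y S \<le> U b \<and>
    (\<forall>z\<in>{a<..<b}. U z < pass U y S \<and> z \<notin> S)"
proof -
  define P where "P = pass U y S"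
  define L where "L = {lo..<y} \<inter> {z. P \<le> U z}"
  define R where "R = {y<..hi} \<inter> {z. P \<le> U z}"
  have fin: "finite L" "finite R" by (simp_all add: L_def R_def)
  obtain z1 where "z1 \<in> {lo..y}" "P \<le> U z1"
    using pass_barrier[OF S assms(2), of y U] assms(4) by (auto simp: P_def)
  then have "z1 \<in> L" using y by (cases "z1 = y") (auto simp: L_def P_def)
  then have a: "Max L \<in> L" using fin by (intro Max_in) auto
  obtain z2 where "z2 \<in> {y..hi}" "P \<le> U z2"
    using pass_barrier[OF S assms(3), of y U] assms(5) by (auto simp: P_def)
  then have "z2 \<in> R" using y by (cases "z2 = y") (auto simp: R_def P_def)
  then have b: "Min R \<in> R" using fin by (intro Min_in) auto
  have low: "U z < P" if "z \<in> {Max L<..<Min R}" for z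
  proof (rule ccontr)
    assume "\<not> U z < P"
    then have "z \<in> L \<or> z \<in> R" using that a b y by (cases z y rule: linorder_cases) (auto simp: L_def R_def P_def)
    then have "z \<le> Max L \<or> Min R \<le> z" using fin by auto
    with that show False by auto
  qed
  have "z \<notin> S" if z: "z \<in> {Max L<..<Min R}" for z
  proof
    assume "z \<in> S"
    then obtain z' where z': "z' \<in> {min z y..max z y}" "P \<le> U z'"
      using pass_barrier[OF S, of z y U] by (auto simp: P_def)
    moreover have "z' \<in> {Max L<..<Min R}" using z z' a b by (auto simp: L_def R_def)
    ultimately show False using low by force
  qed
  with low a b show ?thesis
    by (intro exI[of _ "Max L"] exI[of _ "Min R"]) (auto simp: L_def R_def P_def)
qed

lemma pass_ge_valley:
  assumes "finite S" "S \<noteq> {}" "a < x" "x < b" "c \<le> U a" "c \<le> U b" "\<And>z. z \<in> {a<..<b} \<Longrightarrow> z \<notin> S"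
  shows "c \<le> pass U x S"
proof (rule pass_ge[OF assms(1,2)])
  fix s assume "s \<in> S"
  then have "s \<le> a \<or> b \<le> s" using assms(7)[of s] by force
  then show "\<exists>z\<in>{min s x..max s x}. c \<le> U z"
  proof
    assume "s \<le> a"
    then show ?thesis using assms(3,5) by (intro bexI[of _ a]) auto
  next
    assume "b \<le> s"
    then show ?thesis using assms(4,6) by (intro bexI[of _ b]) auto
  qed
qed

lemma leftmost_minimizer:
  fixes U :: "int \<Rightarrow> real"
  assumes "a \<le> b"
  obtains y where "y \<in> {a..b}" "\<And>z. z \<in> {a..b} \<Longrightarrow> U y \<le> U z" "\<And>z. z \<in> {a..<y} \<Longrightarrow> U y < U z"
proof -
  define m where "m = Min (U ` {a..b})"
  define M where "M = {a..b} \<inter> {z. U z = m}"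
  have "m \<in> U ` {a..b}" unfolding m_def using assms by (intro Min_in) auto
  then have "M \<noteq> {}" by (auto simp: M_def)
  moreover have fM: "finite M" by (simp add: M_def)
  ultimately have y: "Min M \<in> M" by (intro Min_in)
  have m: "m \<le> U z" if "z \<in> {a..b}" for z unfolding m_def using that by (intro Min_le) auto
  have "U (Min M) < U z" if z: "z \<in> {a..<Min M}" for z
  proof (rule ccontr)
    assume "\<not> U (Min M) < U z"
    then have "z \<in> M" using z y m[of z] by (auto simp: M_def)
    then have "Min M \<le> z" using fM by auto
    with z show False by auto
  qed
  with y m show ?thesis by (intro that[of "Min M"]) (auto simp: M_def)
qed

text \<open>The conditions on the potential that the estimates use, on the sites \<open>-n, \<dots>, n\<close>. Here \<open>h\<close> and \<open>d\<close> are the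
  parameters \<open>h\<close> and \<open>\<delta>\<close> of the path, both multiplied by \<open>\<surd>N\<close>. Condition \<open>wells\<close> expresses that the
  \<open>p k\<close> are all of the \<open>h\<close>-minima, choosing the leftmost bottom of a valley as its representative; \<open>deep\<close> and
  \<open>order\<close> are the two other defining properties of good paths.\<close>

locale good_landscape =
  fixes U :: "int \<Rightarrow> real" and n :: int and p :: "nat \<Rightarrow> int" and q :: nat and h d :: real
  assumes n: "n > 0" and h: "h > 0" and d: "d > 0" and q: "q \<ge> 1"
    and p_range: "k \<in> {1..q} \<Longrightarrow> p k \<in> {-n<..<n}"
    and p_inj: "inj_on p {1..q}"
    and wells: "\<And>a b y. -n \<le> a \<Longrightarrow> a < y \<Longrightarrow> y < b \<Longrightarrow> b \<le> n \<Longrightarrow> U y + h \<le> U a \<Longrightarrow> U y + h \<le> U b \<Longrightarrow>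
        (\<And>z. z \<in> {a..b} \<Longrightarrow> U y \<le> U z) \<Longrightarrow> (\<And>z. z \<in> {a..<y} \<Longrightarrow> U y < U z) \<Longrightarrow> y \<in> p ` {1..q}"
    and deep: "k \<in> {1..q} \<Longrightarrow> U (p k) + h + d \<le> pass U (p k) ((p ` {1..q} \<union> {-n, n}) - {p k})"
    and order: "k \<in> {1..q} \<Longrightarrow> j \<in> {k<..q} \<Longrightarrow>
        pass U (p j) (p ` {1..k - 1} \<union> {-n, n}) - U (p j) + d
          \<le> pass U (p k) (p ` {1..k - 1} \<union> {-n, n}) - U (p k)"
begin

definition bd :: "nat \<Rightarrow> int set" where "bd k = p ` {1..k} \<union> {-n, n}"

definition H :: "nat \<Rightarrow> real" where "H k = pass U (p k) (bd (k - 1))"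

lemma bd_finite [simp]: "finite (bd k)" and bd_nonempty [simp]: "bd k \<noteq> {}"
  and bd_ends [simp]: "-n \<in> bd k" "n \<in> bd k"
  by (simp_all add: bd_def)

lemma bd_mono: "j \<le> k \<Longrightarrow> bd j \<subseteq> bd k"
  by (auto simp: bd_def)

lemma bd_range: "k \<le> q \<Longrightarrow> bd k \<subseteq> {-n..n}"
  using p_range n unfolding bd_def by fastforce

lemma p_in_bd: "k \<in> {1..j} \<Longrightarrow> p k \<in> bd j"
  by (auto simp: bd_def)

lemma p_notin_bd: "k \<in> {1..q} \<Longrightarrow> j < k \<Longrightarrow> p k \<notin> bd j"
proof
  assume k: "k \<in> {1..q}" "j < k" and "p k \<in> bd j"
  then obtain i where "i \<in> {1..j}" "p k = p i" using p_range[of k] by (auto simp: bd_def)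
  with k inj_onD[OF p_inj, of k i] show False by auto
qed

lemma bd_Suc: "k \<in> {1..q} \<Longrightarrow> bd k = insert (p k) (bd (k - 1))"
proof -
  assume "k \<in> {1..q}"
  then have "{1..k} = insert k {1..k - 1}" by auto
  then show ?thesis by (auto simp: bd_def)
qed

lemma H_depth: "k \<in> {1..q} \<Longrightarrow> U (p k) + h + d \<le> H k"
proof -
  assume k: "k \<in> {1..q}"
  have "U (p k) + h + d \<le> pass U (p k) (bd q - {p k})" using deep[OF k] by (simp add: bd_def)
  also have "\<dots> \<le> pass U (p k) (bd (k - 1))"
  proof (rule pass_antimono)
    have "bd (k - 1) \<subseteq> bd q" using k by (intro bd_mono) auto
    then show "bd (k - 1) \<subseteq> bd q - {p k}" using k p_notin_bd[OF k, of "k - 1"] by auto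
  qed auto
  finally show ?thesis by (simp add: H_def)
qed

lemma H_step: "k \<in> {1..<q} \<Longrightarrow> H (Suc k) - U (p (Suc k)) + d \<le> H k - U (p k)"
proof -
  assume k: "k \<in> {1..<q}"
  have "H (Suc k) \<le> pass U (p (Suc k)) (bd (k - 1))"
    unfolding H_def by (intro pass_antimono bd_mono) auto
  also have "pass U (p (Suc k)) (bd (k - 1)) - U (p (Suc k)) + d \<le> H k - U (p k)"
    using order[of k "Suc k"] k by (simp add: bd_def H_def)
  finally show ?thesis by simp
qed

text \<open>The site \<open>y\<close> lies in the valley of \<open>p k\<close> below the pass from \<open>p k\<close> to \<open>bd (k - 1)\<close>, and \<open>p k\<close> is the
  bottom of this valley.\<close>

definition in_well :: "nat \<Rightarrow> int \<Rightarrow> bool" where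
  "in_well k y \<longleftrightarrow> (\<exists>a b. a < y \<and> y < b \<and> a < p k \<and> p k < b \<and> H k \<le> U a \<and> H k \<le> U b \<and>
     (\<forall>z\<in>{a<..<b}. U z < H k \<and> z \<notin> bd (k - 1)) \<and> (\<forall>z\<in>{a..b}. U (p k) \<le> U z))"

text \<open>The leftmost lowest site of a valley of depth at least \<open>h\<close> is an \<open>h\<close>-minimum.\<close>

lemma deep_valley_minimum:
  assumes y: "y \<in> {-n<..<n}" and deep: "U y + h \<le> pass U y S"
    and S: "finite S" "-n \<in> S" "n \<in> S" "S \<subseteq> {-n..n}"
  shows "\<exists>a b. \<exists>j\<in>{1..q}. a < y \<and> y < b \<and> a < p j \<and> p j < b \<and> pass U y S \<le> U a \<and> pass U y S \<le> U b \<and>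
    (\<forall>z\<in>{a<..<b}. U z < pass U y S \<and> z \<notin> S) \<and> (\<forall>z\<in>{a..b}. U (p j) \<le> U z)"
proof -
  have "U y < pass U y S" using deep h by simp
  from valley_exists[OF S(1-3) _ _ this] y obtain a b where
    ab: "-n \<le> a" "a < y" "y < b" "b \<le> n" "pass U y S \<le> U a" "pass U y S \<le> U b"
      "\<And>z. z \<in> {a<..<b} \<Longrightarrow> U z < pass U y S \<and> z \<notin> S" by auto
  have "a \<le> b" using ab by simp
  then obtain y' where y': "y' \<in> {a..b}" "\<And>z. z \<in> {a..b} \<Longrightarrow> U y' \<le> U z" "\<And>z. z \<in> {a..<y'} \<Longrightarrow> U y' < U z"
    using leftmost_minimizer[of a b U] by blast
  have le: "U y' \<le> U y" using ab by (intro y'(2)) auto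
  then have "U y' < U a" "U y' < U b" using ab deep h by simp_all
  then have "a < y'" "y' < b" using y'(1) by (auto simp: less_le)
  moreover have "U y' + h \<le> U a" "U y' + h \<le> U b" using ab deep le by simp_all
  then have "y' \<in> p ` {1..q}"
    using ab calculation y' by (intro wells[of a y' b]) auto
  ultimately show ?thesis using ab y' by blast
qed

text \<open>A deeper valley would contain an \<open>h\<close>-minimum, but valleys avoid \<open>bd q\<close>.\<close>

lemma shallow_off_minima:
  assumes y: "y \<in> {-n<..<n}" "y \<notin> bd q"
  shows "pass U y (bd q) \<le> U y + h"
proof (rule ccontr)
  assume "\<not> ?thesis"
  then have "U y + h \<le> pass U y (bd q)" by simp
  from deep_valley_minimum[OF y(1) this bd_finite bd_ends bd_range[OF order_refl]]
  obtain a b j where "j \<in> {1..q}" "p j \<in> {a<..<b}" "\<forall>z\<in>{a<..<b}. z \<notin> bd q" by auto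
  then show False using p_in_bd by blast
qed

text \<open>If the depth of \<open>y\<close> is less than \<open>h\<close>, compare with \<open>deep\<close>. Otherwise the valley of \<open>y\<close> contains an
  \<open>h\<close>-minimum \<open>p j\<close> that is not in \<open>bd (k - 1)\<close> and is at least as deep as \<open>y\<close>. If \<open>j > k\<close>, compare with
  \<open>order\<close>; if \<open>j = k\<close>, the valley of \<open>y\<close> is that of \<open>p k\<close>.\<close>

lemma well_dichotomy:
  assumes k: "k \<in> {1..q}" and y: "y \<in> {-n<..<n}" "y \<notin> bd (k - 1)"
  shows "pass U y (bd (k - 1)) - U y \<le> H k - U (p k) - d \<or> in_well k y"
proof (cases "U y + h \<le> pass U y (bd (k - 1))")
  case False
  then show ?thesis using H_depth[OF k] by simp
next
  case True
  let ?S = "bd (k - 1)" and ?P = "pass U y (bd (k - 1))"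
  have "bd (k - 1) \<subseteq> {-n..n}" using k by (intro bd_range) auto
  from deep_valley_minimum[OF y(1) True bd_finite bd_ends this]
  obtain a b j where j: "j \<in> {1..q}" and ab: "a < y" "y < b" "a < p j" "p j < b" "?P \<le> U a" "?P \<le> U b"
    "\<And>z. z \<in> {a<..<b} \<Longrightarrow> U z < ?P \<and> z \<notin> ?S" "\<And>z. z \<in> {a..b} \<Longrightarrow> U (p j) \<le> U z"
    by blast
  have "p j \<notin> ?S" using ab(7)[of "p j"] ab by auto
  then have "j \<notin> {1..k - 1}" using p_in_bd by blast
  then have jk: "k \<le> j" using j by auto
  have P: "?P \<le> pass U (p j) ?S"
    using ab by (intro pass_ge_valley[of _ a _ b]) auto
  show ?thesis
  proof (cases "j = k")
    case False
    with jk have "pass U (p j) ?S - U (p j) + d \<le> H k - U (p k)"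
      using order[of k j] k j by (simp add: bd_def H_def)
    moreover have "U (p j) \<le> U y" using ab by auto
    ultimately show ?thesis using P by simp
  next
    case True
    obtain s where s: "s \<in> ?S" "\<And>z. z \<in> {min s y..max s y} \<Longrightarrow> U z \<le> ?P"
      using pass_attained[of "bd (k - 1)" y U, OF bd_finite bd_nonempty] by auto
    have "H k \<le> ?P"
      unfolding H_def
    proof (rule pass_le[OF bd_finite s(1)])
      fix z assume z: "z \<in> {min s (p k)..max s (p k)}"
      have "s \<le> a \<or> b \<le> s" using s(1) ab(7)[of s] by force
      then have "z \<in> {min s y..max s y} \<or> z \<in> {a<..<b}" using z ab True by auto
      then show "U z \<le> ?P" using s(2) ab(7) by (auto simp: less_imp_le)
    qed
    with P True have "H k = ?P" by (simp add: H_def)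
    with ab True have "in_well k y" unfolding in_well_def by (intro exI[of _ a] exI[of _ b]) auto
    then show ?thesis ..
  qed
qed

lemma in_well_ge: "in_well k y \<Longrightarrow> U (p k) \<le> U y"
  unfolding in_well_def by auto

text \<open>The two valleys are components of sublevel sets, so one contains the other; \<open>p k\<close> lies in the first but,
  being an element of \<open>bd (j - 1)\<close>, not in the second. Hence \<open>p j\<close> lies in the valley of \<open>p k\<close>, where both
  minima see the same pass, and \<open>order\<close> compares their heights.\<close>

lemma nested_wells:
  assumes k: "k \<in> {1..q}" and j: "j \<in> {k<..q}" and "in_well k y" "in_well j y"
  shows "U (p k) + d \<le> U (p j)"
proof -
  obtain a b where ab: "a < y" "y < b" "a < p k" "p k < b" "H k \<le> U a" "H k \<le> U b"
     "\<And>z. z \<in> {a<..<b} \<Longrightarrow> U z < H k \<and> z \<notin> bd (k - 1)" "\<And>z. z \<in> {a..b} \<Longrightarrow> U (p k) \<le> U z"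
    using assms(3) unfolding in_well_def by blast
  obtain a' b' where ab': "a' < y" "y < b'" "a' < p j" "p j < b'" "H j \<le> U a'" "H j \<le> U b'"
     "\<And>z. z \<in> {a'<..<b'} \<Longrightarrow> U z < H j \<and> z \<notin> bd (j - 1)"
    using assms(4) unfolding in_well_def by blast
  have "p k \<in> bd (j - 1)" using k j by (intro p_in_bd) auto
  then have out: "p k \<le> a' \<or> b' \<le> p k" using ab'(7)[of "p k"] by force
  have "p j \<in> {a<..<b}"
  proof -
    have "a \<le> a' \<and> b' \<le> b"
    proof (rule ccontr)
      assume *: "\<not> (a \<le> a' \<and> b' \<le> b)"
      show False
      proof (cases "p k \<le> a'")
        case True
        then have "a' \<in> {a<..<b}" using ab ab' by auto
        then have "H j < H k" using ab(7) ab' by force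
        moreover have "b \<in> {a'<..<b'}" using * True ab ab' by auto
        then have "U b < H j" using ab'(7) by auto
        ultimately show False using ab by simp
      next
        case False
        then have pk: "b' \<le> p k" using out by simp
        then have "b' \<in> {a<..<b}" using ab ab' by auto
        then have "H j < H k" using ab(7) ab' by force
        moreover have "a \<in> {a'<..<b'}" using * pk ab ab' by auto
        then have "U a < H j" using ab'(7) by auto
        ultimately show False using ab by simp
      qed
    qed
    then show ?thesis using ab' by auto
  qed
  then have "H k \<le> pass U (p j) (bd (k - 1))"
    using ab by (intro pass_ge_valley[of _ a _ b]) auto
  moreover have "pass U (p j) (bd (k - 1)) - U (p j) + d \<le> H k - U (p k)"
    using order[OF k j] by (simp add: bd_def H_def)
  ultimately show ?thesis by simp
qed

definition energy :: "(int \<Rightarrow> real) \<Rightarrow> (int \<Rightarrow> real) \<Rightarrow> real" where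
  "energy f g = (\<Sum>z\<in>{-n..<n}. exp (- U z) * (f (z + 1) - f z) * (g (z + 1) - g z))"

lemma energy_nonneg: "energy f f \<ge> 0"
  unfolding energy_def by (intro sum_nonneg) (simp add: mult.assoc)

lemma telescope_int:
  fixes f :: "int \<Rightarrow> real"
  assumes "a \<le> b"
  shows "(\<Sum>z\<in>{a..<b}. f (z + 1) - f z) = f b - f a"
  using assms
proof (induction b rule: int_ge_induct)
  case (step i)
  then have "{a..<i + 1} = insert i {a..<i}" by auto
  then show ?case using step by simp
qed simp

text \<open>The sum is the resistance of the path from \<open>a\<close> to \<open>b\<close> when the edge \<open>{z, z + 1}\<close> has conductance
  \<open>exp (- U z)\<close>.\<close>

lemma energy_resistance:
  assumes "-n \<le> a" "a \<le> b" "b \<le> n"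
  shows "(f b - f a)\<^sup>2 \<le> (\<Sum>z\<in>{a..<b}. exp (U z)) * energy f f"
proof -
  define r where "r z = exp (U z / 2)" for z
  have r: "(r z)\<^sup>2 = exp (U z)" "r z > 0" for z by (simp_all add: r_def flip: exp_double)
  have "f b - f a = (\<Sum>z\<in>{a..<b}. r z * ((f (z + 1) - f z) / r z))"
    using telescope_int[OF assms(2), of f] r(2) by (simp add: less_imp_neq[THEN not_sym])
  then have "(f b - f a)\<^sup>2 \<le> (\<Sum>z\<in>{a..<b}. (r z)\<^sup>2) * (\<Sum>z\<in>{a..<b}. ((f (z + 1) - f z) / r z)\<^sup>2)"
    using Cauchy_Schwarz_ineq_sum[of r "\<lambda>z. (f (z + 1) - f z) / r z" "{a..<b}"] by simp
  also have "(\<Sum>z\<in>{a..<b}. ((f (z + 1) - f z) / r z)\<^sup>2) \<le> energy f f"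
  proof -
    have "exp (- U z) = 1 / (r z)\<^sup>2" for z by (simp add: r(1) exp_minus inverse_eq_divide)
    then have eq: "((f (z + 1) - f z) / r z)\<^sup>2 = exp (- U z) * (f (z + 1) - f z) * (f (z + 1) - f z)" for z
      by (simp add: power_divide power2_eq_square)
    show ?thesis unfolding eq energy_def using assms
      by (intro sum_mono2) (auto simp: mult.assoc)
  qed
  finally show ?thesis by (simp add: r(1) mult_left_mono sum_nonneg)
qed

text \<open>The path over the lowest pass has at most \<open>2 n\<close> edges, each of resistance at most the exponential of the
  pass.\<close>

lemma energy_point_bound:
  assumes S: "finite S" "S \<noteq> {}" "S \<subseteq> {-n..n}" and f: "\<And>s. s \<in> S \<Longrightarrow> f s = 0"
    and y: "y \<in> {-n..n}"
  shows "(f y)\<^sup>2 \<le> 2 * n * exp (pass U y S) * energy f f"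
proof -
  obtain s where s: "s \<in> S" "\<And>z. z \<in> {min s y..max s y} \<Longrightarrow> U z \<le> pass U y S"
    using pass_attained[OF S(1,2), of y U] by auto
  have r: "(\<Sum>z\<in>{min s y..<max s y}. exp (U z)) \<le> 2 * n * exp (pass U y S)"
  proof -
    have "(\<Sum>z\<in>{min s y..<max s y}. exp (U z)) \<le> (\<Sum>z\<in>{min s y..<max s y}. exp (pass U y S))"
      using s(2) by (intro sum_mono) auto
    also have "\<dots> = real_of_int (max s y - min s y) * exp (pass U y S)" by simp
    also have "\<dots> \<le> real_of_int (2 * n) * exp (pass U y S)"
      using s(1) S(3) y by (intro mult_right_mono) (auto simp: subset_eq)
    finally show ?thesis by simp
  qed
  have "(f (max s y) - f (min s y))\<^sup>2 \<le> (\<Sum>z\<in>{min s y..<max s y}. exp (U z)) * energy f f"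
    using s(1) S(3) y by (intro energy_resistance) (auto simp: subset_eq)
  moreover have "(f (max s y) - f (min s y))\<^sup>2 = (f y)\<^sup>2"
    using f[OF s(1)] by (simp add: min_def max_def)
  moreover have "(\<Sum>z\<in>{min s y..<max s y}. exp (U z)) * energy f f \<le> 2 * n * exp (pass U y S) * energy f f"
    using r energy_nonneg by (intro mult_right_mono)
  ultimately show ?thesis by linarith
qed

end

text \<open>The walk enters only through the reversible measure \<open>\<mu>\<close> and the equilibrium potentials \<open>e k\<close>, which
  are the functions \<open>h\<^sub>k\<close> on the integers. Harmonicity of \<open>e k\<close> off \<open>bd k\<close> is stated in its weak form
  \<open>e_harmonic\<close>. The constant \<open>K\<close> will be \<open>1 / \<kappa>\<close>.\<close>

locale good_environment = good_landscape U n p q h d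
  for U :: "int \<Rightarrow> real" and n :: int and p :: "nat \<Rightarrow> int" and q :: nat and h d :: real +
  fixes K :: real and \<mu> :: "int \<Rightarrow> real" and e :: "nat \<Rightarrow> int \<Rightarrow> real"
  assumes K: "K \<ge> 1"
    and elliptic: "exp (- U (z - 1)) \<le> K * exp (- U z)"
    and \<mu>_lower: "exp (- U z) \<le> \<mu> z" and \<mu>_upper: "\<mu> z \<le> K * exp (- U z)"
    and e_range: "0 \<le> e k z" "e k z \<le> 1"
    and e_one: "k \<in> {1..q} \<Longrightarrow> e k (p k) = 1"
    and e_zero: "k \<in> {1..q} \<Longrightarrow> z \<in> bd (k - 1) \<Longrightarrow> e k z = 0"
    and e_harmonic: "k \<in> {1..q} \<Longrightarrow> (\<And>z. z \<in> bd k \<Longrightarrow> g z = 0) \<Longrightarrow> energy (e k) g = 0"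
    and large: "4 * n * K * exp (- d) \<le> 1"
begin

definition cap :: "nat \<Rightarrow> real" where "cap k = energy (e k) (e k)"

definition mass :: "nat \<Rightarrow> real" where "mass k = (\<Sum>y\<in>{-n<..<n}. \<mu> y * (e k y)\<^sup>2)"

lemma \<mu>_pos: "\<mu> z > 0"
  using \<mu>_lower[of z] exp_gt_zero[of "- U z"] by linarith

lemma cap_lower: "k \<in> {1..q} \<Longrightarrow> exp (- H k) \<le> 2 * n * cap k"
proof -
  assume k: "k \<in> {1..q}"
  have "(e k (p k))\<^sup>2 \<le> 2 * n * exp (pass U (p k) (bd (k - 1))) * energy (e k) (e k)"
    using p_range[OF k] k by (intro energy_point_bound bd_range e_zero) auto
  then have "1 \<le> 2 * n * exp (H k) * cap k" using e_one[OF k] by (simp add: H_def cap_def)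
  then have "exp (- H k) * 1 \<le> exp (- H k) * (2 * n * exp (H k) * cap k)"
    by (intro mult_left_mono) auto
  also have "\<dots> = 2 * n * cap k * (exp (- H k) * exp (H k))" by (simp add: mult_ac)
  finally show ?thesis by (simp flip: exp_add)
qed

lemma dirichlet_principle:
  assumes k: "k \<in> {1..q}" and f: "f (p k) = 1" "\<And>z. z \<in> bd (k - 1) \<Longrightarrow> f z = 0"
  shows "cap k \<le> energy f f"
proof -
  define g where "g z = f z - e k z" for z
  have "energy (e k) g = 0"
    using f e_one[OF k] e_zero[OF k] by (intro e_harmonic[OF k]) (auto simp: g_def bd_Suc[OF k])
  moreover have "energy f f = energy (e k) (e k) + 2 * energy (e k) g + energy g g"
    unfolding energy_def g_def sum_distrib_left sum.distrib[symmetric]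
    by (intro sum.cong) (auto simp: algebra_simps)
  ultimately show ?thesis using energy_nonneg[of g] by (simp add: cap_def)
qed

text \<open>The test function is the indicator of the valley of \<open>p k\<close>. Its energy comes from the two edges at the ends of
  the valley; the right one carries the height of the site before \<open>b\<close>, which ellipticity compares with
  that of \<open>b\<close>.\<close>

lemma cap_upper: "k \<in> {1..q} \<Longrightarrow> cap k \<le> 2 * K * exp (- H k)"
proof -
  assume k: "k \<in> {1..q}"
  have "U (p k) < pass U (p k) (bd (k - 1))" using H_depth[OF k] h d by (simp add: H_def)
  from valley_exists[OF bd_finite bd_ends _ _ this] p_range[OF k] obtain a b where
    ab: "-n \<le> a" "a < p k" "p k < b" "b \<le> n" "H k \<le> U a" "H k \<le> U b" "\<And>z. z \<in> {a<..<b} \<Longrightarrow> z \<notin> bd (k - 1)"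
    by (auto simp: H_def)
  define f :: "int \<Rightarrow> real" where "f z = (if z \<in> {a<..<b} then 1 else 0)" for z
  have "cap k \<le> energy f f" using ab by (intro dirichlet_principle[OF k]) (auto simp: f_def)
  also have "energy f f = (\<Sum>z\<in>{a, b - 1}. exp (- U z))"
    unfolding energy_def using ab
    by (intro sum.mono_neutral_cong_right) (auto simp: f_def)
  also have "\<dots> = exp (- U a) + exp (- U (b - 1))" using ab by simp
  also have "\<dots> \<le> exp (- H k) + K * exp (- H k)"
  proof (intro add_mono)
    have "exp (- U (b - 1)) \<le> K * exp (- U b)" by (rule elliptic)
    also have "\<dots> \<le> K * exp (- H k)" using ab K by (intro mult_left_mono) auto
    finally show "exp (- U (b - 1)) \<le> K * exp (- H k)" .
  qed (use ab in simp)
  also have "\<dots> \<le> 2 * K * exp (- H k)"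
  proof -
    have "1 * exp (- H k) \<le> K * exp (- H k)" using K by (intro mult_right_mono) auto
    then show ?thesis by simp
  qed
  finally show ?thesis .
qed

lemma cap_pos: "k \<in> {1..q} \<Longrightarrow> cap k > 0"
proof -
  assume "k \<in> {1..q}"
  then have "0 < (2 * n) * cap k" using cap_lower[of k] exp_gt_zero[of "- H k"] by linarith
  then show ?thesis using n by (simp add: zero_less_mult_iff)
qed

text \<open>The factor by which the bound on the weight of \<open>e k\<close> drops outside the valley of \<open>p k\<close>, see
  \<open>weight_bound\<close>.\<close>

definition \<sigma> :: real where "\<sigma> = 4 * n * K * exp (- d)"

lemma \<sigma>: "0 < \<sigma>" "\<sigma> \<le> 1" "exp (- d) \<le> \<sigma>"
proof -
  show "0 < \<sigma>" "\<sigma> \<le> 1" using n K large by (auto simp: \<sigma>_def)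
  have "1 * 1 \<le> (4 * n) * K" using n K by (intro mult_mono) auto
  then have "1 * exp (- d) \<le> (4 * n * K) * exp (- d)" by (intro mult_right_mono) auto
  then show "exp (- d) \<le> \<sigma>" by (simp add: \<sigma>_def)
qed

text \<open>In the valley, \<open>p k\<close> is a lowest site and \<open>e k\<close> is at most one. Elsewhere the path inequality and
  \<open>cap_upper\<close> bound \<open>(e k y)\<^sup>2\<close> by the exponential of the difference of the passes from \<open>y\<close> and from \<open>p k\<close>, so
  that the product with \<open>\<mu> y\<close> is governed by the difference of the depths.\<close>

lemma weight_bound:
  assumes k: "k \<in> {1..q}" and y: "y \<in> {-n<..<n}"
  shows "\<mu> y * (e k y)\<^sup>2 \<le> K * exp (- U (p k)) * (if in_well k y then 1 else \<sigma>)"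
proof (cases "y \<in> bd (k - 1)")
  case True
  then show ?thesis using e_zero[OF k] K \<sigma> by simp
next
  case out: False
  show ?thesis
  proof (cases "in_well k y")
    case True
    have "\<mu> y * (e k y)\<^sup>2 \<le> (K * exp (- U y)) * 1"
      using \<mu>_upper[of y] e_range[of k y] K by (intro mult_mono) (auto simp: power_le_one)
    also have "\<dots> \<le> K * exp (- U (p k))" using in_well_ge[OF True] K by simp
    finally show ?thesis using True by simp
  next
    case False
    let ?P = "pass U y (bd (k - 1))"
    have P: "?P - U y - H k \<le> - U (p k) - d" using well_dichotomy[OF k y out] False by simp
    have "(e k y)\<^sup>2 \<le> 2 * n * exp ?P * cap k"
      unfolding cap_def using y k by (intro energy_point_bound bd_range e_zero) auto
    also have "\<dots> \<le> 2 * n * exp ?P * (2 * K * exp (- H k))"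
      using cap_upper[OF k] n by (intro mult_left_mono) auto
    finally have "\<mu> y * (e k y)\<^sup>2 \<le> (K * exp (- U y)) * (2 * n * exp ?P * (2 * K * exp (- H k)))"
      using \<mu>_upper[of y] \<mu>_pos[of y] K by (intro mult_mono) auto
    also have "\<dots> = K * (4 * n * K) * exp (?P - U y - H k)"
      by (simp add: exp_diff exp_minus divide_inverse mult_ac)
    also have "\<dots> \<le> K * (4 * n * K) * exp (- U (p k) - d)"
      using P K n by (intro mult_left_mono) auto
    also have "\<dots> = K * exp (- U (p k)) * \<sigma>"
      by (simp add: \<sigma>_def exp_diff exp_minus divide_inverse mult_ac)
    finally show ?thesis using False by simp
  qed
qed

lemma card_interior: "real (card {-n<..<n}) \<le> 2 * n"
  using n by simp

lemma mass_lower: "k \<in> {1..q} \<Longrightarrow> exp (- U (p k)) \<le> mass k"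
proof -
  assume k: "k \<in> {1..q}"
  have "exp (- U (p k)) \<le> \<mu> (p k) * (e k (p k))\<^sup>2" using \<mu>_lower e_one[OF k] by simp
  also have "\<dots> \<le> mass k" unfolding mass_def using p_range[OF k] \<mu>_pos
    by (intro member_le_sum) (auto simp: less_imp_le)
  finally show ?thesis .
qed

lemma mass_pos: "k \<in> {1..q} \<Longrightarrow> mass k > 0"
  using mass_lower[of k] exp_gt_zero[of "- U (p k)"] by linarith

lemma mass_upper: "k \<in> {1..q} \<Longrightarrow> mass k \<le> 2 * n * K * exp (- U (p k))"
proof -
  assume k: "k \<in> {1..q}"
  have "mass k \<le> (\<Sum>y\<in>{-n<..<n}. K * exp (- U (p k)))"
    unfolding mass_def
  proof (rule sum_mono)
    fix y assume y: "y \<in> {-n<..<n}"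
    have "\<mu> y * (e k y)\<^sup>2 \<le> K * exp (- U (p k)) * (if in_well k y then 1 else \<sigma>)"
      by (rule weight_bound[OF k y])
    also have "\<dots> \<le> K * exp (- U (p k)) * 1" using \<sigma> K by (intro mult_left_mono) auto
    finally show "\<mu> y * (e k y)\<^sup>2 \<le> K * exp (- U (p k))" by simp
  qed
  also have "\<dots> = card {-n<..<n} * (K * exp (- U (p k)))" by simp
  also have "\<dots> \<le> (2 * n) * (K * exp (- U (p k)))"
    using card_interior K by (intro mult_right_mono) auto
  finally show ?thesis by (simp add: mult_ac)
qed

text \<open>At a site outside one of the two valleys, the geometric mean of the two weights contains a factor
  \<open>sqrt \<sigma>\<close>. At a site in both valleys, \<open>p j\<close> is higher than \<open>p k\<close> by \<open>d\<close>, and the site is at least as high as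
  \<open>p j\<close>.\<close>

lemma overlap_bound:
  assumes k: "k \<in> {1..q}" and j: "j \<in> {k<..q}"
  shows "(\<Sum>y\<in>{-n<..<n}. \<mu> y * e k y * e j y)
     \<le> 2 * n * K * sqrt \<sigma> * (exp (- U (p k) / 2) * exp (- U (p j) / 2))"
proof -
  let ?B = "K * sqrt \<sigma> * (exp (- U (p k) / 2) * exp (- U (p j) / 2))"
  have j': "j \<in> {1..q}" using j by auto
  have "(\<Sum>y\<in>{-n<..<n}. \<mu> y * e k y * e j y) \<le> (\<Sum>y\<in>{-n<..<n}. ?B)"
  proof (rule sum_mono)
    fix y assume y: "y \<in> {-n<..<n}"
    show "\<mu> y * e k y * e j y \<le> ?B"
    proof (cases "in_well k y \<and> in_well j y")
      case True
      then have "U (p k) + d \<le> U (p j)" using nested_wells[OF k j] by blast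
      have "\<mu> y * e k y * e j y \<le> (K * exp (- U y)) * 1 * 1"
        using \<mu>_upper[of y] \<mu>_pos[of y] e_range[of k y] e_range[of j y] K by (intro mult_mono) auto
      also have "\<dots> \<le> K * exp (- d / 2 + (- U (p k) / 2 + - U (p j) / 2))"
        using in_well_ge[of j y] True \<open>U (p k) + d \<le> U (p j)\<close> K by simp
      also have "\<dots> = K * exp (- d / 2) * (exp (- U (p k) / 2) * exp (- U (p j) / 2))"
        unfolding exp_add by simp
      also have "\<dots> \<le> ?B"
      proof -
        have "sqrt (exp (- d)) = exp (- d / 2)"
          by (rule real_sqrt_unique) (simp_all flip: exp_double)
        then have "exp (- d / 2) \<le> sqrt \<sigma>" using real_sqrt_le_mono[OF \<sigma>(3)] by simp
        then show ?thesis using K by (intro mult_right_mono mult_left_mono) auto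
      qed
      finally show ?thesis .
    next
      case False
      let ?s = "\<lambda>k. if in_well k y then 1 else \<sigma>"
      have "(\<mu> y * e k y * e j y)\<^sup>2 = (\<mu> y * (e k y)\<^sup>2) * (\<mu> y * (e j y)\<^sup>2)"
        by (simp add: power2_eq_square mult_ac)
      also have "\<dots> \<le> (K * exp (- U (p k)) * ?s k) * (K * exp (- U (p j)) * ?s j)"
        using \<mu>_pos[of y] K \<sigma>(1)
        by (intro mult_mono[OF weight_bound[OF k y] weight_bound[OF j' y]]) (auto simp: less_imp_le)
      also have "\<dots> = (K\<^sup>2 * (exp (- U (p k)) * exp (- U (p j)))) * (?s k * ?s j)"
        by (simp add: power2_eq_square mult_ac)
      also have "\<dots> \<le> (K\<^sup>2 * (exp (- U (p k)) * exp (- U (p j)))) * \<sigma>"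
        using False \<sigma> by (intro mult_left_mono) (auto simp: mult_le_one)
      also have "\<dots> = ?B\<^sup>2"
        using \<sigma> by (simp add: power_mult_distrib flip: exp_double)
      finally show ?thesis by (rule power2_le_imp_le) (use K \<sigma> in auto)
    qed
  qed
  also have "\<dots> = card {-n<..<n} * ?B" by simp
  also have "\<dots> \<le> (2 * n) * ?B" using card_interior K \<sigma> by (intro mult_right_mono) auto
  finally show ?thesis by (simp add: mult_ac)
qed

text \<open>The path inequality at each site, where the pass exceeds the height of the site by at most \<open>h\<close>.\<close>

lemma poincare:
  assumes "\<And>z. z \<in> bd q \<Longrightarrow> f z = 0"
  shows "(\<Sum>y\<in>{-n<..<n}. \<mu> y * (f y)\<^sup>2) \<le> 4 * n\<^sup>2 * K * exp h * energy f f"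
proof -
  let ?B = "2 * n * K * exp h * energy f f"
  have "(\<Sum>y\<in>{-n<..<n}. \<mu> y * (f y)\<^sup>2) \<le> (\<Sum>y\<in>{-n<..<n}. ?B)"
  proof (rule sum_mono)
    fix y assume y: "y \<in> {-n<..<n}"
    show "\<mu> y * (f y)\<^sup>2 \<le> ?B"
    proof (cases "y \<in> bd q")
      case True
      then show ?thesis using assms n K energy_nonneg[of f] by simp
    next
      case False
      have "(f y)\<^sup>2 \<le> 2 * n * exp (pass U y (bd q)) * energy f f"
        using y assms by (intro energy_point_bound bd_range) auto
      also have "\<dots> \<le> 2 * n * exp (U y + h) * energy f f"
        using shallow_off_minima[OF y False] n energy_nonneg by (intro mult_right_mono mult_left_mono) auto
      finally have "\<mu> y * (f y)\<^sup>2 \<le> (K * exp (- U y)) * (2 * n * exp (U y + h) * energy f f)"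
        using \<mu>_upper[of y] \<mu>_pos[of y] K by (intro mult_mono) auto
      also have "\<dots> = (exp (- U y) * exp (U y)) * ?B" unfolding exp_add by (simp only: mult_ac)
      also have "\<dots> = ?B" by (simp flip: exp_add)
      finally show ?thesis .
    qed
  qed
  also have "\<dots> = card {-n<..<n} * ?B" by simp
  also have "\<dots> \<le> (2 * n) * ?B" using card_interior K n energy_nonneg[of f]
    by (intro mult_right_mono) auto
  finally show ?thesis by (simp add: power2_eq_square mult_ac)
qed

lemma energy_orthogonal:
  assumes k: "k \<in> {1..q}" and j: "j \<in> {1..q}" and "k < j"
  shows "energy (e k) (e j) = 0"
proof (rule e_harmonic[OF k])
  fix z assume "z \<in> bd k"
  moreover have "bd k \<subseteq> bd (j - 1)" using \<open>k < j\<close> by (intro bd_mono) auto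
  ultimately have "z \<in> bd (j - 1)" by blast
  then show "e j z = 0" by (rule e_zero[OF j])
qed

end

section \<open>Hitting probabilities of the walk\<close>

lemma hit_time_less_iff:
  "hit_time A X < hit_time B X \<longleftrightarrow> (\<exists>n\<ge>1. X n \<in> A \<and> (\<forall>m\<in>{1..n}. X m \<notin> B))"
proof
  assume less: "hit_time A X < hit_time B X"
  then obtain n where n: "n \<ge> 1" "X n \<in> A" "enat n < hit_time B X"
    unfolding hit_time_def[of A] by (auto simp: Inf_less_iff)
  have "X m \<notin> B" if "m \<in> {1..n}" for m
  proof
    assume "X m \<in> B"
    then have "hit_time B X \<le> enat m" unfolding hit_time_def using that by (intro Inf_lower) auto
    also have "\<dots> \<le> enat n" using that by simp
    finally show False using n(3) by simp
  qed
  with n show "\<exists>n\<ge>1. X n \<in> A \<and> (\<forall>m\<in>{1..n}. X m \<notin> B)" by auto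
next
  assume "\<exists>n\<ge>1. X n \<in> A \<and> (\<forall>m\<in>{1..n}. X m \<notin> B)"
  then obtain n where n: "n \<ge> 1" "X n \<in> A" "\<And>m. m \<in> {1..n} \<Longrightarrow> X m \<notin> B" by auto
  have "hit_time A X \<le> enat n" unfolding hit_time_def using n by (intro Inf_lower) auto
  also have "enat n < enat (Suc n)" by simp
  also have "enat (Suc n) \<le> hit_time B X"
    unfolding hit_time_def
  proof (rule Inf_greatest)
    fix y assume "y \<in> enat ` {m. m \<ge> 1 \<and> X m \<in> B}"
    then obtain m where m: "y = enat m" "m \<ge> 1" "X m \<in> B" by auto
    with n(3)[of m] have "n < m" by (cases "m \<le> n") auto
    with m show "enat (Suc n) \<le> y" by simp
  qed
  finally show "hit_time A X < hit_time B X" .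
qed

text \<open>The walk visits \<open>A\<close> before \<open>B\<close>, where time zero counts. In \<open>returns\<close> below, as in \<open>hit_time\<close>, it does
  not.\<close>

definition reaches :: "(int \<Rightarrow> real) \<Rightarrow> int set \<Rightarrow> int set \<Rightarrow> int \<Rightarrow> real stream \<Rightarrow> bool" where
  "reaches w A B k us \<longleftrightarrow> (\<exists>n. rw_path w k us n \<in> A \<and> (\<forall>m\<le>n. rw_path w k us m \<notin> B))"

definition reach_prob :: "(int \<Rightarrow> real) \<Rightarrow> int set \<Rightarrow> int set \<Rightarrow> int \<Rightarrow> real" where
  "reach_prob w A B k = measure (stream_space uniform01) {us. reaches w A B k us}"

lemma space_unif_stream: "space (stream_space uniform01) = UNIV"
  by (simp add: space_stream_space)

text \<open>The first jump is independent of the later ones, and the law of the driving sequence is invariant under the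
  shift.\<close>

lemma first_step:
  assumes w: "w k \<in> {0..1}"
    and P: "{us. P us} \<in> sets (stream_space uniform01)"
    and step: "\<And>u us. P (u ## us) \<longleftrightarrow> reaches w A B (rw_step w u k) us"
  shows "measure (stream_space uniform01) {us. P us}
    = w k * reach_prob w A B (k + 1) + (1 - w k) * reach_prob w A B (k - 1)"
proof -
  let ?r = "reach_prob w A B"
  let ?I = "\<lambda>l. {u. rw_step w u k = l}"
  have r0: "0 \<le> ?r l" for l by (simp add: reach_prob_def)
  have m: "?I l \<in> sets uniform01" for l
    using measurable_sets[OF rw_step_measurable, of "{l}" w k] by (simp add: vimage_def)
  have "measure (stream_space uniform01) {us. P (u ## us)} = ?r (rw_step w u k)" for u
    unfolding step reach_prob_def ..
  then have "ennreal (measure (stream_space uniform01) {us. P us})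
      = (\<integral>\<^sup>+u. ennreal (?r (rw_step w u k)) \<partial>uniform01)"
    using uniform01.prob_stream_space[of P] P by (simp add: space_unif_stream)
  also have "\<dots> = (\<integral>\<^sup>+u. ennreal (?r (k + 1)) * indicator (?I (k + 1)) u
      + ennreal (?r (k - 1)) * indicator (?I (k - 1)) u \<partial>uniform01)"
    by (intro nn_integral_cong) (auto simp: rw_step_def indicator_def)
  also have "\<dots> = ennreal (?r (k + 1)) * emeasure uniform01 (?I (k + 1))
      + ennreal (?r (k - 1)) * emeasure uniform01 (?I (k - 1))"
    using m by (simp add: nn_integral_add nn_integral_cmult_indicator)
  also have "\<dots> = ennreal (?r (k + 1)) * ennreal (w k) + ennreal (?r (k - 1)) * ennreal (1 - w k)"
    using w by (simp add: uniform01.emeasure_eq_measure prob_rw_step jump_prob_def)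
  also have "\<dots> = ennreal (?r (k + 1) * w k + ?r (k - 1) * (1 - w k))"
    using w r0 by (simp add: ennreal_mult)
  finally show ?thesis using w r0 by (subst (asm) ennreal_inj) (auto simp: mult.commute)
qed

lemma reaches_sets: "{us. reaches w A B k us} \<in> sets (stream_space uniform01)"
proof -
  have "{us \<in> space (stream_space uniform01). reaches w A B k us} \<in> sets (stream_space uniform01)"
    unfolding reaches_def by measurable
  then show ?thesis by (simp add: space_unif_stream)
qed

lemma reach_prob_range: "0 \<le> reach_prob w A B k" "reach_prob w A B k \<le> 1"
  by (simp_all add: reach_prob_def)

lemma reach_prob_avoid: "k \<in> B \<Longrightarrow> reach_prob w A B k = 0"
proof -
  assume "k \<in> B"
  then have "\<not> reaches w A B k us" for us unfolding reaches_def by (metis le0 rw_path.simps(1))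
  then show ?thesis by (simp add: reach_prob_def)
qed

lemma reach_prob_target: "k \<in> A \<Longrightarrow> k \<notin> B \<Longrightarrow> reach_prob w A B k = 1"
proof -
  assume "k \<in> A" "k \<notin> B"
  then have "reaches w A B k us" for us unfolding reaches_def by (intro exI[of _ 0]) auto
  then show ?thesis using unif_stream.prob_space by (simp add: reach_prob_def space_unif_stream)
qed

definition returns :: "(int \<Rightarrow> real) \<Rightarrow> int set \<Rightarrow> int set \<Rightarrow> int \<Rightarrow> real stream \<Rightarrow> bool" where
  "returns w A B k us \<longleftrightarrow> (\<exists>n\<ge>1. rw_path w k us n \<in> A \<and> (\<forall>m\<in>{1..n}. rw_path w k us m \<notin> B))"

lemma returns_Stream: "returns w A B k (u ## us) \<longleftrightarrow> reaches w A B (rw_step w u k) us"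
proof -
  have "returns w A B k (u ## us) \<longleftrightarrow> (\<exists>n. rw_path w k (u ## us) (Suc n) \<in> A \<and>
      (\<forall>m\<le>n. rw_path w k (u ## us) (Suc m) \<notin> B))"
  proof
    assume "returns w A B k (u ## us)"
    then obtain n where n: "n \<ge> 1" "rw_path w k (u ## us) n \<in> A"
      "\<And>m. m \<in> {1..n} \<Longrightarrow> rw_path w k (u ## us) m \<notin> B" unfolding returns_def by blast
    obtain n' where n': "n = Suc n'" using n(1) by (cases n) auto
    have "rw_path w k (u ## us) (Suc m) \<notin> B" if "m \<le> n'" for m
      using that n' by (intro n(3)) auto
    with n(2) n' show "\<exists>n. rw_path w k (u ## us) (Suc n) \<in> A \<and>
      (\<forall>m\<le>n. rw_path w k (u ## us) (Suc m) \<notin> B)" by blast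
  next
    assume "\<exists>n. rw_path w k (u ## us) (Suc n) \<in> A \<and> (\<forall>m\<le>n. rw_path w k (u ## us) (Suc m) \<notin> B)"
    then obtain n where n: "rw_path w k (u ## us) (Suc n) \<in> A"
      "\<And>m. m \<le> n \<Longrightarrow> rw_path w k (u ## us) (Suc m) \<notin> B" by blast
    have "rw_path w k (u ## us) m \<notin> B" if "m \<in> {1..Suc n}" for m
      using that n(2)[of "m - 1"] by (cases m) auto
    with n(1) show "returns w A B k (u ## us)" unfolding returns_def by (intro exI[of _ "Suc n"]) auto
  qed
  then show ?thesis unfolding rw_path_Stream reaches_def .
qed

lemma prob_returns:
  assumes "w k \<in> {0..1}"
  shows "measure (stream_space uniform01) {us. returns w A B k us}
    = w k * reach_prob w A B (k + 1) + (1 - w k) * reach_prob w A B (k - 1)"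
proof (rule first_step[of w k "returns w A B k", OF assms _ returns_Stream])
  have "{us \<in> space (stream_space uniform01). returns w A B k us} \<in> sets (stream_space uniform01)"
    unfolding returns_def by measurable
  then show "{us. returns w A B k us} \<in> sets (stream_space uniform01)" by (simp add: space_unif_stream)
qed

lemma reach_prob_step:
  assumes "w k \<in> {0..1}" "k \<notin> A" "k \<notin> B"
  shows "reach_prob w A B k = w k * reach_prob w A B (k + 1) + (1 - w k) * reach_prob w A B (k - 1)"
proof -
  have "reaches w A B k us \<longleftrightarrow> returns w A B k us" for us
  proof
    assume "reaches w A B k us"
    then obtain n where n: "rw_path w k us n \<in> A" "\<And>m. m \<le> n \<Longrightarrow> rw_path w k us m \<notin> B"
      by (auto simp: reaches_def)
    with assms(2) have "n \<ge> 1" by (cases n) auto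
    with n show "returns w A B k us" unfolding returns_def by (intro exI[of _ n]) auto
  next
    assume "returns w A B k us"
    then obtain n where n: "rw_path w k us n \<in> A" "\<And>m. m \<in> {1..n} \<Longrightarrow> rw_path w k us m \<notin> B"
      unfolding returns_def by blast
    have "rw_path w k us m \<notin> B" if "m \<le> n" for m using that n(2)[of m] assms(3) by (cases m) auto
    with n(1) show "reaches w A B k us" unfolding reaches_def by blast
  qed
  then show ?thesis using prob_returns[of w k A B, OF assms(1)] by (simp add: reach_prob_def)
qed

text \<open>The sets \<open>A'\<close> and \<open>B'\<close> consist of the integer sites of \<open>A\<close> and \<open>B\<close>.\<close>

lemma hits_before_eq_reach_prob:
  assumes w: "w (site N x) \<in> {0..1}" and fin: "finite A" "finite B"
    and A': "\<And>z. z \<in> A' \<longleftrightarrow> of_int z / real N \<in> A" and B': "\<And>z. z \<in> B' \<longleftrightarrow> of_int z / real N \<in> B"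
  shows "hits_before w N x A B = w (site N x) * reach_prob w A' B' (site N x + 1)
    + (1 - w (site N x)) * reach_prob w A' B' (site N x - 1)"
proof -
  let ?k = "site N x"
  have "{X \<in> space (walk w N x). hit_time A X < hit_time B X} \<in> sets (Pi\<^sub>M UNIV (\<lambda>_. borel))"
    using hits_before_event[OF fin, of w N x] by (simp add: walk_def)
  then have "hits_before w N x A B = measure (stream_space uniform01) {us. returns w A' B' ?k us}"
    unfolding hits_before_def walk_def hit_time_less_iff returns_def
    by (subst measure_distr) (auto simp: vimage_def space_unif_stream A' B' space_PiM PiE_UNIV_domain)
  also note prob_returns[of w ?k A' B', OF w]
  finally show ?thesis .
qed

section \<open>Saddles and \<open>h\<close>-minima of the interpolated potential\<close>

abbreviation pt :: "nat \<Rightarrow> int \<Rightarrow> real" where "pt N k \<equiv> of_int k / real N"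

lemma pt_le_iff: "N > 0 \<Longrightarrow> pt N i \<le> pt N j \<longleftrightarrow> i \<le> j"
  and pt_less_iff: "N > 0 \<Longrightarrow> pt N i < pt N j \<longleftrightarrow> i < j"
  by (simp_all add: divide_le_cancel divide_less_cancel)

lemma pt_inj: "N > 0 \<Longrightarrow> inj (pt N)"
  by (auto simp: inj_def)

lemma scaled_potential_segment:
  assumes "N > 0" "pt N k \<le> t" "t \<le> pt N (k + 1)"
  shows "scaled_potential w N t
    = (potential w k + (real N * t - k) * (potential w (k + 1) - potential w k)) / sqrt (real N)"
proof (cases "t = pt N (k + 1)")
  case True
  then show ?thesis using assms(1) by (simp add: scaled_potential_def Let_def)
next
  case False
  then have "t < pt N (k + 1)" using assms(3) by simp
  then have "of_int k \<le> real N * t" "real N * t < of_int k + 1"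
    using assms(1,2) by (simp_all add: field_simps)
  then have "\<lfloor>real N * t\<rfloor> = k" by (simp add: floor_eq_iff)
  then show ?thesis by (simp add: scaled_potential_def Let_def left_diff_distrib right_diff_distrib)
qed

lemma scaled_potential_pt: "N > 0 \<Longrightarrow> scaled_potential w N (pt N k) = potential w k / sqrt (real N)"
  by (simp add: scaled_potential_def Let_def)

lemma segment_cases:
  assumes "N > 0" "pt N i \<le> t" "t \<le> pt N j"
  obtains "t = pt N j" | k where "i \<le> k" "k < j" "pt N k \<le> t" "t < pt N (k + 1)"
proof (cases "t = pt N j")
  case False
  define k where "k = \<lfloor>real N * t\<rfloor>"
  have k: "of_int k \<le> real N * t" "real N * t < of_int k + 1" by (simp_all add: k_def)
  have "t < pt N j" using assms(3) False by simp
  then have "of_int i \<le> real N * t" "real N * t < of_int j" using assms(1,2) by (simp_all add: field_simps)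
  then have "i \<le> k" "k < j" by (simp_all add: k_def le_floor_iff floor_less_iff)
  moreover have "pt N k \<le> t" "t < pt N (k + 1)" using k assms(1) by (simp_all add: field_simps)
  ultimately show ?thesis using that(2) by blast
qed (use that in blast)

lemma scaled_potential_between:
  assumes "N > 0" "pt N k \<le> t" "t \<le> pt N (k + 1)"
  shows "min (potential w k) (potential w (k + 1)) / sqrt (real N) \<le> scaled_potential w N t"
    and "scaled_potential w N t \<le> max (potential w k) (potential w (k + 1)) / sqrt (real N)"
proof -
  define s where "s = real N * t - k"
  have s: "0 \<le> s" "s \<le> 1" using assms by (auto simp: s_def field_simps)
  let ?a = "potential w k" and ?b = "potential w (k + 1)"
  have eq: "?a + s * (?b - ?a) = (1 - s) * ?a + s * ?b" by (simp add: algebra_simps)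
  have "(1 - s) * min ?a ?b + s * min ?a ?b \<le> (1 - s) * ?a + s * ?b"
    using s by (intro add_mono mult_left_mono) auto
  moreover have "(1 - s) * ?a + s * ?b \<le> (1 - s) * max ?a ?b + s * max ?a ?b"
    using s by (intro add_mono mult_left_mono) auto
  ultimately have "min ?a ?b \<le> ?a + s * (?b - ?a)" "?a + s * (?b - ?a) \<le> max ?a ?b"
    unfolding eq by (simp_all add: algebra_simps)
  then show "min ?a ?b / sqrt (real N) \<le> scaled_potential w N t"
    "scaled_potential w N t \<le> max ?a ?b / sqrt (real N)"
    unfolding scaled_potential_segment[OF assms] s_def by (intro divide_right_mono; simp)+
qed

lemma scaled_potential_le_site:
  assumes "N > 0" "pt N i \<le> t" "t \<le> pt N j"
  shows "\<exists>z\<in>{i..j}. scaled_potential w N t \<le> potential w z / sqrt (real N)"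
  using assms
proof (cases rule: segment_cases)
  case 1
  then have "i \<le> j" using assms by (simp add: pt_le_iff)
  with 1 assms(1) show ?thesis by (intro bexI[of _ j]) (simp_all add: scaled_potential_pt)
next
  case (2 k)
  have "scaled_potential w N t \<le> max (potential w k) (potential w (k + 1)) / sqrt (real N)"
    using 2 assms by (intro scaled_potential_between) auto
  then have "scaled_potential w N t \<le> potential w (k + 1) / sqrt (real N) \<or>
      scaled_potential w N t \<le> potential w k / sqrt (real N)"
    by (auto simp: max_def split: if_splits)
  moreover have "k \<in> {i..j}" "k + 1 \<in> {i..j}" using 2 by auto
  ultimately show ?thesis by blast
qed

lemma scaled_potential_ge_site:
  assumes "N > 0" "pt N i \<le> t" "t \<le> pt N j"
  shows "\<exists>z\<in>{i..j}. potential w z / sqrt (real N) \<le> scaled_potential w N t"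
  using assms
proof (cases rule: segment_cases)
  case 1
  then have "i \<le> j" using assms by (simp add: pt_le_iff)
  with 1 assms(1) show ?thesis by (intro bexI[of _ j]) (simp_all add: scaled_potential_pt)
next
  case (2 k)
  have "min (potential w k) (potential w (k + 1)) / sqrt (real N) \<le> scaled_potential w N t"
    using 2 assms by (intro scaled_potential_between) auto
  then have "potential w (k + 1) / sqrt (real N) \<le> scaled_potential w N t \<or>
      potential w k / sqrt (real N) \<le> scaled_potential w N t"
    by (auto simp: min_def split: if_splits)
  moreover have "k \<in> {i..j}" "k + 1 \<in> {i..j}" using 2 by auto
  ultimately show ?thesis by blast
qed

text \<open>A linear interpolation attains its maximum over an interval with lattice end points at a lattice point.\<close>

lemma SUP_scaled_potential:
  assumes "N > 0" "i \<le> j"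
  shows "(SUP t\<in>{pt N i..pt N j}. scaled_potential w N t) = Max (potential w ` {i..j}) / sqrt (real N)"
proof (rule cSup_eq_maximum)
  have "Max (potential w ` {i..j}) \<in> potential w ` {i..j}" using assms by (intro Max_in) auto
  then obtain m where m: "m \<in> {i..j}" "Max (potential w ` {i..j}) = potential w m" by blast
  then have "pt N m \<in> {pt N i..pt N j}" using assms(1) by (simp add: pt_le_iff)
  moreover have "scaled_potential w N (pt N m) = Max (potential w ` {i..j}) / sqrt (real N)"
    using assms(1) m(2) by (simp add: scaled_potential_pt)
  ultimately show "Max (potential w ` {i..j}) / sqrt (real N) \<in> scaled_potential w N ` {pt N i..pt N j}"
    by (intro image_eqI[of _ _ "pt N m"]) auto
  fix x assume "x \<in> scaled_potential w N ` {pt N i..pt N j}"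
  then obtain t where t: "x = scaled_potential w N t" "pt N i \<le> t" "t \<le> pt N j" by auto
  from scaled_potential_le_site[OF assms(1) t(2,3)] obtain z where
    z: "z \<in> {i..j}" "x \<le> potential w z / sqrt (real N)" unfolding t(1) by blast
  have "potential w z \<le> Max (potential w ` {i..j})" using z(1) by (intro Max_ge) auto
  then have "potential w z / sqrt (real N) \<le> Max (potential w ` {i..j}) / sqrt (real N)"
    by (intro divide_right_mono) auto
  with z(2) show "x \<le> Max (potential w ` {i..j}) / sqrt (real N)" by (rule order_trans)
qed

lemma saddle_height_scaled_potential:
  assumes N: "N > 0" and B: "finite B" "B \<noteq> {}"
  shows "saddle_height (scaled_potential w N) {pt N y} (pt N ` B) = pass (potential w) y B / sqrt (real N)"
proof -
  let ?M = "\<lambda>s. Max (potential w ` {min s y..max s y})"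
  have "(SUP t\<in>{min (pt N y) (pt N s)..max (pt N y) (pt N s)}. scaled_potential w N t)
      = ?M s / sqrt (real N)" for s
  proof -
    have "min (pt N y) (pt N s) = pt N (min s y)" "max (pt N y) (pt N s) = pt N (max s y)"
      using N by (auto simp: min_def max_def pt_le_iff)
    then show ?thesis using SUP_scaled_potential[OF N, of "min s y" "max s y" w] by simp
  qed
  moreover have "{pt N y} \<times> pt N ` B = (\<lambda>s. (pt N y, pt N s)) ` B" by blast
  ultimately have "(\<lambda>(a, b). SUP x\<in>{min a b..max a b}. scaled_potential w N x) ` ({pt N y} \<times> pt N ` B)
      = (\<lambda>v. v / sqrt (real N)) ` ?M ` B"
    by (simp only: image_image prod.case)
  then have "saddle_height (scaled_potential w N) {pt N y} (pt N ` B)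
      = Min ((\<lambda>v. v / sqrt (real N)) ` ?M ` B)" by (simp add: saddle_height_def)
  also have "\<dots> = Min (?M ` B) / sqrt (real N)"
    using B by (intro mono_Min_commute[symmetric]) (auto simp: mono_def divide_right_mono)
  finally show ?thesis by (simp add: pass_def)
qed

text \<open>The set of saddles is compact and nonempty, so its least element exists and is a saddle.\<close>

lemma saddle_value:
  assumes \<gamma>: "continuous_on {-1..1} \<gamma>" and A: "finite A" "A \<noteq> {}" "A \<subseteq> {-1..1}"
    and B: "finite B" "B \<noteq> {}" "B \<subseteq> {-1..1::real}"
  shows "\<gamma> (saddle \<gamma> A B) = saddle_height \<gamma> A B"
proof -
  let ?h = "saddle_height \<gamma> A B"
  have sub: "{min a b..max a b} \<subseteq> {-1..1}" if "a \<in> A" "b \<in> B" for a b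
  proof -
    have "a \<in> {-1..1}" "b \<in> {-1..1}" using that A B by auto
    then show ?thesis by (auto simp: min_def max_def)
  qed
  have eq: "saddle_set \<gamma> A B = (\<Union>a\<in>A. \<Union>b\<in>B. {z\<in>{min a b..max a b}. \<gamma> z = ?h})"
  proof (intro equalityI subsetI)
    fix z assume "z \<in> (\<Union>a\<in>A. \<Union>b\<in>B. {z\<in>{min a b..max a b}. \<gamma> z = ?h})"
    then obtain a b where ab: "a \<in> A" "b \<in> B" "z \<in> {min a b..max a b}" "\<gamma> z = ?h" by blast
    then have "z \<in> {-1..1}" using sub[OF ab(1,2)] by blast
    with ab show "z \<in> saddle_set \<gamma> A B" unfolding saddle_set_def atLeastAtMost_iff by blast
  next
    fix z assume "z \<in> saddle_set \<gamma> A B"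
    then show "z \<in> (\<Union>a\<in>A. \<Union>b\<in>B. {z\<in>{min a b..max a b}. \<gamma> z = ?h})"
      unfolding saddle_set_def atLeastAtMost_iff by blast
  qed
  have "compact {z\<in>{min a b..max a b}. \<gamma> z = ?h}" if "a \<in> A" "b \<in> B" for a b
  proof -
    have c: "continuous_on {min a b..max a b} \<gamma>" using \<gamma> sub[OF that] by (rule continuous_on_subset)
    have "closed {z\<in>{min a b..max a b}. \<gamma> z = ?h}"
      using continuous_closed_preimage[OF c closed_atLeastAtMost closed_singleton[of ?h]]
      by (simp add: vimage_def Int_def)
    from compact_Int_closed[OF compact_Icc this, of "min a b" "max a b"] show ?thesis
      by (simp add: Int_def cong: conj_cong)
  qed
  then have comp: "compact (saddle_set \<gamma> A B)"
    unfolding eq using A(1) B(1) by (intro compact_UN) auto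
  have "?h \<in> (\<lambda>(a, b). SUP x\<in>{min a b..max a b}. \<gamma> x) ` (A \<times> B)"
    unfolding saddle_height_def using A B by (intro Min_in) auto
  then obtain a b where ab: "a \<in> A" "b \<in> B" "?h = (SUP x\<in>{min a b..max a b}. \<gamma> x)" by auto
  have c: "continuous_on {min a b..max a b} \<gamma>" using \<gamma> sub[OF ab(1,2)] by (rule continuous_on_subset)
  obtain z where z: "z \<in> {min a b..max a b}" "\<And>y. y \<in> {min a b..max a b} \<Longrightarrow> \<gamma> y \<le> \<gamma> z"
  proof -
    have "{min a b..max a b} \<noteq> {}" by (simp add: min_def max_def)
    from continuous_attains_sup[OF compact_Icc this c] show ?thesis using that by blast
  qed
  have "?h = \<gamma> z" unfolding ab(3) using z by (intro cSup_eq_maximum) auto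
  then have "z \<in> saddle_set \<gamma> A B" unfolding eq using z ab by auto
  then obtain m where m: "m \<in> saddle_set \<gamma> A B" "\<And>y. y \<in> saddle_set \<gamma> A B \<Longrightarrow> m \<le> y"
    using compact_attains_inf[OF comp] by blast
  then have "saddle \<gamma> A B = m" unfolding saddle_def by (intro Least_equality) auto
  with m(1) show ?thesis by (auto simp: saddle_set_def)
qed

lemma depth_scaled_potential:
  assumes N: "N > 0" and c: "continuous_on {-1..1} (scaled_potential w N)"
    and B: "finite B" "B \<noteq> {}" "B \<subseteq> {- int N..int N}" and y: "y \<in> {- int N..int N}"
  shows "depth (scaled_potential w N) (pt N y) (pt N ` B)
    = (pass (potential w) y B - potential w y) / sqrt (real N)"
proof -
  have "pt N z \<in> {-1..1}" if z: "z \<in> {- int N..int N}" for z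
  proof -
    have "- real N \<le> of_int z" "of_int z \<le> real N" using z by auto
    then show ?thesis using N by (simp add: field_simps)
  qed
  then have "scaled_potential w N (saddle (scaled_potential w N) {pt N y} (pt N ` B))
      = pass (potential w) y B / sqrt (real N)"
    using B y by (subst saddle_value[OF c]) (auto simp: saddle_height_scaled_potential[OF N])
  then show ?thesis by (simp add: depth_def scaled_potential_pt[OF N] diff_divide_distrib)
qed

text \<open>At an \<open>h\<close>-minimum strictly between two neighbouring lattice points the interpolation has slope zero. The left
  one of these points is then an equivalent \<open>h\<close>-minimum, so the given one is not the smallest of its class.\<close>

lemma h_minima_on_lattice:
  assumes N: "N > 0" and h: "h > 0" and x: "x \<in> h_minima h (scaled_potential w N)"
  shows "\<exists>k\<in>{- int N<..<int N}. x = pt N k"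
proof -
  let ?V = "scaled_potential w N"
  obtain a b where ab: "a \<in> {-1..1}" "b \<in> {-1..1}" "a < x" "x < b" "?V x + h \<le> ?V a" "?V x + h \<le> ?V b"
    "\<And>z. z \<in> {a..b} \<Longrightarrow> ?V x \<le> ?V z"
    using x unfolding h_minima_def h_minimum_def by blast
  have least: "x \<le> y" if "h_minimum h ?V y" "h_equiv h ?V x y" for y
    using x that by (auto simp: h_minima_def)
  define k where "k = \<lfloor>real N * x\<rfloor>"
  have k: "of_int k \<le> real N * x" "real N * x < of_int k + 1" by (simp_all add: k_def)
  then have seg: "pt N k \<le> x" "x < pt N (k + 1)" using N by (simp_all add: field_simps)
  have "x = pt N k"
  proof (rule ccontr)
    assume "x \<noteq> pt N k"
    with seg have lt: "pt N k < x" by simp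
    define \<sigma> where "\<sigma> = potential w (k + 1) - potential w k"
    have V: "?V t = ?V x + real N * (t - x) * \<sigma> / sqrt (real N)" if "pt N k \<le> t" "t \<le> pt N (k + 1)" for t
    proof -
      have "?V t = (potential w k + (real N * t - k) * \<sigma>) / sqrt (real N)"
        unfolding \<sigma>_def using that by (intro scaled_potential_segment[OF N])
      moreover have "?V x = (potential w k + (real N * x - k) * \<sigma>) / sqrt (real N)"
        unfolding \<sigma>_def using seg by (intro scaled_potential_segment[OF N]) auto
      moreover have "real N * (t - x) * \<sigma> = (real N * t - k) * \<sigma> - (real N * x - k) * \<sigma>"
        by (simp add: algebra_simps)
      ultimately show ?thesis by (simp add: add_divide_distrib diff_divide_distrib)
    qed
    define \<epsilon> where "\<epsilon> = Min {x - a, b - x, x - pt N k, pt N (k + 1) - x}"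
    have \<epsilon>: "\<epsilon> > 0" "\<epsilon> \<le> x - a" "\<epsilon> \<le> b - x" "\<epsilon> \<le> x - pt N k" "\<epsilon> \<le> pt N (k + 1) - x"
      using ab lt seg by (auto simp: \<epsilon>_def)
    define E where "E = real N * \<epsilon> * \<sigma> / sqrt (real N)"
    have "?V (x + \<epsilon>) = ?V x + real N * (x + \<epsilon> - x) * \<sigma> / sqrt (real N)"
      using \<epsilon> lt by (intro V) linarith+
    also have "real N * (x + \<epsilon> - x) * \<sigma> / sqrt (real N) = E" by (simp add: E_def)
    finally have "?V (x + \<epsilon>) = ?V x + E" .
    moreover have "?V x \<le> ?V (x + \<epsilon>)" using \<epsilon> ab(3) by (intro ab(7)) auto
    moreover have "?V (x - \<epsilon>) = ?V x + real N * (x - \<epsilon> - x) * \<sigma> / sqrt (real N)"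
      using \<epsilon> seg by (intro V) linarith+
    moreover have "real N * (x - \<epsilon> - x) * \<sigma> / sqrt (real N) = - E" by (simp add: E_def)
    moreover have "?V x \<le> ?V (x - \<epsilon>)" using \<epsilon> ab(4) by (intro ab(7)) auto
    ultimately have "E = 0" by linarith
    then have "\<sigma> = 0" using N \<epsilon>(1) by (simp add: E_def)
    then have flat: "?V t = ?V x" if "pt N k \<le> t" "t \<le> x" for t
      using V[of t] that seg by simp
    have ak: "a < pt N k"
    proof (rule ccontr)
      assume "\<not> a < pt N k"
      then have "?V a = ?V x" using ab by (intro flat) auto
      with ab h show False by simp
    qed
    have "h_minimum h ?V (pt N k)"
      unfolding h_minimum_def using ab ak lt flat[of "pt N k"]
      by (intro conjI bexI[of _ a] bexI[of _ b]) auto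
    moreover have "h_equiv h ?V x (pt N k)"
      unfolding h_equiv_def
    proof
      fix z assume "z \<in> {min x (pt N k)..max x (pt N k)}"
      then have "?V z = ?V x" using lt by (intro flat) auto
      then show "\<bar>?V z - ?V x\<bar> < h" using h by simp
    qed
    ultimately show False using least lt by fastforce
  qed
  moreover have "-1 < x" "x < 1" using ab by auto
  then have "- real N < real N * x" "real N * x < real N"
    using N mult_strict_left_mono[of "- 1" x "real N"] mult_strict_left_mono[of x 1 "real N"] by simp_all
  then have "k \<in> {- int N<..<int N}" using \<open>x = pt N k\<close> N by simp
  ultimately show ?thesis by blast
qed

text \<open>Membership in \<open>h_minima\<close> also requires that \<open>y\<close> be the smallest of its class. An equivalent \<open>h\<close>-minimum
  \<open>y'\<close> to the left of \<open>y\<close> lies to the right of \<open>a\<close>, hence is strictly higher than \<open>y\<close>. The point to the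
  right of \<open>y'\<close> that exceeds it by \<open>h\<close> cannot lie beyond \<open>y\<close>, because \<open>y'\<close> is lowest up to there, and cannot
  lie before \<open>y\<close>, because there the path stays within \<open>h\<close> of its value at \<open>y\<close>.\<close>

lemma leftmost_minimum_in_h_minima:
  assumes N: "N > 0" and h: "h > 0"
    and ab: "- int N \<le> a" "a < y" "y < b" "b \<le> int N"
    and high: "potential w y + h * sqrt (real N) \<le> potential w a"
      "potential w y + h * sqrt (real N) \<le> potential w b"
    and low: "\<And>z. z \<in> {a..b} \<Longrightarrow> potential w y \<le> potential w z"
    and left: "\<And>z. z \<in> {a..<y} \<Longrightarrow> potential w y < potential w z"
  shows "pt N y \<in> h_minima h (scaled_potential w N)"
proof -
  let ?V = "scaled_potential w N"
  have r: "sqrt (real N) > 0" using N by simp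
  have range: "pt N z \<in> {-1..1}" if z: "- int N \<le> z" "z \<le> int N" for z
  proof -
    have "- real N \<le> of_int z" "of_int z \<le> real N" using z by auto
    then show ?thesis using N by (simp add: field_simps)
  qed
  have high': "?V (pt N y) + h \<le> ?V (pt N a)" "?V (pt N y) + h \<le> ?V (pt N b)"
  proof -
    have eq: "potential w y / sqrt (real N) + h = (potential w y + h * sqrt (real N)) / sqrt (real N)"
      using r by (simp add: add_divide_distrib)
    then show "?V (pt N y) + h \<le> ?V (pt N a)" "?V (pt N y) + h \<le> ?V (pt N b)"
      unfolding scaled_potential_pt[OF N] eq using high r by (intro divide_right_mono; simp)+
  qed
  have low': "?V (pt N y) \<le> ?V t" if t: "t \<in> {pt N a..pt N b}" for t
  proof -
    obtain z where "z \<in> {a..b}" "potential w z / sqrt (real N) \<le> ?V t"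
      using scaled_potential_ge_site[OF N, of a t b w] t by auto
    moreover have "potential w y / sqrt (real N) \<le> potential w z / sqrt (real N)"
      using low[OF \<open>z \<in> {a..b}\<close>] by (intro divide_right_mono) auto
    ultimately show ?thesis by (simp add: scaled_potential_pt[OF N])
  qed
  have left': "?V (pt N y) < ?V t" if t: "pt N a \<le> t" "t < pt N y" for t
    using N t(1) less_imp_le[OF t(2)]
  proof (cases rule: segment_cases)
    case 1
    with t show ?thesis by simp
  next
    case (2 k)
    define s where "s = real N * t - k"
    have s: "0 \<le> s" "s < 1" using 2 N by (auto simp: s_def field_simps)
    have "potential w y < potential w k" using 2 by (intro left) auto
    moreover have "potential w y \<le> potential w (k + 1)" using 2 ab by (intro low) auto
    ultimately have "(1 - s) * potential w y + s * potential w y < (1 - s) * potential w k + s * potential w (k + 1)"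
      using s by (intro add_less_le_mono mult_strict_left_mono mult_left_mono) auto
    then have "potential w y < potential w k + s * (potential w (k + 1) - potential w k)"
      by (simp add: algebra_simps)
    then have "potential w y / sqrt (real N) < ?V t"
      using scaled_potential_segment[OF N, of k t w] 2 r by (simp add: s_def divide_strict_right_mono)
    then show ?thesis by (simp add: scaled_potential_pt[OF N])
  qed
  have "h_minimum h ?V (pt N y)"
    unfolding h_minimum_def using range[of a] range[of b] range[of y] ab high' low'
    by (intro conjI bexI[of _ "pt N a"] bexI[of _ "pt N b"]) (auto simp: pt_less_iff[OF N])
  moreover have "pt N y \<le> y'" if y': "h_minimum h ?V y'" and eq: "h_equiv h ?V (pt N y) y'" for y'
  proof (rule ccontr)
    assume "\<not> pt N y \<le> y'"
    then have lt: "y' < pt N y" by simp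
    then have close: "\<bar>?V z - ?V (pt N y)\<bar> < h" if "y' \<le> z" "z \<le> pt N y" for z
      using eq that by (auto simp: h_equiv_def min_def max_def)
    have "pt N a < y'"
    proof (rule ccontr)
      assume "\<not> pt N a < y'"
      then have "\<bar>?V (pt N a) - ?V (pt N y)\<bar> < h" using ab by (intro close) (auto simp: pt_le_iff[OF N])
      with high' h show False by simp
    qed
    then have above: "?V (pt N y) < ?V y'" using lt by (intro left') auto
    obtain a' b' where ab': "y' < b'" "?V y' + h \<le> ?V b'" "a' < y'" "\<And>z. z \<in> {a'..b'} \<Longrightarrow> ?V y' \<le> ?V z"
      using y' unfolding h_minimum_def by blast
    show False
    proof (cases "pt N y \<le> b'")
      case True
      then have "?V y' \<le> ?V (pt N y)" using ab' lt by (intro ab'(4)) auto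
      with above show False by simp
    next
      case False
      then have "\<bar>?V b' - ?V (pt N y)\<bar> < h" using ab' by (intro close) auto
      with ab'(2) above show False by simp
    qed
  qed
  ultimately show ?thesis by (auto simp: h_minima_def)
qed

section \<open>The walk in a good landscape\<close>

lemma potential_step: "potential w k = potential w (k - 1) + ln ((1 - w k) / w k)"
proof (cases "k \<ge> 1")
  case True
  then have "{1..k} = insert k {1..k - 1}" by auto
  then show ?thesis using True by (simp add: potential_def)
next
  case False
  show ?thesis
  proof (cases "k = 0")
    case False
    then have k: "k < 0" using \<open>\<not> k \<ge> 1\<close> by simp
    then have "{k..0} = insert k {k + 1..0}" by auto
    then show ?thesis using k by (simp add: potential_def)
  qed (simp add: potential_def)
qed

lemma (in good_landscape) energy_by_parts:
  assumes "f (- n) = 0" "f n = 0"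
  shows "energy f g = (\<Sum>i\<in>{-n<..<n}. f i * (exp (- U i) * (g i - g (i + 1)) + exp (- U (i - 1)) * (g i - g (i - 1))))"
proof -
  have "(\<Sum>z\<in>{-n..<n}. exp (- U z) * f z * (g z - g (z + 1)))
      = (\<Sum>i\<in>{-n<..<n}. exp (- U i) * f i * (g i - g (i + 1)))"
  proof -
    have "{-n..<n} = insert (-n) {-n<..<n}" using n by auto
    then show ?thesis using assms by simp
  qed
  moreover have "(\<Sum>z\<in>{-n..<n}. exp (- U z) * f (z + 1) * (g (z + 1) - g z))
      = (\<Sum>i\<in>{-n<..<n}. exp (- U (i - 1)) * f i * (g i - g (i - 1)))"
  proof -
    have "(\<Sum>z\<in>{-n..<n}. exp (- U z) * f (z + 1) * (g (z + 1) - g z))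
      = (\<Sum>i\<in>{-n<..n}. exp (- U (i - 1)) * f i * (g i - g (i - 1)))"
      by (rule sum.reindex_bij_witness[of _ "\<lambda>i. i - 1" "\<lambda>z. z + 1"]) auto
    moreover have "{-n<..n} = insert n {-n<..<n}" using n by auto
    ultimately show ?thesis using assms by simp
  qed
  moreover have "energy f g = (\<Sum>z\<in>{-n..<n}. exp (- U z) * f z * (g z - g (z + 1)))
      + (\<Sum>z\<in>{-n..<n}. exp (- U z) * f (z + 1) * (g (z + 1) - g z))"
    unfolding energy_def sum.distrib[symmetric] by (intro sum.cong) (auto simp: algebra_simps)
  ultimately show ?thesis
    by (simp add: sum.distrib[symmetric] distrib_left mult_ac)
qed

lemma (in good_landscape) energy_commute: "energy f g = energy g f"
  by (simp add: energy_def mult_ac)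

locale metastable_walk =
  fixes \<kappa> h \<delta> :: real and w :: "int \<Rightarrow> real" and N :: nat and x :: "nat \<Rightarrow> real"
  assumes \<kappa>: "\<kappa> > 0" and env: "elliptic_env \<kappa> w" and N: "N \<ge> 1" and h_pos: "h > 0" and \<delta>_pos: "\<delta> > 0"
    and good: "scaled_potential w N \<in> good_paths h \<delta>"
    and lab: "special_labeling h \<delta> (scaled_potential w N) x"
begin

abbreviation "V \<equiv> scaled_potential w N"
abbreviation "U \<equiv> potential w"
definition "M = h_minima h V"
definition "q = card M"
definition "p k = site N (x k)"

lemma N_pos: "N > 0" using N by simp

lemma w_range: "\<kappa> \<le> w k" "w k \<le> 1 - \<kappa>" "0 < w k" "w k < 1" "w k \<in> {0..1}"
proof -
  have "w k \<in> {\<kappa>..1 - \<kappa>}" using env by (auto simp: elliptic_env_def)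
  with \<kappa> show "\<kappa> \<le> w k" "w k \<le> 1 - \<kappa>" "0 < w k" "w k < 1" "w k \<in> {0..1}" by auto
qed

lemma V_cont: "continuous_on {-1..1} V"
  using good by (simp add: good_paths_def)

lemma M_nonempty: "M \<noteq> {}"
  using good by (simp add: good_paths_def M_def)

lemma x_bij: "bij_betw x {1..q} M"
  using lab by (simp add: special_labeling_def Let_def M_def q_def)

lemma q_pos: "q \<ge> 1"
proof (rule ccontr)
  assume "\<not> q \<ge> 1"
  then have "M = {}" using x_bij by (simp add: bij_betw_def)
  with M_nonempty show False by simp
qed

lemma x_image: "x ` {1..q} = M"
  using x_bij by (simp add: bij_betw_def)

lemma x_pt: "k \<in> {1..q} \<Longrightarrow> x k = pt N (p k)" and p_int: "k \<in> {1..q} \<Longrightarrow> p k \<in> {- int N<..<int N}"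
proof -
  assume "k \<in> {1..q}"
  then have "x k \<in> h_minima h V" using x_image by (auto simp: M_def)
  then obtain i where "i \<in> {- int N<..<int N}" "x k = pt N i"
    using h_minima_on_lattice[OF N_pos h_pos] by blast
  then show "x k = pt N (p k)" "p k \<in> {- int N<..<int N}" using N_pos by (simp_all add: p_def site_lattice)
qed

lemma M_pt: "M = pt N ` p ` {1..q}"
proof -
  have "x ` {1..q} = (\<lambda>k. pt N (p k)) ` {1..q}" using x_pt by (intro image_cong) auto
  then show ?thesis using x_image by (simp add: image_image)
qed

lemma inj_p: "inj_on p {1..q}"
proof (rule inj_onI)
  fix i j assume ij: "i \<in> {1..q}" "j \<in> {1..q}" "p i = p j"
  then have "x i = x j" using x_pt by simp
  then show "i = j" using x_bij ij by (auto simp: bij_betw_def inj_on_eq_iff)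
qed

lemma pt_ends: "pt N (- int N) = -1" "pt N (int N) = 1"
  using N_pos by simp_all

lemma bdry_minima_pt: "k \<le> q \<Longrightarrow> bdry_minima x k = pt N ` (p ` {1..k} \<union> {- int N, int N})"
proof -
  assume "k \<le> q"
  then have "x ` {1..k} = (\<lambda>k. pt N (p k)) ` {1..k}" using x_pt by (intro image_cong) auto
  then show ?thesis using pt_ends by (auto simp: bdry_minima_def image_Un image_image)
qed

lemma depth_pt:
  assumes "B \<subseteq> {- int N..int N}" "B \<noteq> {}" "y \<in> {- int N..int N}"
  shows "sqrt (real N) * depth V (pt N y) (pt N ` B) = pass U y B - U y"
proof -
  have "finite B" using assms(1) finite_subset by blast
  then show ?thesis using N_pos assms by (subst depth_scaled_potential[OF N_pos V_cont]) auto
qed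

lemma minima_range: "k \<le> q \<Longrightarrow> p ` {1..k} \<union> {- int N, int N} \<subseteq> {- int N..int N}"
  using p_int by fastforce

lemma well_deep:
  assumes "k \<in> {1..q}"
  shows "U (p k) + h * sqrt (real N) + \<delta> * sqrt (real N)
    \<le> pass U (p k) ((p ` {1..q} \<union> {- int N, int N}) - {p k})"
proof -
  let ?B = "p ` {1..q} \<union> {- int N, int N}"
  have "x k \<in> M" using assms x_image by auto
  then have "h + \<delta> \<le> depth V (x k) ((M \<union> {-1, 1}) - {x k})"
    using good by (auto simp: good_paths_def M_def)
  also have "(M \<union> {-1, 1}) - {x k} = pt N ` (?B - {p k})"
    using image_set_diff[OF pt_inj[OF N_pos], of ?B "{p k}"] assms pt_ends
    by (simp add: M_pt x_pt image_Un)
  finally have "sqrt (real N) * (h + \<delta>) \<le> sqrt (real N) * depth V (pt N (p k)) (pt N ` (?B - {p k}))"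
    using x_pt[OF assms] by (intro mult_left_mono) auto
  also have "\<dots> = pass U (p k) (?B - {p k}) - U (p k)"
  proof (rule depth_pt)
    show "?B - {p k} \<subseteq> {- int N..int N}" using minima_range[of q] by auto
    show "?B - {p k} \<noteq> {}" using p_int[OF assms] by fastforce
    show "p k \<in> {- int N..int N}" using p_int[OF assms] by auto
  qed
  finally show ?thesis by (simp add: algebra_simps)
qed

lemma depth_bdry:
  assumes "k \<in> {1..q}" "j \<in> {1..q}"
  shows "sqrt (real N) * depth V (x j) (bdry_minima x (k - 1))
    = pass U (p j) (p ` {1..k - 1} \<union> {- int N, int N}) - U (p j)"
proof -
  have "k - 1 \<le> q" using assms by auto
  then show ?thesis
    using minima_range[of "k - 1"] p_int[OF assms(2)]
    unfolding bdry_minima_pt[OF \<open>k - 1 \<le> q\<close>] x_pt[OF assms(2)] by (intro depth_pt) auto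
qed

lemma well_order:
  assumes k: "k \<in> {1..q}" and j: "j \<in> {k<..q}"
  shows "pass U (p j) (p ` {1..k - 1} \<union> {- int N, int N}) - U (p j) + \<delta> * sqrt (real N)
    \<le> pass U (p k) (p ` {1..k - 1} \<union> {- int N, int N}) - U (p k)"
proof -
  let ?d = "\<lambda>j. depth V (x j) (bdry_minima x (k - 1))"
  have j': "j \<in> {1..q}" using j by auto
  have "k \<in> {1..q - 1}" using k j by auto
  then have "?d k \<ge> Max (?d ` {k<..q}) + \<delta>"
    using lab by (simp add: special_labeling_def Let_def M_def q_def)
  moreover have "?d j \<le> Max (?d ` {k<..q})" using j by (intro Max_ge) auto
  ultimately have "?d j + \<delta> \<le> ?d k" by simp
  then have "sqrt (real N) * (?d j + \<delta>) \<le> sqrt (real N) * ?d k" by (intro mult_left_mono) auto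
  then show ?thesis
    unfolding distrib_left depth_bdry[OF k k] depth_bdry[OF k j'] by (simp add: mult.commute)
qed

sublocale good_landscape U "int N" p q "h * sqrt (real N)" "\<delta> * sqrt (real N)"
proof
  show "0 < int N" using N by simp
  show "0 < h * sqrt (real N)" "0 < \<delta> * sqrt (real N)" using N h_pos \<delta>_pos by simp_all
  show "1 \<le> q" by (rule q_pos)
  show "k \<in> {1..q} \<Longrightarrow> p k \<in> {- int N<..<int N}" for k by (rule p_int)
  show "inj_on p {1..q}" by (rule inj_p)
  show "y \<in> p ` {1..q}" if "- int N \<le> a" "a < y" "y < b" "b \<le> int N" "U y + h * sqrt (real N) \<le> U a"
    "U y + h * sqrt (real N) \<le> U b" "\<And>z. z \<in> {a..b} \<Longrightarrow> U y \<le> U z" "\<And>z. z \<in> {a..<y} \<Longrightarrow> U y < U z" for a b y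
  proof -
    have "pt N y \<in> M" unfolding M_def using that by (intro leftmost_minimum_in_h_minima[OF N_pos h_pos])
    then show ?thesis unfolding M_pt using inj_image_mem_iff[OF pt_inj[OF N_pos]] by blast
  qed
  show "k \<in> {1..q} \<Longrightarrow> U (p k) + h * sqrt (real N) + \<delta> * sqrt (real N)
    \<le> pass U (p k) (p ` {1..q} \<union> {- int N, int N} - {p k})" for k by (rule well_deep)
  show "k \<in> {1..q} \<Longrightarrow> j \<in> {k<..q} \<Longrightarrow>
      pass U (p j) (p ` {1..k - 1} \<union> {- int N, int N}) - U (p j) + \<delta> * sqrt (real N)
       \<le> pass U (p k) (p ` {1..k - 1} \<union> {- int N, int N}) - U (p k)" for k j by (rule well_order)
qed

definition "K = 1 / \<kappa>"

definition \<mu> :: "int \<Rightarrow> real" where "\<mu> z = exp (- U z) / w z"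

text \<open>The function \<open>h\<^sub>k\<close> in integer coordinates, see \<open>hk_pt\<close>.\<close>

definition e :: "nat \<Rightarrow> int \<Rightarrow> real" where "e k = reach_prob w {p k} (bd (k - 1))"

lemma K_ge: "K \<ge> 1"
  using \<kappa> w_range[of 0] by (simp add: K_def)

lemma \<mu>_up: "\<mu> z * w z = exp (- U z)"
  using w_range[of z] by (simp add: \<mu>_def)

lemma \<mu>_down: "\<mu> z * (1 - w z) = exp (- U (z - 1))"
proof -
  have "exp (- U (z - 1)) = exp (- U z) * exp (ln ((1 - w z) / w z))"
    using potential_step[of w z] by (simp flip: exp_add)
  also have "exp (ln ((1 - w z) / w z)) = (1 - w z) / w z" using w_range[of z] by simp
  finally show ?thesis by (simp add: \<mu>_def)
qed

text \<open>The weighted generator, \<open>\<mu> i (\<L> g)(i)\<close>.\<close>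

definition flux :: "(int \<Rightarrow> real) \<Rightarrow> int \<Rightarrow> real" where
  "flux g i = \<mu> i * (g i - w i * g (i + 1) - (1 - w i) * g (i - 1))"

lemma energy_flux:
  assumes "f (- int N) = 0" "f (int N) = 0"
  shows "energy f g = (\<Sum>i\<in>{- int N<..<int N}. f i * flux g i)"
proof -
  have "flux g i = \<mu> i * w i * (g i - g (i + 1)) + \<mu> i * (1 - w i) * (g i - g (i - 1))" for i
    by (simp add: flux_def algebra_simps)
  then have "flux g i = exp (- U i) * (g i - g (i + 1)) + exp (- U (i - 1)) * (g i - g (i - 1))" for i
    unfolding \<mu>_up \<mu>_down .
  then show ?thesis using energy_by_parts[OF assms, of g] by simp
qed

lemma e_values:
  shows e_01: "0 \<le> e k z" "e k z \<le> 1"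
    and e_1: "k \<in> {1..q} \<Longrightarrow> e k (p k) = 1"
    and e_0: "z \<in> bd (k - 1) \<Longrightarrow> e k z = 0"
proof -
  show "0 \<le> e k z" "e k z \<le> 1" by (simp_all add: e_def reach_prob_range)
  show "k \<in> {1..q} \<Longrightarrow> e k (p k) = 1"
    using p_notin_bd[of k "k - 1"] by (simp add: e_def reach_prob_target)
  show "z \<in> bd (k - 1) \<Longrightarrow> e k z = 0" by (simp add: e_def reach_prob_avoid)
qed

lemma flux_e: "k \<in> {1..q} \<Longrightarrow> z \<notin> bd k \<Longrightarrow> flux (e k) z = 0"
proof -
  assume "k \<in> {1..q}" "z \<notin> bd k"
  then have "z \<notin> {p k}" "z \<notin> bd (k - 1)" by (auto simp: bd_Suc[of k])
  from reach_prob_step[of w, OF w_range(5) this] show ?thesis by (simp add: flux_def e_def)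
qed

text \<open>Summation by parts moves all derivatives to \<open>e k\<close>; at every site either \<open>g\<close> or the flux of \<open>e k\<close>
  vanishes.\<close>

lemma e_harmonic:
  assumes k: "k \<in> {1..q}" and g: "\<And>z. z \<in> bd k \<Longrightarrow> g z = 0"
  shows "energy (e k) g = 0"
proof -
  have "energy g (e k) = (\<Sum>i\<in>{- int N<..<int N}. g i * flux (e k) i)"
    by (rule energy_flux) (use g in auto)
  also have "\<dots> = 0" using g flux_e[OF k] by (intro sum.neutral) force
  finally show ?thesis by (simp add: energy_commute)
qed

lemma energy_e: "k \<in> {1..q} \<Longrightarrow> energy (e k) (e k) = flux (e k) (p k)"
proof -
  assume k: "k \<in> {1..q}"
  have "energy (e k) (e k) = (\<Sum>i\<in>{- int N<..<int N}. e k i * flux (e k) i)"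
    by (rule energy_flux) (auto intro: e_0)
  also have "\<dots> = (\<Sum>i\<in>{p k}. e k i * flux (e k) i)"
    using p_int[OF k] e_0[of _ k] flux_e[OF k] by (intro sum.mono_neutral_right) (auto simp: bd_Suc[OF k])
  finally show ?thesis using e_1[OF k] by simp
qed

text \<open>The walk leaves the finite interval almost surely, so one of the two sets is reached. Analytically, the sum of
  the two hitting probabilities minus one is harmonic off \<open>bd k\<close> and zero on \<open>bd k\<close>; its energy vanishes, and the
  path inequality shows that it is zero.\<close>

lemma reach_complement:
  assumes k: "k \<in> {1..q}" and z: "z \<in> {- int N..int N}"
  shows "reach_prob w (bd (k - 1)) {p k} z = 1 - e k z"
proof -
  define u where "u z = reach_prob w (bd (k - 1)) {p k} z + e k z - 1" for z
  have pk: "p k \<notin> bd (k - 1)" using p_notin_bd[OF k, of "k - 1"] k by auto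
  have u0: "u z = 0" if "z \<in> bd k" for z
  proof (cases "z = p k")
    case True
    then show ?thesis using e_1[OF k] by (simp add: u_def reach_prob_avoid)
  next
    case False
    then have "z \<in> bd (k - 1)" using that by (simp add: bd_Suc[OF k])
    then show ?thesis using False e_0[of z k] by (simp add: u_def reach_prob_target)
  qed
  have "flux u z = 0" if "z \<notin> bd k" for z
  proof -
    have "z \<notin> bd (k - 1)" "z \<notin> {p k}" using that by (auto simp: bd_Suc[OF k])
    from reach_prob_step[of w, OF w_range(5) this] flux_e[OF k that] show ?thesis
      by (simp add: flux_def u_def algebra_simps)
  qed
  then have "u i * flux u i = 0" for i using u0 by (cases "i \<in> bd k") simp_all
  then have "(\<Sum>i\<in>{- int N<..<int N}. u i * flux u i) = 0" by (intro sum.neutral ballI)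
  moreover have "energy u u = (\<Sum>i\<in>{- int N<..<int N}. u i * flux u i)"
    by (rule energy_flux; rule u0) simp_all
  ultimately have "energy u u = 0" by simp
  moreover have "(u z)\<^sup>2 \<le> 2 * int N * exp (pass U z (bd k)) * energy u u"
    using k z u0 by (intro energy_point_bound bd_range) auto
  ultimately show ?thesis by (simp add: u_def)
qed

lemma bdry_bd: "k \<in> {1..q} \<Longrightarrow> bdry_minima x (k - 1) = pt N ` bd (k - 1)"
proof -
  assume "k \<in> {1..q}"
  then have "k - 1 \<le> q" by auto
  then show ?thesis unfolding bd_def by (rule bdry_minima_pt)
qed

lemma pt_in_image: "z \<in> B \<longleftrightarrow> pt N z \<in> pt N ` B"
  using inj_image_mem_iff[OF pt_inj[OF N_pos]] by simp

text \<open>Both sides are the flux of \<open>e k\<close> at its only source \<open>p k\<close>: on the left by the first step of the walk, on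
  the right by summation by parts.\<close>

lemma hits_before_escape:
  assumes k: "k \<in> {1..q}"
  shows "mu w N (x k) * hits_before w N (x k) (bdry_minima x (k - 1)) {x k} = energy (e k) (e k)"
proof -
  have s: "site N (x k) = p k" by (simp add: p_def)
  note b = bdry_bd[OF k]
  have "hits_before w N (x k) (bdry_minima x (k - 1)) {x k}
      = w (p k) * reach_prob w (bd (k - 1)) {p k} (p k + 1)
        + (1 - w (p k)) * reach_prob w (bd (k - 1)) {p k} (p k - 1)"
    unfolding b s[symmetric]
  proof (rule hits_before_eq_reach_prob)
    show "z \<in> bd (k - 1) \<longleftrightarrow> pt N z \<in> pt N ` bd (k - 1)" for z by (rule pt_in_image)
    show "z \<in> {site N (x k)} \<longleftrightarrow> pt N z \<in> {x k}" for z
      unfolding s using pt_in_image[of z "{p k}"] x_pt[OF k] by simp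
  qed (auto simp: w_range less_imp_le)
  also have "\<dots> = w (p k) * (1 - e k (p k + 1)) + (1 - w (p k)) * (1 - e k (p k - 1))"
  proof -
    have "p k + 1 \<in> {- int N..int N}" "p k - 1 \<in> {- int N..int N}" using p_int[OF k] by auto
    then show ?thesis by (simp only: reach_complement[OF k])
  qed
  also have "mu w N (x k) * \<dots> = flux (e k) (p k)"
    unfolding flux_def e_1[OF k] by (simp add: mu_def s \<mu>_def algebra_simps)
  finally show ?thesis by (simp add: energy_e[OF k])
qed

lemma hk_pt:
  assumes k: "k \<in> {1..q}"
  shows "hk w N x k (pt N z) = e k z"
proof -
  note b = bdry_bd[OF k]
  have xk: "pt N z = x k \<longleftrightarrow> z = p k" using pt_in_image[of z "{p k}"] x_pt[OF k] by simp
  have mem: "pt N z \<in> bdry_minima x (k - 1) \<longleftrightarrow> z \<in> bd (k - 1)" unfolding b by (rule pt_in_image[symmetric])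
  have s: "site N (pt N z) = z" using N_pos by (simp add: site_lattice)
  show ?thesis
  proof (cases "z = p k \<or> z \<in> bd (k - 1)")
    case True
    then show ?thesis using xk mem e_1[OF k] e_0[of z k] by (auto simp: hk_def)
  next
    case False
    have "hits_before w N (pt N z) {x k} (bdry_minima x (k - 1))
      = w (site N (pt N z)) * reach_prob w {p k} (bd (k - 1)) (site N (pt N z) + 1)
        + (1 - w (site N (pt N z))) * reach_prob w {p k} (bd (k - 1)) (site N (pt N z) - 1)"
      unfolding b
    proof (rule hits_before_eq_reach_prob)
      show "z \<in> bd (k - 1) \<longleftrightarrow> pt N z \<in> pt N ` bd (k - 1)" for z by (rule pt_in_image)
      show "z \<in> {p k} \<longleftrightarrow> pt N z \<in> {x k}" for z
        using pt_in_image[of z "{p k}"] x_pt[OF k] by simp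
    qed (auto simp: w_range less_imp_le)
    also have "\<dots> = reach_prob w {p k} (bd (k - 1)) z"
      unfolding s using False by (intro reach_prob_step[symmetric] w_range) auto
    finally show ?thesis using False xk mem by (simp add: hk_def e_def)
  qed
qed

definition "I = lattice_interval N"

lemma I_pt: "I = pt N ` {- int N<..<int N}"
proof -
  have "pt N k \<in> {-1<..<1} \<longleftrightarrow> k \<in> {- int N<..<int N}" for k
  proof -
    have "-1 < pt N k \<longleftrightarrow> - int N < k" "pt N k < 1 \<longleftrightarrow> k < int N"
      using pt_less_iff[OF N_pos, of "- int N" k] pt_less_iff[OF N_pos, of k "int N"]
      unfolding pt_ends by simp_all
    then show ?thesis by auto
  qed
  then show ?thesis unfolding I_def lattice_interval_def lattice_def by blast
qed

lemma sum_I: "(\<Sum>y\<in>I. f y) = (\<Sum>i\<in>{- int N<..<int N}. f (pt N i))"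
  unfolding I_pt by (rule sum.reindex[unfolded comp_def]) (use pt_inj[OF N_pos] in \<open>auto simp: inj_def inj_on_def\<close>)

lemma mu_pt: "mu w N (pt N i) = \<mu> i"
  using N_pos by (simp add: mu_def \<mu>_def site_lattice)

lemma gen_entry_pt: "gen_entry w N (pt N i) (pt N j)
  = of_bool (j = i) - w i * of_bool (j = i + 1) - (1 - w i) * of_bool (j = i - 1)"
proof -
  have "pt N i + 1 / real N = pt N (i + 1)" "pt N i - 1 / real N = pt N (i - 1)"
    by (simp_all add: add_divide_distrib diff_divide_distrib)
  moreover have "indicator {pt N j} (pt N a) = (of_bool (j = a) :: real)" for a
    using N_pos by (auto simp: indicator_def)
  moreover have "site N (pt N i) = i" using N_pos by (simp add: site_lattice)
  ultimately show ?thesis unfolding gen_entry_def generator_def by (simp only:)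
qed

lemma \<mu>_pos': "\<mu> i > 0"
  using w_range[of i] by (simp add: \<mu>_def)

lemma kernel: "Y \<subseteq> I \<Longrightarrow> reversible_kernel Y (mu w N) (gen_entry w N)"
proof
  assume Y: "Y \<subseteq> I"
  show "finite Y" using Y by (rule finite_subset) (simp add: I_pt)
  show "0 < mu w N a" if "a \<in> Y" for a using that Y \<mu>_pos' by (auto simp: I_pt mu_pt)
  show "mu w N a * gen_entry w N a b = mu w N b * gen_entry w N b a" if ab: "a \<in> Y" "b \<in> Y" for a b
  proof -
    obtain i j where ij: "a = pt N i" "b = pt N j" using ab Y unfolding I_pt by blast
    have "\<mu> i * (of_bool (j = i) - w i * of_bool (j = i + 1) - (1 - w i) * of_bool (j = i - 1))
       = \<mu> j * (of_bool (i = j) - w j * of_bool (i = j + 1) - (1 - w j) * of_bool (i = j - 1))"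
    proof -
      consider "j = i" | "j = i + 1" | "i = j + 1" | "j \<noteq> i \<and> j \<noteq> i + 1 \<and> i \<noteq> j + 1" by blast
      then show ?thesis
      proof cases
        case 2
        have "\<mu> (i + 1) * (w (i + 1) - 1) = - exp (- U i)" using \<mu>_down[of "i + 1"] by (simp add: algebra_simps)
        then show ?thesis using 2 \<mu>_up[of i] by simp
      next
        case 3
        have "\<mu> (j + 1) * (w (j + 1) - 1) = - exp (- U j)" using \<mu>_down[of "j + 1"] by (simp add: algebra_simps)
        then show ?thesis using 3 \<mu>_up[of j] by simp
      qed auto
    qed
    then show ?thesis unfolding ij mu_pt gen_entry_pt .
  qed
qed

lemma eigvec_kernel: "Y \<subseteq> I \<Longrightarrow>
  reversible_kernel.eigvec Y (gen_entry w N) = dirichlet_eigenvector w N Y"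
proof -
  assume "Y \<subseteq> I"
  then interpret Y: reversible_kernel Y "mu w N" "gen_entry w N" by (rule kernel)
  show ?thesis
    by (simp add: fun_eq_iff Y.eigvec_def Y.kop_def dirichlet_eigenvector_def dirichlet_gen_def)
qed

sublocale kern: reversible_kernel I "mu w N" "gen_entry w N"
  by (rule kernel) simp

text \<open>Dirichlet conditions as boundary values: with them the form on \<open>I\<close> becomes the energy on the closed
  interval, see \<open>form_ext\<close>.\<close>

definition ext :: "(real \<Rightarrow> real) \<Rightarrow> int \<Rightarrow> real" where
  "ext f i = (if i \<in> {- int N<..<int N} then f (pt N i) else 0)"

lemma ip_ext: "kern.ip f g = (\<Sum>i\<in>{- int N<..<int N}. \<mu> i * ext f i * ext g i)"
  unfolding kern.ip_def sum_I mu_pt by (intro sum.cong) (auto simp: ext_def)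

lemma form_ext: "kern.form f g = energy (ext f) (ext g)"
proof -
  have "kern.kop g (pt N i) = ext g i - w i * ext g (i + 1) - (1 - w i) * ext g (i - 1)"
    if i: "i \<in> {- int N<..<int N}" for i
  proof -
    have delta: "(\<Sum>j\<in>{- int N<..<int N}. of_bool (j = a) * g (pt N j)) = ext g a" for a
    proof -
      have "(\<Sum>j\<in>{- int N<..<int N}. of_bool (j = a) * g (pt N j))
          = (\<Sum>j\<in>{- int N<..<int N}. if j = a then g (pt N j) else 0)"
        by (intro sum.cong) auto
      then show ?thesis by (simp add: ext_def)
    qed
    have "kern.kop g (pt N i) = (\<Sum>j\<in>{- int N<..<int N}. of_bool (j = i) * g (pt N j))
        - w i * (\<Sum>j\<in>{- int N<..<int N}. of_bool (j = i + 1) * g (pt N j))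
        - (1 - w i) * (\<Sum>j\<in>{- int N<..<int N}. of_bool (j = i - 1) * g (pt N j))"
      unfolding kern.kop_def sum_I gen_entry_pt sum_distrib_left sum_subtractf[symmetric]
      by (intro sum.cong) (auto simp: algebra_simps)
    then show ?thesis unfolding delta .
  qed
  then have "kern.form f g = (\<Sum>i\<in>{- int N<..<int N}. ext f i * flux (ext g) i)"
    unfolding kern.form_def kern.ip_def sum_I mu_pt by (intro sum.cong) (auto simp: flux_def ext_def)
  also have "\<dots> = energy (ext f) (ext g)"
    by (rule energy_flux[symmetric]) (auto simp: ext_def)
  finally show ?thesis .
qed

lemma norm2_nrm: "norm2 w N f = kern.nrm f"
  unfolding norm2_def kern.nrm_def kern.ip_def by (simp add: I_def power2_eq_square mult.assoc)

lemma ext_hk: "k \<in> {1..q} \<Longrightarrow> i \<in> {- int N..int N} \<Longrightarrow> ext (hk w N x k) i = e k i"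
proof -
  assume k: "k \<in> {1..q}" and i: "i \<in> {- int N..int N}"
  show ?thesis
  proof (cases "i \<in> {- int N<..<int N}")
    case False
    then have "i = - int N \<or> i = int N" using i by auto
    then have "e k i = 0" using e_0[of i k] by auto
    with False show ?thesis unfolding ext_def by auto
  qed (simp add: ext_def hk_pt[OF k])
qed

lemma energy_cong:
  "(\<And>i. i \<in> {- int N..int N} \<Longrightarrow> f i = f' i) \<Longrightarrow> (\<And>i. i \<in> {- int N..int N} \<Longrightarrow> g i = g' i)
    \<Longrightarrow> energy f g = energy f' g'"
  unfolding energy_def by (intro sum.cong) auto

lemma form_hk_left: "k \<in> {1..q} \<Longrightarrow> kern.form (hk w N x k) g = energy (e k) (ext g)"
  unfolding form_ext by (intro energy_cong) (auto simp: ext_hk)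

lemma form_hk: "k \<in> {1..q} \<Longrightarrow> j \<in> {1..q} \<Longrightarrow> kern.form (hk w N x k) (hk w N x j) = energy (e k) (e j)"
  unfolding form_ext by (intro energy_cong) (auto simp: ext_hk)

lemma ip_hk: "k \<in> {1..q} \<Longrightarrow> j \<in> {1..q} \<Longrightarrow>
  kern.ip (hk w N x k) (hk w N x j) = (\<Sum>i\<in>{- int N<..<int N}. \<mu> i * e k i * e j i)"
  unfolding ip_ext by (intro sum.cong) (auto simp: ext_hk)

lemma M_subset: "M \<subseteq> I"
  using p_int by (auto simp: M_pt I_pt)

lemma ext_zero_on_bd: "(\<And>i. i \<in> {1..q} \<Longrightarrow> g (x i) = 0) \<Longrightarrow> z \<in> bd q \<Longrightarrow> ext g z = 0"
  by (auto simp: bd_def ext_def x_pt)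

end

section \<open>Low-lying eigenvalues and eigenvectors\<close>

context metastable_walk
begin

text \<open>The bound for the normalised overlaps that follows from \<open>overlap_bound\<close>. It also bounds the ratios of
  consecutive \<open>\<rho>\<close>, since these are at most its square (see \<open>exp_d_le_\<eta>\<close>), and so serves for both error
  parameters of \<open>quasi_eigenbasis\<close>.\<close>

definition "\<eta> = 2 * real N * K * sqrt (4 * real N * K * exp (- (\<delta> * sqrt (real N))))"

definition "gap_eig = Min (dirichlet_spectrum w N (I - M))"

end

text \<open>The condition that determines \<open>N(\<delta>, Q)\<close>; the left-hand side is the error of the eigenvectors in \<open>low_spectrum\<close>. It also
  implies all other smallness conditions.\<close>

locale metastable_walk_large = metastable_walk +
  assumes small: "10 * real q * (real q * \<eta> + \<eta>) \<le> exp (- (\<delta> / 10) * sqrt (real N))"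
begin

lemma NK: "1 \<le> real N * K"
  using mult_mono[of 1 "real N" 1 K] N K_ge by simp

lemma \<eta>_nonneg: "0 \<le> \<eta>"
  using K_ge by (simp add: \<eta>_def)

lemma \<eta>_le: "real q * \<eta> \<le> 1 / 8" "\<eta> \<le> 1 / 20"
proof -
  have q1: "1 \<le> real q" using q_pos by simp
  have "exp (- (\<delta> / 10) * sqrt (real N)) \<le> 1" using \<delta>_pos by simp
  then have b: "10 * real q * (real q * \<eta> + \<eta>) \<le> 1" using small by linarith
  have "1 * (real q * \<eta> + \<eta>) \<le> real q * (real q * \<eta> + \<eta>)"
    using q1 \<eta>_nonneg by (intro mult_right_mono) auto
  then have c: "real q * \<eta> + \<eta> \<le> 1 / 10" using b by simp
  have "1 * \<eta> \<le> real q * \<eta>" using q1 \<eta>_nonneg by (intro mult_right_mono) auto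
  with c show "\<eta> \<le> 1 / 20" by simp
  show "real q * \<eta> \<le> 1 / 8" using c \<eta>_nonneg by simp
qed

lemma large: "4 * real N * K * exp (- (\<delta> * sqrt (real N))) \<le> 1"
proof -
  let ?s = "4 * real N * K * exp (- (\<delta> * sqrt (real N)))"
  have "1 * sqrt ?s \<le> (2 * real N * K) * sqrt ?s" using NK K_ge by (intro mult_right_mono) auto
  then have "sqrt ?s \<le> 1" using \<eta>_le(2) unfolding \<eta>_def by linarith
  then show ?thesis by simp
qed

lemma exp_d_le_\<eta>: "8 * (real N)\<^sup>2 * K\<^sup>2 * exp (- (\<delta> * sqrt (real N))) \<le> \<eta>"
proof -
  let ?x = "exp (- (\<delta> * sqrt (real N)))"
  have "8 * (real N)\<^sup>2 * K\<^sup>2 * ?x * 1 \<le> 8 * (real N)\<^sup>2 * K\<^sup>2 * ?x * (2 * (real N * K))"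
    using NK by (intro mult_left_mono) auto
  also have "\<dots> = \<eta> * \<eta>"
  proof -
    have "sqrt (4 * real N * K * ?x) * sqrt (4 * real N * K * ?x) = 4 * real N * K * ?x"
      using K_ge by simp
    moreover have "\<eta> * \<eta> = (2 * real N * K) * (2 * real N * K)
        * (sqrt (4 * real N * K * ?x) * sqrt (4 * real N * K * ?x))"
      unfolding \<eta>_def by (simp only: mult_ac)
    ultimately have "\<eta> * \<eta> = (2 * real N * K) * (2 * real N * K) * (4 * real N * K * ?x)"
      by (simp only:)
    then show ?thesis by (simp add: power2_eq_square mult_ac)
  qed
  also have "\<dots> \<le> 1 * \<eta>" using \<eta>_le(2) \<eta>_nonneg by (intro mult_right_mono) auto
  finally show ?thesis by simp
qed

sublocale env: good_environment U "int N" p q "h * sqrt (real N)" "\<delta> * sqrt (real N)" K \<mu> e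
proof
  show "1 \<le> K" by (rule K_ge)
  have up: "\<mu> z \<le> K * exp (- U z)" for z
  proof -
    have "1 / w z \<le> 1 / \<kappa>" using w_range[of z] \<kappa> by (intro divide_left_mono) auto
    then have "exp (- U z) * (1 / w z) \<le> exp (- U z) * (1 / \<kappa>)" by (intro mult_left_mono) auto
    then show ?thesis by (simp add: \<mu>_def K_def)
  qed
  show "\<mu> z \<le> K * exp (- U z)" for z by (rule up)
  show "exp (- U z) \<le> \<mu> z" for z
    using w_range[of z] by (simp add: \<mu>_def field_simps)
  show "exp (- U (z - 1)) \<le> K * exp (- U z)" for z
  proof -
    have "exp (- U (z - 1)) = \<mu> z * (1 - w z)" by (rule \<mu>_down[symmetric])
    also have "\<dots> \<le> \<mu> z * 1" using w_range[of z] \<mu>_pos'[of z] by (intro mult_left_mono) auto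
    finally show ?thesis using up[of z] by simp
  qed
  show "0 \<le> e k z" "e k z \<le> 1" for k z by (rule e_01)+
  show "k \<in> {1..q} \<Longrightarrow> e k (p k) = 1" for k by (rule e_1)
  show "k \<in> {1..q} \<Longrightarrow> z \<in> bd (k - 1) \<Longrightarrow> e k z = 0" for k z by (rule e_0)
  show "energy (e k) g = 0" if k: "k \<in> {1..q}" and g: "\<And>z. z \<in> bd k \<Longrightarrow> g z = 0" for k g
    using k g by (rule e_harmonic)
  show "real_of_int (4 * int N) * K * exp (- (\<delta> * sqrt (real N))) \<le> 1" using large by simp
qed

definition "well_depth k = H k - U (p k)"

definition "\<rho> k = env.cap k / env.mass k"

lemma \<rho>_upper: "k \<in> {1..q} \<Longrightarrow> \<rho> k \<le> 2 * K * exp (- well_depth k)"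
proof -
  assume k: "k \<in> {1..q}"
  have "\<rho> k \<le> (2 * K * exp (- H k)) / exp (- U (p k))"
    unfolding \<rho>_def using env.cap_upper[OF k] env.mass_lower[OF k] env.cap_pos[OF k] K_ge
    by (intro frac_le) auto
  also have "\<dots> = 2 * K * exp (- well_depth k)" by (simp add: well_depth_def exp_diff exp_minus field_simps)
  finally show ?thesis .
qed

lemma \<rho>_lower: "k \<in> {1..q} \<Longrightarrow> exp (- well_depth k) \<le> 4 * (real N)\<^sup>2 * K * \<rho> k"
proof -
  assume k: "k \<in> {1..q}"
  have "exp (- well_depth k) = exp (- H k) / exp (- U (p k))" by (simp add: well_depth_def exp_diff exp_minus field_simps)
  also have "\<dots> \<le> (2 * N * env.cap k) / exp (- U (p k))"
    using env.cap_lower[OF k] by (intro divide_right_mono) auto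
  also have "\<dots> \<le> (2 * N * env.cap k) * (2 * N * K / env.mass k)"
  proof -
    have "1 / exp (- U (p k)) \<le> 2 * N * K / env.mass k"
      using env.mass_upper[OF k] env.mass_pos[OF k] by (simp add: field_simps)
    then have "(2 * N * env.cap k) * (1 / exp (- U (p k))) \<le> (2 * N * env.cap k) * (2 * N * K / env.mass k)"
      using env.cap_pos[OF k] by (intro mult_left_mono) auto
    then show ?thesis by simp
  qed
  also have "\<dots> = 4 * (real N)\<^sup>2 * K * \<rho> k" by (simp add: \<rho>_def power2_eq_square)
  finally show ?thesis .
qed

lemma \<rho>_pos: "k \<in> {1..q} \<Longrightarrow> \<rho> k > 0"
  using env.cap_pos env.mass_pos by (simp add: \<rho>_def)

text \<open>The pass from \<open>p 1\<close> to any other point of \<open>bd q\<close> is higher than \<open>p 1\<close> by \<open>\<delta> \<surd>N\<close>, while the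
  potential rises by at most \<open>ln K\<close>, which is less, between neighbours. So the right neighbour of \<open>p 1\<close> is
  neither a minimum nor an end point.\<close>

lemma complement_nonempty: "I - M \<noteq> {}"
proof
  assume "I - M = {}"
  have k: "1 \<in> {1..q}" using q_pos by simp
  have "p 1 + 1 \<in> bd q"
  proof (cases "p 1 + 1 = int N")
    case False
    then have "pt N (p 1 + 1) \<in> I" using p_int[OF k] unfolding I_pt by (intro imageI) auto
    then have "pt N (p 1 + 1) \<in> pt N ` p ` {1..q}" using \<open>I - M = {}\<close> M_pt by blast
    then have "p 1 + 1 \<in> p ` {1..q}" by (rule pt_in_image[THEN iffD2])
    then show ?thesis by (simp add: bd_def)
  qed simp
  then have "pass U (p 1) (bd q - {p 1}) \<le> max (U (p 1)) (U (p 1 + 1))"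
  proof (intro pass_le[of _ "p 1 + 1"])
    fix z assume "z \<in> {min (p 1 + 1) (p 1)..max (p 1 + 1) (p 1)}"
    then have "z = p 1 \<or> z = p 1 + 1" by auto
    then show "U z \<le> max (U (p 1)) (U (p 1 + 1))" by auto
  qed auto
  moreover have "U (p 1) + h * sqrt (real N) + \<delta> * sqrt (real N) \<le> pass U (p 1) (bd q - {p 1})"
    unfolding bd_def by (rule well_deep[OF k])
  moreover have "0 < h * sqrt (real N)" "0 < \<delta> * sqrt (real N)" using N h_pos \<delta>_pos by simp_all
  ultimately have "U (p 1) + \<delta> * sqrt (real N) \<le> U (p 1 + 1)" by (auto simp: max_def split: if_splits)
  then have "exp (- U (p 1 + 1)) \<le> exp (- U (p 1) + - (\<delta> * sqrt (real N)))" by simp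
  then have "exp (- U (p 1 + 1)) \<le> exp (- U (p 1)) * exp (- (\<delta> * sqrt (real N)))" unfolding exp_add .
  then have *: "K * exp (- U (p 1 + 1)) \<le> K * (exp (- U (p 1)) * exp (- (\<delta> * sqrt (real N))))"
    using K_ge by (intro mult_left_mono) auto
  have "exp (- U (p 1)) * 1 \<le> K * exp (- U (p 1 + 1))" using env.elliptic[of "p 1 + 1"] by simp
  also note *
  also have "K * (exp (- U (p 1)) * exp (- (\<delta> * sqrt (real N))))
    = exp (- U (p 1)) * (K * exp (- (\<delta> * sqrt (real N))))" by (simp only: mult_ac)
  finally have "exp (- U (p 1)) * 1 \<le> exp (- U (p 1)) * (K * exp (- (\<delta> * sqrt (real N))))" .
  then have "1 \<le> K * exp (- (\<delta> * sqrt (real N)))" by (simp only: mult_le_cancel_left_pos exp_gt_zero)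
  moreover have "1 * (K * exp (- (\<delta> * sqrt (real N)))) \<le> real N * (K * exp (- (\<delta> * sqrt (real N))))"
    using N K_ge by (intro mult_right_mono) auto
  ultimately show False using large by (simp add: mult.assoc)
qed

text \<open>For functions that vanish on \<open>M\<close> the forms on \<open>I\<close> and on \<open>I - M\<close> agree. So the variational principle
  on \<open>I - M\<close> carries over to \<open>I\<close>, and the Poincare inequality on \<open>I\<close> applies to an eigenfunction on \<open>I - M\<close>.\<close>

lemma gap_variational:
  assumes "\<And>i. i \<in> {1..q} \<Longrightarrow> g (x i) = 0"
  shows "gap_eig * kern.ip g g \<le> kern.form g g"
    and "exp (- (h * sqrt (real N))) \<le> 4 * (real N)\<^sup>2 * K * gap_eig"
proof -
  interpret J: reversible_kernel "I - M" "mu w N" "gen_entry w N" by (rule kernel) auto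
  have ip: "J.ip f f' = kern.ip f f'" if "\<And>y. y \<in> M \<Longrightarrow> f y = 0" for f f'
    unfolding J.ip_def kern.ip_def using that by (intro sum.mono_neutral_left) auto
  have form: "J.form f f = kern.form f f" if f: "\<And>y. y \<in> M \<Longrightarrow> f y = 0" for f
  proof -
    have "J.kop f y = kern.kop f y" for y
      unfolding J.kop_def kern.kop_def using f by (intro sum.mono_neutral_left) auto
    then have "J.kop f = kern.kop f" by (rule ext)
    then show ?thesis unfolding J.form_def kern.form_def using ip[OF f] by simp
  qed
  have eig: "J.eigvec = dirichlet_eigenvector w N (I - M)" by (rule eigvec_kernel) auto
  have Min: "gap_eig = Min {l. \<exists>f. J.eigvec l f}" by (simp add: gap_eig_def dirichlet_spectrum_def eig)
  note spec = J.Min_spectrum[OF complement_nonempty, folded Min]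
  have "g y = 0" if "y \<in> M" for y using that assms unfolding x_image[symmetric] by blast
  then show "gap_eig * kern.ip g g \<le> kern.form g g" using spec(2)[of g] ip[of g g] form[of g] by simp
  obtain f where f: "J.eigvec gap_eig f" using spec(1) by blast
  define f0 where "f0 y = (if y \<in> M then 0 else f y)" for y
  have f0: "f0 y = 0" if "y \<in> M" for y using that by (simp add: f0_def)
  have "J.ip f0 f0 = J.ip f f" "J.form f0 f0 = J.form f f"
    by (auto intro!: J.ip_cong J.form_cong simp: f0_def)
  then have i0: "kern.ip f0 f0 > 0" "kern.form f0 f0 = gap_eig * kern.ip f0 f0"
    using f ip[of f0 f0, OF f0] form[of f0, OF f0] unfolding J.eigvec_iff by simp_all
  have "kern.ip f0 f0 = (\<Sum>i\<in>{- int N<..<int N}. \<mu> i * (ext f0 i)\<^sup>2)"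
    by (simp add: ip_ext power2_eq_square mult.assoc)
  also have "\<dots> \<le> 4 * (int N)\<^sup>2 * K * exp (h * sqrt (real N)) * energy (ext f0) (ext f0)"
  proof (rule env.poincare)
    have "f0 (x i) = 0" if "i \<in> {1..q}" for i using that f0 x_image by blast
    then show "z \<in> bd q \<Longrightarrow> ext f0 z = 0" for z by (rule ext_zero_on_bd)
  qed
  also have "\<dots> = 4 * (real N)\<^sup>2 * K * exp (h * sqrt (real N)) * (gap_eig * kern.ip f0 f0)"
    by (simp add: form_ext[symmetric] i0(2))
  finally have "1 * kern.ip f0 f0 \<le> (4 * (real N)\<^sup>2 * K * exp (h * sqrt (real N)) * gap_eig) * kern.ip f0 f0"
    by (simp only: mult_ac mult_1)
  then have "1 \<le> 4 * (real N)\<^sup>2 * K * exp (h * sqrt (real N)) * gap_eig"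
    using i0(1) by (simp only: mult_le_cancel_right_pos)
  then have "exp (- (h * sqrt (real N))) * 1 \<le> exp (- (h * sqrt (real N))) * (4 * (real N)\<^sup>2 * K * exp (h * sqrt (real N)) * gap_eig)"
    by (intro mult_left_mono) auto
  also have "\<dots> = 4 * (real N)\<^sup>2 * K * gap_eig * (exp (- (h * sqrt (real N))) * exp (h * sqrt (real N)))"
    by (simp only: mult_ac)
  finally show "exp (- (h * sqrt (real N))) \<le> 4 * (real N)\<^sup>2 * K * gap_eig" by (simp flip: exp_add)
qed

lemma gap_lower: "exp (- (h * sqrt (real N))) \<le> 4 * (real N)\<^sup>2 * K * gap_eig"
  using gap_variational(2)[of "\<lambda>_. 0"] by simp

lemma gap_pos: "gap_eig > 0"
proof (rule zero_less_mult_pos)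
  show "0 < (4 * (real N)\<^sup>2 * K) * gap_eig"
    using gap_lower exp_gt_zero[of "- (h * sqrt (real N))"] by linarith
  show "0 < 4 * (real N)\<^sup>2 * K" using N K_ge by simp
qed

text \<open>Used for two consecutive \<open>\<rho>\<close>, and for \<open>\<rho> q\<close> and \<open>\<lambda>\<^sup>*\<close>; \<open>b\<close> is the depth that belongs to \<open>r\<close>.\<close>

lemma separation:
  assumes "0 \<le> b" "\<rho> k \<le> 2 * K * exp (- well_depth k)" "exp (- b) \<le> 4 * (real N)\<^sup>2 * K * r"
    "b + \<delta> * sqrt (real N) \<le> well_depth k" "r > 0"
  shows "\<rho> k \<le> \<eta> * r"
proof -
  have "exp (- well_depth k) \<le> exp (- b + - (\<delta> * sqrt (real N)))" using assms(4) by simp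
  then have "exp (- well_depth k) \<le> exp (- b) * exp (- (\<delta> * sqrt (real N)))" unfolding exp_add .
  also have "\<dots> \<le> (4 * (real N)\<^sup>2 * K * r) * exp (- (\<delta> * sqrt (real N)))"
    using assms(3) by (intro mult_right_mono) auto
  finally have "2 * K * exp (- well_depth k) \<le> 2 * K * ((4 * (real N)\<^sup>2 * K * r) * exp (- (\<delta> * sqrt (real N))))"
    using K_ge by (intro mult_left_mono) auto
  also have "\<dots> = (8 * (real N)\<^sup>2 * K\<^sup>2 * exp (- (\<delta> * sqrt (real N)))) * r"
    by (simp add: power2_eq_square)
  also have "\<dots> \<le> \<eta> * r" using exp_d_le_\<eta> assms(5) by (intro mult_right_mono) auto
  finally show ?thesis using assms(2) by simp
qed

definition "hk_norm k = kern.nrm (hk w N x k)"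

lemma hk_norm_power2: "k \<in> {1..q} \<Longrightarrow> (hk_norm k)\<^sup>2 = env.mass k"
  unfolding hk_norm_def kern.nrm_power2 by (simp add: ip_hk env.mass_def power2_eq_square mult.assoc)

lemma hk_norm_pos: "k \<in> {1..q} \<Longrightarrow> hk_norm k > 0"
  using hk_norm_power2[of k] env.mass_pos[of k] kern.nrm_nonneg[of "hk w N x k"]
  unfolding hk_norm_def[symmetric] by (cases "hk_norm k = 0") auto

lemma hk_norm_lower: "k \<in> {1..q} \<Longrightarrow> exp (- U (p k) / 2) \<le> hk_norm k"
proof (rule power2_le_imp_le)
  assume k: "k \<in> {1..q}"
  show "(exp (- U (p k) / 2))\<^sup>2 \<le> (hk_norm k)\<^sup>2"
    unfolding hk_norm_power2[OF k] using env.mass_lower[OF k] by (simp flip: exp_double)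
  show "0 \<le> hk_norm k" by (simp add: hk_norm_def)
qed

definition "hk_unit k y = hk w N x k y / hk_norm k"

lemma hk_unit_eq: "hk_unit k = (\<lambda>y. (1 / hk_norm k) * hk w N x k y)"
  by (simp add: hk_unit_def fun_eq_iff)

lemma hk_unit_overlap:
  assumes k: "k \<in> {1..q}" and j: "j \<in> {k<..q}"
  shows "\<bar>kern.ip (hk_unit k) (hk_unit j)\<bar> \<le> \<eta>"
proof -
  have j': "j \<in> {1..q}" using j by auto
  let ?S = "\<Sum>i\<in>{- int N<..<int N}. \<mu> i * e k i * e j i"
  let ?E = "exp (- U (p k) / 2) * exp (- U (p j) / 2)"
  have "kern.ip (hk_unit k) (hk_unit j) = ?S / (hk_norm k * hk_norm j)"
    unfolding hk_unit_eq kern.ip_scale_left kern.ip_scale_right ip_hk[OF k j'] by simp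
  moreover have "0 \<le> ?S"
    using e_01 \<mu>_pos' by (intro sum_nonneg mult_nonneg_nonneg) (auto simp: less_imp_le)
  moreover have "?S \<le> \<eta> * ?E"
    using env.overlap_bound[OF k j] by (simp add: \<eta>_def env.\<sigma>_def)
  moreover have "?E \<le> hk_norm k * hk_norm j" using hk_norm_lower[OF k] hk_norm_lower[OF j'] by (intro mult_mono) (auto simp: hk_norm_def)
  then have "\<eta> * ?E \<le> \<eta> * (hk_norm k * hk_norm j)" using \<eta>_nonneg by (intro mult_left_mono)
  ultimately have "0 \<le> kern.ip (hk_unit k) (hk_unit j)" "kern.ip (hk_unit k) (hk_unit j) \<le> \<eta>"
    using hk_norm_pos[OF k] hk_norm_pos[OF j'] by (simp_all add: pos_divide_le_eq)
  then show ?thesis by simp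
qed

lemma hk_at_minima:
  "k \<in> {1..q} \<Longrightarrow> hk w N x k (x k) = 1" "k \<in> {1..q} \<Longrightarrow> j \<in> {1..<k} \<Longrightarrow> hk w N x k (x j) = 0"
proof -
  show "k \<in> {1..q} \<Longrightarrow> hk w N x k (x k) = 1" by (simp add: hk_def)
  assume k: "k \<in> {1..q}" and j: "j \<in> {1..<k}"
  then have "x j \<noteq> x k" using x_bij by (auto simp: bij_betw_def inj_on_eq_iff)
  moreover have "x j \<in> bdry_minima x (k - 1)" using j by (auto simp: bdry_minima_def)
  ultimately show "hk w N x k (x j) = 0" by (simp add: hk_def)
qed

lemma quasi_eigenbasis:
  "quasi_eigenbasis I (mu w N) (gen_entry w N) q x hk_unit \<rho> gap_eig \<eta> \<eta>"
proof
  show "1 \<le> q" by (rule q_pos)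
  show "k \<in> {1..q} \<Longrightarrow> x k \<in> I" for k using M_subset x_image by auto
  show "inj_on x {1..q}" using x_bij by (simp add: bij_betw_def)
  show "hk_unit k (x j) = 0" if "k \<in> {1..q}" "j \<in> {1..<k}" for k j
    using hk_at_minima(2)[OF that] by (simp add: hk_unit_def)
  show "hk_unit k (x k) \<noteq> 0" if "k \<in> {1..q}" for k
    using hk_at_minima(1)[OF that] hk_norm_pos[OF that] by (simp add: hk_unit_def)
  show "kern.ip (hk_unit k) (hk_unit k) = 1" if "k \<in> {1..q}" for k
  proof -
    have "kern.ip (hk w N x k) (hk w N x k) = hk_norm k * hk_norm k"
      using kern.nrm_power2[of "hk w N x k"] by (simp add: hk_norm_def power2_eq_square)
    then show ?thesis
      unfolding hk_unit_eq kern.ip_scale_left kern.ip_scale_right using hk_norm_pos[OF that] by simp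
  qed
  show "\<bar>kern.ip (hk_unit i) (hk_unit j)\<bar> \<le> \<eta>" if ij: "i \<in> {1..q}" "j \<in> {1..q}" "i \<noteq> j" for i j
  proof (cases "i < j")
    case True
    then show ?thesis using ij by (intro hk_unit_overlap) auto
  next
    case False
    then have "\<bar>kern.ip (hk_unit j) (hk_unit i)\<bar> \<le> \<eta>" using ij by (intro hk_unit_overlap) auto
    then show ?thesis by (simp only: kern.ip_commute[of "hk_unit i"])
  qed
  show "kern.form (hk_unit k) (hk_unit k) = \<rho> k" if k: "k \<in> {1..q}" for k
    unfolding hk_unit_eq kern.form_scale_left kern.form_scale_right form_hk[OF k k] \<rho>_def
    by (simp add: hk_norm_power2[OF k, symmetric] env.cap_def power2_eq_square)
  show "kern.form (hk_unit i) (hk_unit j) = 0" if ij: "i \<in> {1..q}" "j \<in> {1..q}" "i \<noteq> j" for i j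
  proof -
    have "energy (e i) (e j) = 0"
    proof (cases "i < j")
      case True
      then show ?thesis using env.energy_orthogonal ij by blast
    next
      case False
      then have "energy (e j) (e i) = 0" using env.energy_orthogonal[of j i] ij by simp
      then show ?thesis by (simp only: energy_commute[of "e i"])
    qed
    then show ?thesis unfolding hk_unit_eq kern.form_scale_left kern.form_scale_right form_hk[OF ij(1,2)] by simp
  qed
  show "kern.form (hk_unit k) g = 0" if k: "k \<in> {1..q}" and g: "\<And>i. i \<in> {1..q} \<Longrightarrow> g (x i) = 0" for k g
  proof -
    have "energy (e k) (ext g) = 0"
    proof (rule e_harmonic[OF k])
      fix z assume "z \<in> bd k"
      moreover have "bd k \<subseteq> bd q" using k by (intro bd_mono) auto
      ultimately have "z \<in> bd q" by blast
      then show "ext g z = 0" using g by (intro ext_zero_on_bd) auto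
    qed
    then show ?thesis unfolding hk_unit_eq kern.form_scale_left form_hk_left[OF k] by simp
  qed
  show "gap_eig * kern.ip g g \<le> kern.form g g" if "\<And>i. i \<in> {1..q} \<Longrightarrow> g (x i) = 0" for g
    using that by (rule gap_variational)
  show "k \<in> {1..q} \<Longrightarrow> 0 < \<rho> k" for k by (rule \<rho>_pos)
  show "\<rho> k \<le> \<eta> * \<rho> (Suc k)" if k: "k \<in> {1..<q}" for k
  proof (rule separation)
    have k': "k \<in> {1..q}" "Suc k \<in> {1..q}" using k by auto
    have "0 < h * sqrt (real N)" "0 < \<delta> * sqrt (real N)" using N h_pos \<delta>_pos by simp_all
    then show "0 \<le> well_depth (Suc k)" using H_depth[OF k'(2)] unfolding well_depth_def by linarith
    show "\<rho> k \<le> 2 * K * exp (- well_depth k)" by (rule \<rho>_upper[OF k'(1)])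
    show "exp (- well_depth (Suc k)) \<le> 4 * (real N)\<^sup>2 * K * \<rho> (Suc k)" by (rule \<rho>_lower[OF k'(2)])
    show "well_depth (Suc k) + \<delta> * sqrt (real N) \<le> well_depth k" using H_step[OF k] by (simp add: well_depth_def)
    show "0 < \<rho> (Suc k)" by (rule \<rho>_pos[OF k'(2)])
  qed
  show "\<rho> q \<le> \<eta> * gap_eig"
  proof (rule separation)
    have k': "q \<in> {1..q}" using q_pos by auto
    show "0 \<le> h * sqrt (real N)" using h_pos by simp
    show "\<rho> q \<le> 2 * K * exp (- well_depth q)" by (rule \<rho>_upper[OF k'])
    show "exp (- (h * sqrt (real N))) \<le> 4 * (real N)\<^sup>2 * K * gap_eig" by (rule gap_lower)
    show "h * sqrt (real N) + \<delta> * sqrt (real N) \<le> well_depth q" using H_depth[OF k'] by (simp add: well_depth_def)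
    show "0 < gap_eig" by (rule gap_pos)
  qed
  show "real q * \<eta> \<le> 1 / 8" by (rule \<eta>_le(1))
  show "\<eta> \<le> 1 / 8" using \<eta>_le(2) by simp
qed (rule \<eta>_nonneg)+

lemma saddle_depth:
  "k \<in> {1..q} \<Longrightarrow> sqrt (real N) * (V (saddle V {x k} (bdry_minima x (k - 1))) - V (x k)) = well_depth k"
  using depth_bdry[of k k] by (simp add: depth_def well_depth_def H_def bd_def)

lemma powr_N: "real N powr (-2) = 1 / (real N)\<^sup>2"
  using N by (simp add: powr_minus powr_numeral divide_inverse)

lemma low_lying_spectrum:
  "\<exists>l :: nat \<Rightarrow> real.
    strict_mono_on {1..q} l \<and>
    dirichlet_spectrum w N I \<inter> {0..<gap_eig} = l ` {1..q} \<and>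
    card {e \<in> dirichlet_spectrum w N I. e < gap_eig} = q \<and>
    gap_eig \<ge> \<kappa> / 8 * real N powr (-2) * exp (- h * sqrt (real N)) \<and>
    (\<forall>k\<in>{1..q}.
       (\<exists>\<epsilon>. \<bar>\<epsilon>\<bar> \<le> 1 * exp (- (\<delta> / 10) * sqrt (real N)) \<and>
          l k = mu w N (x k) * hits_before w N (x k) (bdry_minima x (k - 1)) {x k}
                / (norm2 w N (hk w N x k))\<^sup>2 * (1 + \<epsilon>)) \<and>
       \<kappa> / 8 * real N powr (-2)
         * exp (- sqrt (real N) * (V (saddle V {x k} (bdry_minima x (k - 1))) - V (x k))) \<le> l k \<and>
       l k \<le> 4 / \<kappa> * exp (- sqrt (real N) * (V (saddle V {x k} (bdry_minima x (k - 1))) - V (x k))) \<and>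
       (\<exists>\<psi>. dirichlet_eigenvector w N I (l k) \<psi> \<and> norm2 w N \<psi> = 1 \<and>
          norm2 w N (\<lambda>y. \<psi> y - hk w N x k y / norm2 w N (hk w N x k))
            \<le> exp (- (\<delta> / 10) * sqrt (real N))))"
proof -
  interpret qe: quasi_eigenbasis I "mu w N" "gen_entry w N" q x hk_unit \<rho> gap_eig \<eta> \<eta>
    by (rule quasi_eigenbasis)
  obtain l \<psi> where lp: "strict_mono_on {1..q} l \<and>
    {e. (\<exists>f. kern.eigvec e f) \<and> e < gap_eig} = l ` {1..q} \<and>
    (\<forall>k\<in>{1..q}. \<bar>l k / \<rho> k - 1\<bar> \<le> 2 * (real q * \<eta> + \<eta>) \<and> kern.eigvec (l k) (\<psi> k) \<and>
      kern.ip (\<psi> k) (\<psi> k) = 1 \<and> kern.nrm (\<lambda>y. \<psi> k y - hk_unit k y) \<le> 10 * real q * (real q * \<eta> + \<eta>))"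
    using qe.low_spectrum by (elim exE) (rule that)
  have l: "strict_mono_on {1..q} l"
    "{e. (\<exists>f. kern.eigvec e f) \<and> e < gap_eig} = l ` {1..q}"
    "\<And>k. k \<in> {1..q} \<Longrightarrow> \<bar>l k / \<rho> k - 1\<bar> \<le> 2 * (real q * \<eta> + \<eta>)"
    "\<And>k. k \<in> {1..q} \<Longrightarrow> kern.eigvec (l k) (\<psi> k)" "\<And>k. k \<in> {1..q} \<Longrightarrow> kern.ip (\<psi> k) (\<psi> k) = 1"
    "\<And>k. k \<in> {1..q} \<Longrightarrow> kern.nrm (\<lambda>y. \<psi> k y - hk_unit k y) \<le> 10 * real q * (real q * \<eta> + \<eta>)"
    using lp by blast+
  have eig: "kern.eigvec = dirichlet_eigenvector w N I" by (rule eigvec_kernel) simp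
  have ratio: "\<bar>l k / \<rho> k - 1\<bar> \<le> 1 / 2" if "k \<in> {1..q}" for k
  proof -
    have "2 * (real q * \<eta> + \<eta>) \<le> 1 / 2" using \<eta>_le by argo
    with l(3)[OF that] show ?thesis by (rule order_trans)
  qed
  have l_low: "\<rho> k / 2 \<le> l k" and l_up: "l k \<le> 2 * \<rho> k" if k: "k \<in> {1..q}" for k
  proof -
    define r where "r = l k / \<rho> k"
    have "\<bar>r - 1\<bar> \<le> 1 / 2" using ratio[OF k] by (simp only: r_def)
    then have "1 / 2 \<le> r" "r \<le> 2" by linarith+
    then have "1 / 2 \<le> l k / \<rho> k" "l k / \<rho> k \<le> 2" by (simp_all only: r_def)
    then show "\<rho> k / 2 \<le> l k" "l k \<le> 2 * \<rho> k" using \<rho>_pos[OF k] by (simp_all add: field_simps)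
  qed
  have l_pos: "0 < l k" if "k \<in> {1..q}" for k using l_low[OF that] \<rho>_pos[OF that] by linarith
  have spec: "{e \<in> dirichlet_spectrum w N I. e < gap_eig} = l ` {1..q}"
    using l(2) unfolding dirichlet_spectrum_def eig by simp
  have NK2: "4 * (real N)\<^sup>2 * K > 0" using N K_ge by simp
  have low: "\<kappa> / 8 * real N powr (-2) * X \<le> y" if "X \<le> 4 * (real N)\<^sup>2 * K * (2 * y)" for X y
  proof -
    have "\<kappa> / 8 * (1 / (real N)\<^sup>2) * X \<le> \<kappa> / 8 * (1 / (real N)\<^sup>2) * (4 * (real N)\<^sup>2 * K * (2 * y))"
      using that \<kappa> by (intro mult_left_mono) auto
    also have "\<dots> = y" using N \<kappa> by (simp add: K_def)
    finally show ?thesis by (simp only: powr_N)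
  qed
  show ?thesis
  proof (rule exI[of _ l], intro conjI ballI)
    show "strict_mono_on {1..q} l" by (rule l(1))
    show "dirichlet_spectrum w N I \<inter> {0..<gap_eig} = l ` {1..q}"
    proof -
      have "dirichlet_spectrum w N I \<inter> {0..<gap_eig} = {e \<in> dirichlet_spectrum w N I. e < gap_eig} \<inter> {0..}"
        by auto
      also have "\<dots> = l ` {1..q} \<inter> {0..}" by (simp only: spec)
      also have "\<dots> = l ` {1..q}" using l_pos[THEN less_imp_le] by blast
      finally show ?thesis .
    qed
    show "card {e \<in> dirichlet_spectrum w N I. e < gap_eig} = q"
      unfolding spec using card_image[OF strict_mono_on_imp_inj_on[OF l(1)]] by simp
    show "\<kappa> / 8 * real N powr (-2) * exp (- h * sqrt (real N)) \<le> gap_eig"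
    proof (rule low)
      have "4 * (real N)\<^sup>2 * K * gap_eig \<le> 4 * (real N)\<^sup>2 * K * (2 * gap_eig)"
        using gap_pos NK2 by (intro mult_left_mono) auto
      with gap_lower have "exp (- (h * sqrt (real N))) \<le> 4 * (real N)\<^sup>2 * K * (2 * gap_eig)"
        by (rule order_trans)
      then show "exp (- h * sqrt (real N)) \<le> 4 * (real N)\<^sup>2 * K * (2 * gap_eig)"
        by (simp only: mult_minus_left)
    qed
  next
    fix k assume k: "k \<in> {1..q}"
    let ?d = "V (saddle V {x k} (bdry_minima x (k - 1))) - V (x k)"
    have d: "exp (- sqrt (real N) * ?d) = exp (- well_depth k)" using saddle_depth[OF k] by simp
    show "\<exists>\<epsilon>. \<bar>\<epsilon>\<bar> \<le> 1 * exp (- (\<delta> / 10) * sqrt (real N)) \<and>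
          l k = mu w N (x k) * hits_before w N (x k) (bdry_minima x (k - 1)) {x k}
                / (norm2 w N (hk w N x k))\<^sup>2 * (1 + \<epsilon>)"
    proof (rule exI[of _ "l k / \<rho> k - 1"], intro conjI)
      have "2 * (real q * \<eta> + \<eta>) \<le> 10 * real q * (real q * \<eta> + \<eta>)"
        using q_pos \<eta>_nonneg by (intro mult_right_mono) auto
      then show "\<bar>l k / \<rho> k - 1\<bar> \<le> 1 * exp (- (\<delta> / 10) * sqrt (real N))"
        using l(3)[OF k] small by linarith
      have "mu w N (x k) * hits_before w N (x k) (bdry_minima x (k - 1)) {x k}
                / (norm2 w N (hk w N x k))\<^sup>2 = \<rho> k"
        unfolding hits_before_escape[OF k] norm2_nrm hk_norm_def[symmetric] hk_norm_power2[OF k] by (simp add: \<rho>_def env.cap_def)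
      then show "l k = mu w N (x k) * hits_before w N (x k) (bdry_minima x (k - 1)) {x k}
                / (norm2 w N (hk w N x k))\<^sup>2 * (1 + (l k / \<rho> k - 1))"
        using \<rho>_pos[OF k] by simp
    qed
    show "\<kappa> / 8 * real N powr (-2) * exp (- sqrt (real N) * ?d) \<le> l k"
      unfolding d
    proof (rule low)
      have "4 * (real N)\<^sup>2 * K * \<rho> k \<le> 4 * (real N)\<^sup>2 * K * (2 * l k)"
        using l_low[OF k] NK2 by (intro mult_left_mono) auto
      then show "exp (- well_depth k) \<le> 4 * (real N)\<^sup>2 * K * (2 * l k)" using \<rho>_lower[OF k] by linarith
    qed
    show "l k \<le> 4 / \<kappa> * exp (- sqrt (real N) * ?d)"
      unfolding d using l_up[OF k] \<rho>_upper[OF k] by (simp add: K_def)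
    show "\<exists>\<psi>. dirichlet_eigenvector w N I (l k) \<psi> \<and> norm2 w N \<psi> = 1 \<and>
          norm2 w N (\<lambda>y. \<psi> y - hk w N x k y / norm2 w N (hk w N x k))
            \<le> exp (- (\<delta> / 10) * sqrt (real N))"
    proof (rule exI[of _ "\<psi> k"], intro conjI)
      show "dirichlet_eigenvector w N I (l k) (\<psi> k)" using l(4)[OF k] by (simp only: eig)
      show "norm2 w N (\<psi> k) = 1" using l(5)[OF k] by (simp add: norm2_nrm kern.nrm_def)
      show "norm2 w N (\<lambda>y. \<psi> k y - hk w N x k y / norm2 w N (hk w N x k)) \<le> exp (- (\<delta> / 10) * sqrt (real N))"
        using l(6)[OF k] small unfolding norm2_nrm hk_unit_def hk_norm_def by linarith
    qed
  qed
qed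

end

text \<open>With \<open>s = sqrt N\<close>, the left-hand side is at most a constant times \<open>s\<^sup>4 exp (- \<delta> s / 2)\<close>. Dividing by the
  right-hand side leaves the exponent \<open>- (2 / 5) \<delta> s\<close>, which beats every power of \<open>s\<close>.\<close>

lemma eventually_small:
  fixes \<kappa> Q \<delta> :: real
  assumes "\<kappa> > 0" "\<kappa> \<le> 1" "Q > 0" "\<delta> > 0"
  shows "\<exists>N0::nat. \<forall>N\<ge>N0. N \<ge> 1 \<longrightarrow> 10 * Q * (Q + 1) *
    (2 * real N * (1 / \<kappa>) * sqrt (4 * real N * (1 / \<kappa>) * exp (- (\<delta> * sqrt (real N)))))
    \<le> exp (- (\<delta> / 10) * sqrt (real N))"
proof -
  define c where "c = 2 / 5 * \<delta>"
  define B where "B = 80 * Q * (Q + 1) / \<kappa>\<^sup>2"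
  have c: "c > 0" and B: "B > 0" using assms by (auto simp: c_def B_def)
  have "((\<lambda>y::real. y ^ 4 / exp y) \<longlongrightarrow> 0) at_top" by (rule tendsto_power_div_exp_0)
  moreover have "0 < c ^ 4 / B" using c B by simp
  ultimately have "\<forall>\<^sub>F y in at_top. y ^ 4 / exp y < c ^ 4 / B" by (rule order_tendstoD)
  then obtain Y where Y: "\<And>y. y \<ge> Y \<Longrightarrow> y ^ 4 / exp y < c ^ 4 / B"
    by (auto simp: eventually_at_top_linorder)
  obtain N0 :: nat where N0: "(max Y 0 / c)\<^sup>2 \<le> real N0" using real_arch_simple by blast
  show ?thesis
  proof (rule exI[of _ N0], intro allI impI)
    fix N :: nat assume N: "N \<ge> N0" "N \<ge> 1"
    define s where "s = sqrt (real N)"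
    have s: "s\<^sup>2 = real N" "s \<ge> 0" by (simp_all add: s_def)
    have "(max Y 0 / c)\<^sup>2 \<le> s\<^sup>2" using N0 N s by simp
    then have "max Y 0 / c \<le> s" using s(2) by (rule power2_le_imp_le)
    then have "Y \<le> c * s" using c by (simp add: field_simps)
    from Y[OF this] have "B * (c * s) ^ 4 \<le> c ^ 4 * exp (c * s)" using B by (simp add: field_simps)
    then have "c ^ 4 * (B * s ^ 4) \<le> c ^ 4 * exp (c * s)" by (simp add: power_mult_distrib mult_ac)
    then have Bs: "B * s ^ 4 \<le> exp (c * s)" using c by simp
    let ?K = "1 / \<kappa>"
    \<comment> \<open>Since \<open>4 N / \<kappa>\<close> is at least one, its square root may be replaced by the number itself.\<close>
    have NK: "1 \<le> 4 * real N * ?K"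
    proof -
      have "1 * 1 \<le> (4 * real N) * ?K" using N assms by (intro mult_mono) auto
      then show ?thesis by simp
    qed
    have "sqrt (4 * real N * ?K * exp (- (\<delta> * s))) = sqrt (4 * real N * ?K) * exp (- (\<delta> * s) / 2)"
    proof -
      have "sqrt (exp (- (\<delta> * s))) = exp (- (\<delta> * s) / 2)"
        by (rule real_sqrt_unique) (simp_all flip: exp_double)
      then show ?thesis by (simp only: real_sqrt_mult)
    qed
    also have "\<dots> \<le> (4 * real N * ?K) * exp (- (\<delta> * s) / 2)"
    proof (rule mult_right_mono)
      have "4 * real N * ?K \<le> (4 * real N * ?K) * (4 * real N * ?K)"
        using mult_right_mono[OF NK, of "4 * real N * ?K"] NK by simp
      then have "sqrt (4 * real N * ?K) \<le> sqrt ((4 * real N * ?K)\<^sup>2)"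
        by (intro real_sqrt_le_mono) (simp add: power2_eq_square)
      then show "sqrt (4 * real N * ?K) \<le> 4 * real N * ?K" using NK by simp
    qed simp
    finally have "10 * Q * (Q + 1) * (2 * real N * ?K * sqrt (4 * real N * ?K * exp (- (\<delta> * s))))
        \<le> 10 * Q * (Q + 1) * (2 * real N * ?K * ((4 * real N * ?K) * exp (- (\<delta> * s) / 2)))"
      using assms by (intro mult_left_mono) auto
    also have "\<dots> = B * s ^ 4 * exp (- (\<delta> * s) / 2)"
    proof -
      have "s ^ 4 = real N * real N" using s(1) by (simp add: power4_eq_xxxx power2_eq_square)
      then show ?thesis by (simp add: B_def power2_eq_square)
    qed
    also have "\<dots> \<le> exp (c * s) * exp (- (\<delta> * s) / 2)" using Bs by (intro mult_right_mono) auto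
    also have "\<dots> = exp (- (\<delta> / 10) * s)" unfolding exp_add[symmetric] by (simp add: c_def field_simps)
    finally show "10 * Q * (Q + 1) *
      (2 * real N * ?K * sqrt (4 * real N * ?K * exp (- (\<delta> * sqrt (real N))))) \<le> exp (- (\<delta> / 10) * sqrt (real N))"
      unfolding s_def .
  qed
qed

theorem theorem1:
  fixes \<kappa> :: real
  assumes "\<kappa> > 0"
  shows "\<exists>c>0. \<exists>c'>0. \<forall>Q>0. \<forall>\<delta>>0. \<exists>N0::nat. \<exists>C::real.
    \<forall>(h::real) (w :: int \<Rightarrow> real) (N::nat) (x :: nat \<Rightarrow> real).
      let V = scaled_potential w N;
          M = h_minima h V;
          q = card M;
          S = bdry_minima x;
          I = lattice_interval N;
          d = (\<lambda>k. V (saddle V {x k} (S (k - 1))) - V (x k));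
          lstar = Min (dirichlet_spectrum w N (I - M));
          H = hk w N x
      in h > 0 \<and> elliptic_env \<kappa> w \<and> N \<ge> 1 \<and> N \<ge> N0 \<and> V \<in> good_paths h \<delta> \<and>
         real q \<le> Q \<and> special_labeling h \<delta> V x \<longrightarrow>
         (\<exists>l :: nat \<Rightarrow> real.
            strict_mono_on {1..q} l \<and>
            dirichlet_spectrum w N I \<inter> {0..<lstar} = l ` {1..q} \<and>
            card {e \<in> dirichlet_spectrum w N I. e < lstar} = q \<and>
            lstar \<ge> c * real N powr (-2) * exp (- h * sqrt (real N)) \<and>
            (\<forall>k\<in>{1..q}.
               (\<exists>\<epsilon>. \<bar>\<epsilon>\<bar> \<le> C * exp (- (\<delta> / 10) * sqrt (real N)) \<and>
                  l k = mu w N (x k) * hits_before w N (x k) (S (k - 1)) {x k}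
                        / (norm2 w N (H k))\<^sup>2 * (1 + \<epsilon>)) \<and>
               c * real N powr (-2) * exp (- sqrt (real N) * d k) \<le> l k \<and>
               l k \<le> c' * exp (- sqrt (real N) * d k) \<and>
               (\<exists>\<psi>. dirichlet_eigenvector w N I (l k) \<psi> \<and> norm2 w N \<psi> = 1 \<and>
                  norm2 w N (\<lambda>y. \<psi> y - H k y / norm2 w N (H k))
                    \<le> exp (- (\<delta> / 10) * sqrt (real N)))))"
proof (rule exI[of _ "\<kappa> / 8"], rule conjI, use assms in simp, rule exI[of _ "4 / \<kappa>"], rule conjI,
    use assms in simp, intro allI impI, goal_cases)
  case (1 Q \<delta>)
  show ?case
  proof (cases "\<kappa> \<le> 1")
    \<comment> \<open>No environment is elliptic with such a constant.\<close>
    case False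
    then have "\<not> elliptic_env \<kappa> w" for w by (auto simp: elliptic_env_def)
    then show ?thesis by (simp add: Let_def)
  next
    case True
    from eventually_small[OF assms True 1] obtain N0 :: nat where N0: "\<And>N. N \<ge> N0 \<Longrightarrow> N \<ge> 1 \<Longrightarrow>
      10 * Q * (Q + 1) * (2 * real N * (1 / \<kappa>) * sqrt (4 * real N * (1 / \<kappa>) * exp (- (\<delta> * sqrt (real N)))))
      \<le> exp (- (\<delta> / 10) * sqrt (real N))" by blast
    show ?thesis
      unfolding Let_def
    proof (rule exI[of _ N0], rule exI[of _ 1], intro allI impI, elim conjE, goal_cases)
      case a: (1 h w N x)
      interpret walk: metastable_walk \<kappa> h \<delta> w N x
        using assms a 1 by unfold_locales
      have q: "real walk.q \<le> Q" using a(6) by (simp add: walk.q_def walk.M_def)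
      interpret large: metastable_walk_large \<kappa> h \<delta> w N x
      proof
        have eta: "0 \<le> walk.\<eta>" using walk.K_ge by (simp add: walk.\<eta>_def)
        have "10 * real walk.q * (real walk.q * walk.\<eta> + walk.\<eta>) = 10 * real walk.q * (real walk.q + 1) * walk.\<eta>"
          by (simp add: algebra_simps)
        also have "\<dots> \<le> 10 * Q * (Q + 1) * walk.\<eta>" using q 1 eta by (intro mult_mono mult_right_mono) auto
        also have "\<dots> \<le> exp (- (\<delta> / 10) * sqrt (real N))"
          using N0[OF a(4,3)] by (simp add: walk.\<eta>_def walk.K_def)
        finally show "10 * real walk.q * (real walk.q * walk.\<eta> + walk.\<eta>) \<le> exp (- (\<delta> / 10) * sqrt (real N))" .
      qed
      show ?case
        by (rule large.low_lying_spectrum[unfolded walk.gap_eig_def walk.q_def walk.M_def walk.I_def])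
    qed
  qed
qed

end
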